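(* Let $T_\alpha\subset M_{t_0}\cong\mathbb S^3_{a_0}$, $0<\alpha<\pi/2$, be the Clifford tori in the fixed time slice $t=t_0$ of the FLRW Lorentzian manifold $(\mathbb R\times\mathbb S^3,\,-dt^2+a(t)^2g_{\mathbb S^3})$. Then, for $\alpha>0$ sufficiently small, $T_\alpha$ is STCMC and area-constrained Willmore in every constant direction $V_\beta=\vec H+\beta\vec H^\star$, $\beta\in\mathbb R$. Moreover, the corresponding Lagrange multiplier satisfies $\lambda_\beta<0$ for every $|\beta|\leq1$. Finally, $T_\alpha$ is both constant-mode unstable and variationally unstable as an STCMC surface.
   Context: Setting. $a:\mathbb R\to(0,\infty)$ is smooth, $t_0\in\mathbb R$ fixed, $a_0=a(t_0)$, $\mathcal H_0=\dot a(t_0)/a(t_0)$, $M_{t_0}=\{t=t_0\}$ is identified with the round sphere $\mathbb S^3_{a_0}\subset\mathbb C^2$ of radius $a_0$; its second fundamental form is $K=\mathcal H_0g^{M_{t_0}}$ (with $K(X,Y)=\langle\nabla_Xn,Y\rangle$, $n=\partial_t$). The Clifford torus is $T_\alpha=\{(z_1,z_2)\in\mathbb S^3_{a_0}:|z_1|=a_0\cos\alpha,\ |z_2|=a_0\sin\alpha\}$, with induced metric $h$, area measure $d\mu$, and unit normal $\nu$ in $M_{t_0}$ such that its mean curvature in $M_{t_0}$ is $H=\frac1{a_0}(\tan\alpha-\cot\alpha)$; $P=\operatorname{tr}_hK=2\mathcal H_0$. The spacetime mean curvature vector is $\vec H=H\nu-Pn$ (trace of $\chi(X,Y)=-(\nabla_XY)^\perp$),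 $\vec H^\star=Hn-P\nu$, $|\vec H|^2=\langle\vec H,\vec H\rangle=H^2-P^2$. For a normal field $V$, $\delta_V$ denotes the derivative at time $0$ along a smooth variation of the surface with initial velocity $V$. For a nowhere-vanishing normal field $V$, a closed spacelike surface $\Sigma$ is area-constrained Willmore in the direction $V$ if it is critical for $\int_\Sigma|\vec H|^2\,d\mu$ under all area-preserving normal variations of the form $\phi V$, $\phi\in C^\infty(\Sigma)$; equivalently, there is a constant $\lambda$ (the Lagrange multiplier; denoted $\lambda_\beta$ for $V=V_\beta$) with $\delta_{\phi V}\int_\Sigma|\vec H|^2\,d\mu=\lambda\,\delta_{\phi V}|\Sigma|$ for all $\phi$. A surface is STCMC (spacetime constant mean curvature) if $|\vec H|^2$ is constant. Let $W$ be the function defined by $\delta_{\phi\vec H}\int_\Sigma|\vec H|^2d\mu=\int_\Sigma\phi W\,d\mu$ for all smooth $\phi$. For an STCMC surface the relevant second variation of area is $\delta^2_{u\vec H}|\Sigma|=\int_\Sigma\big(2|\vec H|^2|\nabla^hu|^2+Wu^2\big)\,d\mu$. The surface is constant-mode unstable if $\delta^2_{\vec H}|\Sigma|=\int_\Sigma W\,d\mu<0$, and variationally unstable if there is $u\in C^\infty(\Sigma)$ with $\int_\Sigma u\,d\mu=0$ and $\delta^2_{u\vec H}|\Sigma|<0$. *)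

theory Defs
  imports "HOL-Analysis.Analysis"
begin

section \<open>Smooth maps\<close>

abbreviation dirderiv :: "'a::real_normed_vector \<Rightarrow> ('a \<Rightarrow> 'b::real_normed_vector) \<Rightarrow> 'a \<Rightarrow> 'b"
  where "dirderiv v f p \<equiv> frechet_derivative f (at p) v"

text \<open>Intended for an open set in a finite-dimensional space, where continuity of all iterated
  directional derivatives is the usual notion of class \<open>C^k\<close>.\<close>

primrec C_on :: "nat \<Rightarrow> 'a::real_normed_vector set \<Rightarrow> ('a \<Rightarrow> 'b::real_normed_vector) \<Rightarrow> bool" where
  "C_on 0 S f \<longleftrightarrow> continuous_on S f"
| "C_on (Suc k) S f \<longleftrightarrow>
     (\<forall>p\<in>S. f differentiable (at p)) \<and> (\<forall>v. C_on k S (dirderiv v f))"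

definition smooth_on :: "'a::real_normed_vector set \<Rightarrow> ('a \<Rightarrow> 'b::real_normed_vector) \<Rightarrow> bool" where
  "smooth_on S f \<longleftrightarrow> (\<forall>k. C_on k S f)"

section \<open>The FLRW spacetime\<close>

text \<open>The manifold \<open>R \<times> S^3\<close> is realised inside \<open>R \<times> C^2\<close>, with \<open>S^3\<close> the unit sphere. Tangent
  vectors at \<open>(t, x)\<close> are the pairs \<open>(\<tau>, \<xi>)\<close> with \<open>\<xi>\<close> orthogonal to \<open>x\<close>. The factor \<open>a(t)\<close> sits in the
  metric, so the slice at time \<open>t\<close> is identified with the round sphere of radius \<open>a(t)\<close>
  via \<open>(t, x) \<mapsto> a(t) x\<close>.\<close>

type_synonym spacetime = "real \<times> complex \<times> complex"

definition FLRW :: "spacetime set" where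
  "FLRW = {q. norm (snd q) = 1}"

definition tangent :: "spacetime \<Rightarrow> spacetime \<Rightarrow> bool" where
  "tangent q X \<longleftrightarrow> snd q \<bullet> snd X = 0"

definition flrw_metric :: "(real \<Rightarrow> real) \<Rightarrow> spacetime \<Rightarrow> spacetime \<Rightarrow> spacetime \<Rightarrow> real" where
  "flrw_metric a q X Y = - (fst X * fst Y) + (a (fst q))\<^sup>2 * (snd X \<bullet> snd Y)"

section \<open>Parametrised tori\<close>

text \<open>Surfaces of torus type, and functions and vector fields on them, are doubly periodic maps
  on the plane.\<close>

type_synonym param = "real \<times> real"

definition doubly_periodic :: "(param \<Rightarrow> 'b) \<Rightarrow> bool" where
  "doubly_periodic f \<longleftrightarrow>
     (\<forall>x y. f (x + 2 * pi, y) = f (x, y) \<and> f (x, y + 2 * pi) = f (x, y))"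

definition torus_smooth :: "(param \<Rightarrow> 'b::real_normed_vector) \<Rightarrow> bool" where
  "torus_smooth f \<longleftrightarrow> smooth_on UNIV f \<and> doubly_periodic f"

definition induced_metric ::
    "(real \<Rightarrow> real) \<Rightarrow> (param \<Rightarrow> spacetime) \<Rightarrow> param \<Rightarrow> param \<Rightarrow> param \<Rightarrow> real" where
  "induced_metric a F p v w = flrw_metric a (F p) (dirderiv v F p) (dirderiv w F p)"

definition spacelike_torus :: "(real \<Rightarrow> real) \<Rightarrow> (param \<Rightarrow> spacetime) \<Rightarrow> bool" where
  "spacelike_torus a F \<longleftrightarrow> torus_smooth F \<and> range F \<subseteq> FLRW \<and>
     (\<forall>p v. v \<noteq> 0 \<longrightarrow> induced_metric a F p v v > 0)"

abbreviation e1 :: param where "e1 \<equiv> (1, 0)"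
abbreviation e2 :: param where "e2 \<equiv> (0, 1)"

definition gram_det :: "(real \<Rightarrow> real) \<Rightarrow> (param \<Rightarrow> spacetime) \<Rightarrow> param \<Rightarrow> real" where
  "gram_det a F p = induced_metric a F p e1 e1 * induced_metric a F p e2 e2
     - induced_metric a F p e1 e2 * induced_metric a F p e2 e1"

text \<open>The trace \<open>h^{ij} B(e_i, e_j)\<close> of a bilinear form on the parameter plane, with the inverse
  of the 2 by 2 matrix \<open>h\<close> written out.\<close>

definition tr_h ::
    "(real \<Rightarrow> real) \<Rightarrow> (param \<Rightarrow> spacetime) \<Rightarrow> param \<Rightarrow> (param \<Rightarrow> param \<Rightarrow> 'b::real_vector) \<Rightarrow> 'b" where
  "tr_h a F p B = (1 / gram_det a F p) *\<^sub>R
     (induced_metric a F p e2 e2 *\<^sub>R B e1 e1 - induced_metric a F p e1 e2 *\<^sub>R B e1 e2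
      - induced_metric a F p e2 e1 *\<^sub>R B e2 e1 + induced_metric a F p e1 e1 *\<^sub>R B e2 e2)"

definition surface_integral ::
    "(real \<Rightarrow> real) \<Rightarrow> (param \<Rightarrow> spacetime) \<Rightarrow> (param \<Rightarrow> real) \<Rightarrow> real" where
  "surface_integral a F f =
     integral (cbox (0, 0) (2 * pi, 2 * pi)) (\<lambda>p. f p * sqrt (gram_det a F p))"

definition area :: "(real \<Rightarrow> real) \<Rightarrow> (param \<Rightarrow> spacetime) \<Rightarrow> real" where
  "area a F = surface_integral a F (\<lambda>p. 1)"

section \<open>Levi-Civita connection and extrinsic geometry\<close>

text \<open>Covariant derivative, in the coordinate direction \<open>v\<close>, of a vector field \<open>Y\<close> along \<open>F\<close>. Writing
  \<open>(\<tau>, \<xi>)\<close> for the derivative of \<open>F\<close> and \<open>Y = (\<eta>, y)\<close>, the Levi-Civita connection of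
  \<open>-dt^2 + a^2 g_{S^3}\<close> gives
  \<open>(\<partial>\<eta> + a a' \<langle>\<xi>, y\<rangle>, (\<partial>y)^T + (a'/a) (\<tau> y + \<eta> \<xi>))\<close>, where the projection to the tangent space
  of the unit sphere at \<open>x\<close> is \<open>(\<partial>y)^T = \<partial>y + \<langle>\<xi>, y\<rangle> x\<close>. The lemmas \<open>tangent_cov_deriv\<close>,
  \<open>cov_deriv_torsion_free\<close> and \<open>cov_deriv_metric\<close> below show the characterising properties.\<close>

definition cov_deriv ::
    "(real \<Rightarrow> real) \<Rightarrow> (param \<Rightarrow> spacetime) \<Rightarrow> param \<Rightarrow> (param \<Rightarrow> spacetime) \<Rightarrow> param \<Rightarrow> spacetime" where
  "cov_deriv a F v Y p =
     (let t = fst (F p); x = snd (F p);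
          \<tau> = fst (dirderiv v F p); \<xi> = snd (dirderiv v F p);
          \<eta> = fst (Y p); y = snd (Y p)
      in (fst (dirderiv v Y p) + a t * deriv a t * (\<xi> \<bullet> y),
          snd (dirderiv v Y p) + (\<xi> \<bullet> y) *\<^sub>R x + (deriv a t / a t) *\<^sub>R (\<tau> *\<^sub>R y + \<eta> *\<^sub>R \<xi>)))"

definition normal_part ::
    "(real \<Rightarrow> real) \<Rightarrow> (param \<Rightarrow> spacetime) \<Rightarrow> param \<Rightarrow> spacetime \<Rightarrow> spacetime" where
  "normal_part a F p X =
     X - tr_h a F p (\<lambda>v w. flrw_metric a (F p) X (dirderiv v F p) *\<^sub>R dirderiv w F p)"

definition second_ff ::
    "(real \<Rightarrow> real) \<Rightarrow> (param \<Rightarrow> spacetime) \<Rightarrow> param \<Rightarrow> param \<Rightarrow> param \<Rightarrow> spacetime" where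
  "second_ff a F p v w = - normal_part a F p (cov_deriv a F v (dirderiv w F) p)"

definition vecH :: "(real \<Rightarrow> real) \<Rightarrow> (param \<Rightarrow> spacetime) \<Rightarrow> param \<Rightarrow> spacetime" where
  "vecH a F p = tr_h a F p (second_ff a F p)"

definition vecH_sq :: "(real \<Rightarrow> real) \<Rightarrow> (param \<Rightarrow> spacetime) \<Rightarrow> param \<Rightarrow> real" where
  "vecH_sq a F p = flrw_metric a (F p) (vecH a F p) (vecH a F p)"

definition willmore :: "(real \<Rightarrow> real) \<Rightarrow> (param \<Rightarrow> spacetime) \<Rightarrow> real" where
  "willmore a F = surface_integral a F (vecH_sq a F)"

text \<open>The trace of \<open>(X, Y) \<mapsto> \<langle>\<nabla>_X \<nu>, Y\<rangle>\<close> over the surface. For a surface in a time slice this is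
  the mean curvature \<open>H\<close> in the slice when \<open>\<nu>\<close> is its unit normal there, and \<open>P = tr_h K\<close> when
  \<open>\<nu> = n = \<partial>_t\<close>.\<close>

definition mean_curv ::
    "(real \<Rightarrow> real) \<Rightarrow> (param \<Rightarrow> spacetime) \<Rightarrow> (param \<Rightarrow> spacetime) \<Rightarrow> param \<Rightarrow> real" where
  "mean_curv a F \<nu> p =
     tr_h a F p (\<lambda>v w. flrw_metric a (F p) (cov_deriv a F v \<nu> p) (dirderiv w F p))"

definition d_t :: "param \<Rightarrow> spacetime" where
  "d_t p = (1, 0, 0)"

definition vecH_star ::
    "(real \<Rightarrow> real) \<Rightarrow> (param \<Rightarrow> spacetime) \<Rightarrow> (param \<Rightarrow> spacetime) \<Rightarrow> param \<Rightarrow> spacetime" where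
  "vecH_star a F \<nu> p = mean_curv a F \<nu> p *\<^sub>R d_t p - mean_curv a F d_t p *\<^sub>R \<nu> p"

definition normal_field ::
    "(real \<Rightarrow> real) \<Rightarrow> (param \<Rightarrow> spacetime) \<Rightarrow> (param \<Rightarrow> spacetime) \<Rightarrow> bool" where
  "normal_field a F V \<longleftrightarrow> torus_smooth V \<and>
     (\<forall>p. tangent (F p) (V p) \<and> (\<forall>v. flrw_metric a (F p) (V p) (dirderiv v F p) = 0))"

section \<open>Variations\<close>

definition variation ::
    "(param \<Rightarrow> spacetime) \<Rightarrow> (param \<Rightarrow> spacetime) \<Rightarrow> (real \<Rightarrow> param \<Rightarrow> spacetime) \<Rightarrow> bool" where
  "variation F V \<Phi> \<longleftrightarrow>
     (\<exists>\<epsilon>>0. smooth_on ({-\<epsilon><..<\<epsilon>} \<times> UNIV) (\<lambda>(s, p). \<Phi> s p) \<and>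
            (\<forall>s\<in>{-\<epsilon><..<\<epsilon>}. doubly_periodic (\<Phi> s) \<and> range (\<Phi> s) \<subseteq> FLRW)) \<and>
     \<Phi> 0 = F \<and>
     (\<forall>p. ((\<lambda>s. \<Phi> s p) has_vector_derivative V p) (at 0))"

text \<open>\<open>\<delta>_V J = d\<close>: the derivative at time 0 is \<open>d\<close> along every smooth variation with initial
  velocity \<open>V\<close>. Existence of such a variation is required so that the condition is never vacuous.\<close>

definition has_first_variation ::
    "((param \<Rightarrow> spacetime) \<Rightarrow> real) \<Rightarrow> (param \<Rightarrow> spacetime) \<Rightarrow> (param \<Rightarrow> spacetime) \<Rightarrow> real \<Rightarrow> bool" where
  "has_first_variation J F V d \<longleftrightarrow>
     (\<exists>\<Phi>. variation F V \<Phi>) \<and>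
     (\<forall>\<Phi>. variation F V \<Phi> \<longrightarrow> ((\<lambda>s. J (\<Phi> s)) has_real_derivative d) (at 0))"

definition area_constrained_willmore ::
    "(real \<Rightarrow> real) \<Rightarrow> (param \<Rightarrow> spacetime) \<Rightarrow> (param \<Rightarrow> spacetime) \<Rightarrow> bool" where
  "area_constrained_willmore a F V \<longleftrightarrow>
     spacelike_torus a F \<and> normal_field a F V \<and> (\<forall>p. V p \<noteq> 0) \<and>
     (\<forall>\<phi> \<Phi>. torus_smooth \<phi> \<and> variation F (\<lambda>p. \<phi> p *\<^sub>R V p) \<Phi> \<and>
             (\<forall>\<^sub>F s in nhds 0. area a (\<Phi> s) = area a F)
         \<longrightarrow> ((\<lambda>s. willmore a (\<Phi> s)) has_real_derivative 0) (at 0))"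

definition lagrange_multiplier ::
    "(real \<Rightarrow> real) \<Rightarrow> (param \<Rightarrow> spacetime) \<Rightarrow> (param \<Rightarrow> spacetime) \<Rightarrow> real \<Rightarrow> bool" where
  "lagrange_multiplier a F V l \<longleftrightarrow>
     (\<forall>\<phi>. torus_smooth \<phi> \<longrightarrow>
        (\<exists>d. has_first_variation (area a) F (\<lambda>p. \<phi> p *\<^sub>R V p) d \<and>
             has_first_variation (willmore a) F (\<lambda>p. \<phi> p *\<^sub>R V p) (l * d)))"

section \<open>STCMC surfaces and stability\<close>

definition stcmc :: "(real \<Rightarrow> real) \<Rightarrow> (param \<Rightarrow> spacetime) \<Rightarrow> bool" where
  "stcmc a F \<longleftrightarrow> spacelike_torus a F \<and> (\<exists>c. \<forall>p. vecH_sq a F p = c)"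

text \<open>\<open>W\<close> is the function determined by \<open>\<delta>_{\<phi> H} \<integral> |H|^2 d\<mu> = \<integral> \<phi> W d\<mu>\<close> for all smooth \<open>\<phi>\<close>.\<close>

definition willmore_gradient ::
    "(real \<Rightarrow> real) \<Rightarrow> (param \<Rightarrow> spacetime) \<Rightarrow> (param \<Rightarrow> real) \<Rightarrow> bool" where
  "willmore_gradient a F W \<longleftrightarrow> torus_smooth W \<and>
     (\<forall>\<phi>. torus_smooth \<phi> \<longrightarrow>
        has_first_variation (willmore a) F (\<lambda>p. \<phi> p *\<^sub>R vecH a F p)
          (surface_integral a F (\<lambda>p. \<phi> p * W p)))"

definition grad_sq :: "(real \<Rightarrow> real) \<Rightarrow> (param \<Rightarrow> spacetime) \<Rightarrow> (param \<Rightarrow> real) \<Rightarrow> param \<Rightarrow> real" where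
  "grad_sq a F u p = tr_h a F p (\<lambda>v w. dirderiv v u p * dirderiv w u p)"

definition second_variation ::
    "(real \<Rightarrow> real) \<Rightarrow> (param \<Rightarrow> spacetime) \<Rightarrow> (param \<Rightarrow> real) \<Rightarrow> (param \<Rightarrow> real) \<Rightarrow> real" where
  "second_variation a F W u =
     surface_integral a F (\<lambda>p. 2 * vecH_sq a F p * grad_sq a F u p + W p * (u p)\<^sup>2)"

definition constant_mode_unstable :: "(real \<Rightarrow> real) \<Rightarrow> (param \<Rightarrow> spacetime) \<Rightarrow> bool" where
  "constant_mode_unstable a F \<longleftrightarrow> stcmc a F \<and>
     (\<exists>W. willmore_gradient a F W \<and> second_variation a F W (\<lambda>p. 1) < 0)"

definition variationally_unstable :: "(real \<Rightarrow> real) \<Rightarrow> (param \<Rightarrow> spacetime) \<Rightarrow> bool" where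
  "variationally_unstable a F \<longleftrightarrow> stcmc a F \<and>
     (\<exists>W u. willmore_gradient a F W \<and> torus_smooth u \<and> surface_integral a F u = 0 \<and>
            second_variation a F W u < 0)"

section \<open>Clifford tori\<close>

definition clifford_torus :: "real \<Rightarrow> real \<Rightarrow> (complex \<times> complex) set" where
  "clifford_torus r \<alpha> = {(z1, z2). (z1, z2) \<in> sphere 0 r \<and>
     cmod z1 = r * cos \<alpha> \<and> cmod z2 = r * sin \<alpha>}"

text \<open>The angular parametrisation of the Clifford torus in the slice at time \<open>t0\<close>;
  see \<open>clifford_image\<close> and \<open>clifford_inj\<close>.\<close>

definition clifford :: "real \<Rightarrow> real \<Rightarrow> param \<Rightarrow> spacetime" where
  "clifford t0 \<alpha> = (\<lambda>(x, y). (t0, cos \<alpha> *\<^sub>R cis x, sin \<alpha> *\<^sub>R cis y))"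

text \<open>The unit normal in the slice whose mean curvature is \<open>(tan \<alpha> - cot \<alpha>) / a(t0)\<close>;
  see \<open>clifford_normal_unit\<close> and \<open>clifford_mean_curv\<close>.\<close>

definition clifford_normal :: "(real \<Rightarrow> real) \<Rightarrow> real \<Rightarrow> real \<Rightarrow> param \<Rightarrow> spacetime" where
  "clifford_normal a t0 \<alpha> =
     (\<lambda>(x, y). (0, (1 / a t0) *\<^sub>R (sin \<alpha> *\<^sub>R cis x, - cos \<alpha> *\<^sub>R cis y)))"

definition V_dir :: "(real \<Rightarrow> real) \<Rightarrow> real \<Rightarrow> real \<Rightarrow> real \<Rightarrow> param \<Rightarrow> spacetime" where
  "V_dir a t0 \<alpha> \<beta> p = vecH a (clifford t0 \<alpha>) p
     + \<beta> *\<^sub>R vecH_star a (clifford t0 \<alpha>) (clifford_normal a t0 \<alpha>) p"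

section \<open>Consistency of the definitions\<close>

lemma tangent_cov_deriv:
  assumes "\<And>q. F q \<in> FLRW" and "\<And>q. tangent (F q) (Y q)"
    and F: "F differentiable (at p)" and Y: "Y differentiable (at p)"
  shows "tangent (F p) (cov_deriv a F v Y p)"
proof -
  let ?F' = "frechet_derivative F (at p)" and ?Y' = "frechet_derivative Y (at p)"
  have dF: "(F has_derivative ?F') (at p)" and dY: "(Y has_derivative ?Y') (at p)"
    using F Y frechet_derivative_works by blast+
  have const: "G' v = 0" if "(G has_derivative G') (at p)" "\<And>q. G q = c"
    for G :: "param \<Rightarrow> real" and G' c
  proof -
    have "G = (\<lambda>q. c)" using that(2) by blast
    then have "((\<lambda>q. c) has_derivative G') (at p)" using that(1) by simp
    then show ?thesis
      using has_derivative_unique[OF _ has_derivative_const] by fastforce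
  qed
  have n1: "snd (F q) \<bullet> snd (F q) = 1" for q
    using assms(1)[of q] by (simp add: FLRW_def dot_square_norm)
  have 1: "snd (F p) \<bullet> snd (?Y' v) + snd (?F' v) \<bullet> snd (Y p) = 0"
    using assms(2) has_derivative_inner[OF has_derivative_snd[OF dF] has_derivative_snd[OF dY]]
    by (intro const[where c = 0]) (auto simp: tangent_def)
  have "snd (F p) \<bullet> snd (?F' v) + snd (?F' v) \<bullet> snd (F p) = 0"
    using n1 has_derivative_inner[OF has_derivative_snd[OF dF] has_derivative_snd[OF dF]]
    by (intro const[where c = 1]) auto
  then have 2: "snd (F p) \<bullet> snd (?F' v) = 0" by (simp add: inner_commute)
  show ?thesis
    using 1 2 n1[of p] assms(2)[of p]
    by (simp add: tangent_def cov_deriv_def Let_def inner_add_right)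
qed

lemma cov_deriv_torsion_free:
  assumes "dirderiv v (dirderiv w F) p = dirderiv w (dirderiv v F) p"
  shows "cov_deriv a F v (dirderiv w F) p = cov_deriv a F w (dirderiv v F) p"
  using assms by (simp add: cov_deriv_def Let_def inner_commute add.commute)

lemma cov_deriv_metric:
  assumes "tangent (F p) (Y p)" "tangent (F p) (Z p)"
    and F: "F differentiable (at p)" and Y: "Y differentiable (at p)" and Z: "Z differentiable (at p)"
    and a: "a differentiable (at (fst (F p)))" and pos: "a (fst (F p)) \<noteq> 0"
  shows "dirderiv v (\<lambda>q. flrw_metric a (F q) (Y q) (Z q)) p
    = flrw_metric a (F p) (cov_deriv a F v Y p) (Z p) + flrw_metric a (F p) (Y p) (cov_deriv a F v Z p)"
proof -
  let ?F' = "frechet_derivative F (at p)" and ?Y' = "frechet_derivative Y (at p)"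
    and ?Z' = "frechet_derivative Z (at p)" and ?t = "fst (F p)"
  have dF: "(F has_derivative ?F') (at p)" and dY: "(Y has_derivative ?Y') (at p)"
    and dZ: "(Z has_derivative ?Z') (at p)"
    using F Y Z frechet_derivative_works by blast+
  have da: "(a has_real_derivative deriv a ?t) (at ?t)"
    using a DERIV_deriv_iff_real_differentiable by blast
  have dt: "((\<lambda>q. fst (F q)) has_derivative (\<lambda>v. fst (?F' v))) (at p)"
    by (rule has_derivative_fst[OF dF])
  have daF: "((\<lambda>q. a (fst (F q))) has_derivative (\<lambda>v. fst (?F' v) * deriv a ?t)) (at p)"
    by (rule DERIV_compose_FDERIV[OF da dt])
  have "((\<lambda>q. flrw_metric a (F q) (Y q) (Z q)) has_derivative
     (\<lambda>v. - (fst (?Y' v) * fst (Z p) + fst (Y p) * fst (?Z' v))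
        + (2 * a ?t * deriv a ?t * fst (?F' v) * (snd (Y p) \<bullet> snd (Z p))
        + (a ?t)\<^sup>2 * (snd (?Y' v) \<bullet> snd (Z p) + snd (Y p) \<bullet> snd (?Z' v))))) (at p)"
    unfolding flrw_metric_def
    by (rule derivative_eq_intros dF dY dZ daF refl | simp add: fun_eq_iff algebra_simps)+
  then have "dirderiv v (\<lambda>q. flrw_metric a (F q) (Y q) (Z q)) p =
      - (fst (?Y' v) * fst (Z p) + fst (Y p) * fst (?Z' v))
        + (2 * a ?t * deriv a ?t * fst (?F' v) * (snd (Y p) \<bullet> snd (Z p))
        + (a ?t)\<^sup>2 * (snd (?Y' v) \<bullet> snd (Z p) + snd (Y p) \<bullet> snd (?Z' v)))"
    by (simp add: frechet_derivative_at[symmetric])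
  then show ?thesis
    using assms(1,2) pos
    by (simp add: flrw_metric_def cov_deriv_def Let_def tangent_def inner_add_left inner_add_right
        inner_commute algebra_simps power2_eq_square)
qed

lemma clifford_image:
  assumes r: "r > 0" and "0 < \<alpha>" "\<alpha> < pi / 2"
  shows "(\<lambda>p. r *\<^sub>R snd (clifford t0 \<alpha> p)) ` UNIV = clifford_torus r \<alpha>"
proof (intro set_eqI iffI)
  have c: "cos \<alpha> > 0" "sin \<alpha> > 0"
    using assms by (auto intro: cos_gt_zero sin_gt_zero)
  fix z assume "z \<in> (\<lambda>p. r *\<^sub>R snd (clifford t0 \<alpha> p)) ` UNIV"
  then obtain p where "z = r *\<^sub>R snd (clifford t0 \<alpha> p)" by blast
  then have z: "z = (r *\<^sub>R cos \<alpha> *\<^sub>R cis (fst p), r *\<^sub>R sin \<alpha> *\<^sub>R cis (snd p))"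
    by (simp add: clifford_def split_beta)
  have "norm z = r"
    using r c by (simp add: z norm_Pair power_mult_distrib flip: distrib_left)
  then show "z \<in> clifford_torus r \<alpha>"
    using r c by (simp add: clifford_torus_def z)
next
  have c: "cos \<alpha> > 0" "sin \<alpha> > 0"
    using assms by (auto intro: cos_gt_zero sin_gt_zero)
  fix z assume "z \<in> clifford_torus r \<alpha>"
  then obtain z1 z2 where z: "z = (z1, z2)" "cmod z1 = r * cos \<alpha>" "cmod z2 = r * sin \<alpha>"
    by (auto simp: clifford_torus_def)
  have "z1 = r *\<^sub>R cos \<alpha> *\<^sub>R cis (Arg z1)" "z2 = r *\<^sub>R sin \<alpha> *\<^sub>R cis (Arg z2)"
    using z(2,3) rcis_cmod_Arg[of z1] rcis_cmod_Arg[of z2] by (simp_all add: rcis_def scaleR_conv_of_real mult.assoc)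
  then show "z \<in> (\<lambda>p. r *\<^sub>R snd (clifford t0 \<alpha> p)) ` UNIV"
    by (intro image_eqI[of _ _ "(Arg z1, Arg z2)"]) (simp_all add: z(1) clifford_def)
qed

lemma cis_inj_2pi:
  assumes "cis x = cis y" "0 \<le> x" "x < 2 * pi" "0 \<le> y" "y < 2 * pi"
  shows "x = y"
proof -
  have "sin x = sin y \<and> cos x = cos y"
    using assms(1) by (metis cis.sel)
  then obtain n :: int where n: "x = y + 2 * pi * n"
    using sin_cos_eq_iff by blast
  with assms have "\<bar>2 * pi * n\<bar> < 2 * pi * 1" by linarith
  then have "\<bar>of_int n :: real\<bar> < 1" by (simp add: abs_mult)
  then have "n = 0" by linarith
  with n show ?thesis by simp
qed

lemma clifford_inj:
  assumes "0 < \<alpha>" "\<alpha> < pi / 2"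
  shows "inj_on (clifford t0 \<alpha>) ({0..<2*pi} \<times> {0..<2*pi})"
proof (rule inj_onI)
  have c: "cos \<alpha> > 0" "sin \<alpha> > 0"
    using assms by (auto intro: cos_gt_zero sin_gt_zero)
  fix p q assume h: "p \<in> {0..<2*pi} \<times> {0..<2*pi}" "q \<in> {0..<2*pi} \<times> {0..<2*pi}"
    "clifford t0 \<alpha> p = clifford t0 \<alpha> q"
  with c have "cis (fst p) = cis (fst q)" "cis (snd p) = cis (snd q)"
    by (simp_all add: clifford_def split_beta)
  then show "p = q"
    using h(1,2) by (auto intro!: prod_eqI cis_inj_2pi)
qed

lemma clifford_has_derivative:
  "(clifford t0 \<alpha> has_derivative (\<lambda>v. (0, (fst v * cos \<alpha>) *\<^sub>R (\<i> * cis (fst p)),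
      (snd v * sin \<alpha>) *\<^sub>R (\<i> * cis (snd p))))) (at p)"
proof -
  have "clifford t0 \<alpha> = (\<lambda>p. (t0, cos \<alpha> *\<^sub>R cis (fst p), sin \<alpha> *\<^sub>R cis (snd p)))"
    by (auto simp: clifford_def)
  moreover have "((\<lambda>p. (t0, cos \<alpha> *\<^sub>R cis (fst p), sin \<alpha> *\<^sub>R cis (snd p))) has_derivative
     (\<lambda>v. (0, (fst v * cos \<alpha>) *\<^sub>R (\<i> * cis (fst p)), (snd v * sin \<alpha>) *\<^sub>R (\<i> * cis (snd p))))) (at p)"
    by (auto intro!: derivative_eq_intros simp: fun_eq_iff)
  ultimately show ?thesis by simp
qed

lemma clifford_dirderiv:
  "dirderiv v (clifford t0 \<alpha>) p = (0, (fst v * cos \<alpha>) *\<^sub>R (\<i> * cis (fst p)),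
      (snd v * sin \<alpha>) *\<^sub>R (\<i> * cis (snd p)))"
  by (rule fun_cong[OF frechet_derivative_at[OF clifford_has_derivative, symmetric]])

lemma clifford_dirderiv2:
  "dirderiv w (dirderiv v (clifford t0 \<alpha>)) p = (0, - (fst v * fst w * cos \<alpha>) *\<^sub>R cis (fst p),
      - (snd v * snd w * sin \<alpha>) *\<^sub>R cis (snd p))"
proof -
  have "((\<lambda>p. (0, (fst v * cos \<alpha>) *\<^sub>R (\<i> * cis (fst p)), (snd v * sin \<alpha>) *\<^sub>R (\<i> * cis (snd p)))) has_derivative
     (\<lambda>w. (0, - (fst v * fst w * cos \<alpha>) *\<^sub>R cis (fst p), - (snd v * snd w * sin \<alpha>) *\<^sub>R cis (snd p)))) (at p)"
    by (auto intro!: derivative_eq_intros simp: fun_eq_iff scaleR_conv_of_real algebra_simps)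
  then show ?thesis
    unfolding clifford_dirderiv by (rule fun_cong[OF frechet_derivative_at[symmetric]])
qed

lemma clifford_normal_dirderiv:
  "dirderiv v (clifford_normal a t0 \<alpha>) p = (0, (fst v * sin \<alpha> / a t0) *\<^sub>R (\<i> * cis (fst p)),
      - (snd v * cos \<alpha> / a t0) *\<^sub>R (\<i> * cis (snd p)))"
proof -
  have "clifford_normal a t0 \<alpha> =
      (\<lambda>p. (0, (sin \<alpha> / a t0) *\<^sub>R cis (fst p), - (cos \<alpha> / a t0) *\<^sub>R cis (snd p)))"
    by (auto simp: clifford_normal_def)
  moreover have "((\<lambda>p. (0, (sin \<alpha> / a t0) *\<^sub>R cis (fst p), - (cos \<alpha> / a t0) *\<^sub>R cis (snd p))) has_derivative
     (\<lambda>v. (0, (fst v * sin \<alpha> / a t0) *\<^sub>R (\<i> * cis (fst p)),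
      - (snd v * cos \<alpha> / a t0) *\<^sub>R (\<i> * cis (snd p))))) (at p)"
    by (auto intro!: derivative_eq_intros simp: fun_eq_iff)
  ultimately show ?thesis
    by (simp only:) (rule fun_cong[OF frechet_derivative_at[symmetric]])
qed

lemma inner_cis [simp]:
  "cis x \<bullet> cis x = 1" "(\<i> * cis x) \<bullet> cis x = 0" "cis x \<bullet> (\<i> * cis x) = 0"
  "(\<i> * cis x) \<bullet> (\<i> * cis x) = 1"
  by (simp_all add: inner_complex_def flip: power2_eq_square)

lemma clifford_normal_unit:
  assumes "a t0 > 0"
  shows "tangent (clifford t0 \<alpha> p) (clifford_normal a t0 \<alpha> p)"
    and "flrw_metric a (clifford t0 \<alpha> p) (clifford_normal a t0 \<alpha> p) (clifford_normal a t0 \<alpha> p) = 1"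
    and "flrw_metric a (clifford t0 \<alpha> p) (clifford_normal a t0 \<alpha> p) (d_t p) = 0"
    and "flrw_metric a (clifford t0 \<alpha> p) (clifford_normal a t0 \<alpha> p) (dirderiv v (clifford t0 \<alpha>) p) = 0"
  using assms sin_cos_squared_add[of \<alpha>]
  by (simp_all add: tangent_def flrw_metric_def clifford_dirderiv d_t_def)
     (simp_all add: clifford_def clifford_normal_def split_beta field_simps power2_eq_square)

lemma clifford_induced_metric:
  "induced_metric a (clifford t0 \<alpha>) p v w
     = (a t0)\<^sup>2 * ((cos \<alpha>)\<^sup>2 * (fst v * fst w) + (sin \<alpha>)\<^sup>2 * (snd v * snd w))"
  by (simp add: induced_metric_def flrw_metric_def clifford_dirderiv)
     (simp add: clifford_def split_beta power2_eq_square)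

lemma clifford_tr_h:
  assumes "a t0 > 0" "0 < \<alpha>" "\<alpha> < pi / 2"
  shows "tr_h a (clifford t0 \<alpha>) p B =
    (1 / (a t0 * cos \<alpha>)\<^sup>2) *\<^sub>R B e1 e1 + (1 / (a t0 * sin \<alpha>)\<^sup>2) *\<^sub>R B e2 e2"
proof -
  have c: "cos \<alpha> > 0" "sin \<alpha> > 0"
    using assms by (auto intro: cos_gt_zero sin_gt_zero)
  then show ?thesis
    using assms(1) by (simp add: tr_h_def gram_det_def clifford_induced_metric scaleR_add_right
        power_mult_distrib)
qed

lemma clifford_mean_curv:
  assumes "a t0 > 0" "0 < \<alpha>" "\<alpha> < pi / 2"
  shows "mean_curv a (clifford t0 \<alpha>) (clifford_normal a t0 \<alpha>) p = (tan \<alpha> - cot \<alpha>) / a t0"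
    and "mean_curv a (clifford t0 \<alpha>) d_t p = 2 * (deriv a t0 / a t0)"
proof -
  have c: "cos \<alpha> > 0" "sin \<alpha> > 0"
    using assms by (auto intro: cos_gt_zero sin_gt_zero)
  have F: "clifford t0 \<alpha> p = (t0, cos \<alpha> *\<^sub>R cis (fst p), sin \<alpha> *\<^sub>R cis (snd p))"
    by (simp add: clifford_def split_beta)
  have N: "clifford_normal a t0 \<alpha> p =
      (0, (sin \<alpha> / a t0) *\<^sub>R cis (fst p), - (cos \<alpha> / a t0) *\<^sub>R cis (snd p))"
    by (simp add: clifford_normal_def split_beta)
  have D: "dirderiv v d_t p = 0" for v
    using frechet_derivative_const[of "(1, 0, 0) :: spacetime" p]
    by (simp add: d_t_def[abs_def])
  show "mean_curv a (clifford t0 \<alpha>) (clifford_normal a t0 \<alpha>) p = (tan \<alpha> - cot \<alpha>) / a t0"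
    unfolding mean_curv_def clifford_tr_h[where a = a, OF assms]
    using c assms(1) sin_cos_squared_add[of \<alpha>]
    by (simp add: flrw_metric_def cov_deriv_def F N clifford_normal_dirderiv clifford_dirderiv
        inner_add_left)
       (simp add: tan_def cot_def field_simps power2_eq_square)
  show "mean_curv a (clifford t0 \<alpha>) d_t p = 2 * (deriv a t0 / a t0)"
    unfolding mean_curv_def clifford_tr_h[where a = a, OF assms]
    using c assms(1)
    by (simp add: flrw_metric_def cov_deriv_def F D clifford_dirderiv inner_add_left)
       (simp add: d_t_def field_simps power2_eq_square)
qed

lemma clifford_vecH:
  assumes "a t0 > 0" "0 < \<alpha>" "\<alpha> < pi / 2"
  shows "vecH a (clifford t0 \<alpha>) p =
     mean_curv a (clifford t0 \<alpha>) (clifford_normal a t0 \<alpha>) p *\<^sub>R clifford_normal a t0 \<alpha> p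
     - mean_curv a (clifford t0 \<alpha>) d_t p *\<^sub>R d_t p"
proof -
  have c: "cos \<alpha> > 0" "sin \<alpha> > 0"
    using assms by (auto intro: cos_gt_zero sin_gt_zero)
  have F: "clifford t0 \<alpha> p = (t0, cos \<alpha> *\<^sub>R cis (fst p), sin \<alpha> *\<^sub>R cis (snd p))"
    by (simp add: clifford_def split_beta)
  have N: "clifford_normal a t0 \<alpha> p =
      (0, (sin \<alpha> / a t0) *\<^sub>R cis (fst p), - (cos \<alpha> / a t0) *\<^sub>R cis (snd p))"
    by (simp add: clifford_normal_def split_beta)
  have s: "sin \<alpha> * sin \<alpha> = 1 - cos \<alpha> * cos \<alpha>"
    using sin_cos_squared_add[of \<alpha>] by (simp add: power2_eq_square)
  have C: "cov_deriv a (clifford t0 \<alpha>) e1 (dirderiv e1 (clifford t0 \<alpha>)) p =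
      (a t0 * deriv a t0 * (cos \<alpha>)\<^sup>2, (- cos \<alpha> * (sin \<alpha>)\<^sup>2) *\<^sub>R cis (fst p),
        ((cos \<alpha>)\<^sup>2 * sin \<alpha>) *\<^sub>R cis (snd p))"
    "cov_deriv a (clifford t0 \<alpha>) e2 (dirderiv e2 (clifford t0 \<alpha>)) p =
      (a t0 * deriv a t0 * (sin \<alpha>)\<^sup>2, ((sin \<alpha>)\<^sup>2 * cos \<alpha>) *\<^sub>R cis (fst p),
        (- sin \<alpha> * (cos \<alpha>)\<^sup>2) *\<^sub>R cis (snd p))"
    unfolding cov_deriv_def Let_def clifford_dirderiv2
    by (simp_all add: clifford_dirderiv F scaleR_left_diff_distrib[symmetric]
        scaleR_left_distrib[symmetric] power2_eq_square)
       (simp_all add: s algebra_simps flip: scaleR_left_distrib)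
  have np: "normal_part a (clifford t0 \<alpha>) p (q, b *\<^sub>R cis (fst p), d *\<^sub>R cis (snd p))
      = (q, b *\<^sub>R cis (fst p), d *\<^sub>R cis (snd p))" for q b d
    by (simp add: normal_part_def clifford_tr_h[where a = a, OF assms] flrw_metric_def clifford_dirderiv)
  show ?thesis
    unfolding clifford_mean_curv[where a = a, OF assms]
    using c assms(1)
    unfolding vecH_def clifford_tr_h[where a = a, OF assms] second_ff_def C np N d_t_def
    by (simp add: tan_def cot_def field_simps power2_eq_square
          flip: scaleR_left_distrib scaleR_left_diff_distrib)
       (subst scaleR_minus_left[symmetric], rule arg_cong[where f = "\<lambda>c. c *\<^sub>R cis (snd p)"],
        simp add: field_simps)
qed

end

theory Submission
  imports Defs
begin

text \<open>Writing the squared mean curvature and the area density in terms of the 2-jet of the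
  parametrisation, and using that derivatives in the variation parameter commute with those on
  the torus, the first variations of area and of the Willmore energy at a Clifford torus become a
  pointwise computation with constant coefficients. In the direction \<open>\<phi> (c1 \<nu> + c2 n)\<close> the
  terms with second derivatives of \<open>\<phi>\<close> integrate to zero by periodicity, so both first variations
  are constant multiples of \<open>\<integral> \<phi> d\<mu>\<close>. For \<open>V\<^sub>\<beta>\<close> the factor for the area is
  \<open>Q = H\<^sup>2 - P\<^sup>2\<close>, which gives the multiplier as a quotient of two constants. As
  \<open>\<alpha>\<close> tends to 0, \<open>\<bar>H\<bar>\<close> tends to infinity and the factor for the Willmore energy behaves like
  \<open>- H\<^sup>4\<close>, uniformly for \<open>\<bar>\<beta>\<bar> \<le> 1\<close>; this gives the signs. The variational instability is
  seen on \<open>u = cos x\<close>, whose gradient term grows only like \<open>H\<^sup>2\<close>.\<close>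

section \<open>Functions of class \<open>C\<^sup>k\<close>\<close>

text \<open>The energy density of a varied surface is a quotient by the Gram determinant, known to
  be positive only at time 0. Smoothness in the variation parameter is therefore available only on
  an open neighbourhood of \<open>{0} \<times> torus_box\<close>, and compactness of the box turns
  this into a uniform time interval. With a0 = a(t0), the principal curvatures in the slice are tan
  \<alpha> / a0 and - cot \<alpha> / a0, and Ric(\<nu>,\<nu>) = 2 / a0^2, so |A|^2 +
  Ric(\<nu>,\<nu>) = 1 / (a0 sin \<alpha> cos \<alpha>)^2 = H^2 + 4 / a0^2. Hence the leading - H^4
  is a balance: - 2 H^4 from the Jacobi operator of the torus in the slice against + H^4 from Q^2,
  the change of the area element. The parameter \<beta> drops out of the area variation because
  \<open>vecH_star\<close> is orthogonal to \<open>vecH\<close>. The test function depends on x and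
  not on y because the x-circles keep a radius near a0; on the shrinking y-circles the gradient term
  would grow like 2 H^4 and outweigh the potential.\<close>

lemma dirderiv_eqI:
  assumes "(f has_derivative f') (at p)"
  shows "dirderiv v f p = f' v"
  using frechet_derivative_at[OF assms] by simp

lemma dirderiv_cong:
  assumes "open S" "p \<in> S" "\<And>q. q \<in> S \<Longrightarrow> f q = g q" "f differentiable (at p)"
  shows "g differentiable (at p)" "dirderiv v g p = dirderiv v f p"
proof -
  have "(g has_derivative frechet_derivative f (at p)) (at p)"
    using has_derivative_transform_within_open[OF _ assms(1,2)] assms(3,4)
      frechet_derivative_works by blast
  then show "g differentiable (at p)" "dirderiv v g p = dirderiv v f p"
    by (auto simp: differentiable_def dirderiv_eqI)
qed

text \<open>Openness matters: \<open>dirderiv\<close> at p looks at a neighbourhood of p, so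
  agreement on S passes to derivatives only inside an open set.\<close>

lemma C_on_cong:
  assumes "open S" "\<And>p. p \<in> S \<Longrightarrow> f p = g p" "C_on k S f"
  shows "C_on k S g"
  using assms(2,3)
proof (induction k arbitrary: f g)
  case 0
  then show ?case using continuous_on_cong[of S S f g] by simp
next
  case (Suc k)
  have f: "f differentiable (at p)" if "p \<in> S" for p using Suc.prems(2) that by simp
  have fv: "C_on k S (dirderiv v f)" for v using Suc.prems(2) by simp
  have "C_on k S (dirderiv v g)" for v
    by (rule Suc.IH[OF _ fv]) (rule dirderiv_cong(2)[OF assms(1) _ Suc.prems(1) f, symmetric])
  then show ?case
    by (simp add: dirderiv_cong(1)[OF assms(1) _ Suc.prems(1) f])
qed

text \<open>Induction step for the closure properties: exhibit a derivative in closed form and show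
  that its value in each fixed direction is of class C^k, without computing
  \<open>frechet_derivative\<close>.\<close>

lemma C_on_SucI:
  assumes "open S" "\<And>p. p \<in> S \<Longrightarrow> (f has_derivative f' p) (at p)"
    "\<And>v. C_on k S (\<lambda>p. f' p v)"
  shows "C_on (Suc k) S f"
proof -
  have "C_on k S (dirderiv v f)" for v
    by (intro C_on_cong[OF assms(1) _ assms(3)[of v]]) (simp add: dirderiv_eqI[OF assms(2)])
  then show ?thesis using assms(2) by (auto simp: differentiable_def)
qed

lemma C_on_Suc_has_derivative:
  assumes "C_on (Suc k) S f" "p \<in> S"
  shows "(f has_derivative (\<lambda>v. dirderiv v f p)) (at p)"
  using assms by (simp add: frechet_derivative_works[symmetric])

lemma C_on_SucD: "C_on (Suc k) S f \<Longrightarrow> C_on k S f"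
proof (induction k arbitrary: f)
  case 0
  then show ?case
    by (auto intro!: continuous_at_imp_continuous_on differentiable_imp_continuous_within)
qed auto

lemma C_on_subset: "T \<subseteq> S \<Longrightarrow> C_on k S f \<Longrightarrow> C_on k T f"
  by (induction k arbitrary: f) (auto intro: continuous_on_subset)

lemma C_on_const: "open S \<Longrightarrow> C_on k S (\<lambda>p. c)"
proof (induction k arbitrary: c)
  case (Suc k)
  then show ?case by (intro C_on_SucI[where f' = "\<lambda>p v. 0"]) auto
qed simp

text \<open>For a linear inner map the derivative in direction v is \<open>dirderiv (L v) f\<close>
  composed with L: again a fixed direction, so the induction closes. A general inner map would make
  the direction depend on the point.\<close>

lemma C_on_linear_comp:
  assumes "open S" "bounded_linear L" "C_on k T f" "L ` S \<subseteq> T"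
  shows "C_on k S (\<lambda>p. f (L p))"
  using assms(3)
proof (induction k arbitrary: f)
  case 0
  then show ?case
    using continuous_on_compose2[OF _ linear_continuous_on[OF assms(2)] assms(4)] by simp
next
  case (Suc k)
  have "((\<lambda>p. f (L p)) has_derivative (\<lambda>v. dirderiv (L v) f (L p))) (at p)" if "p \<in> S" for p
    using Suc.prems that assms(4)
    by (intro has_derivative_compose[where f = L and g = f] C_on_Suc_has_derivative)
      (auto intro: bounded_linear_imp_has_derivative[OF assms(2)])
  then show ?case
    using Suc by (intro C_on_SucI[OF assms(1)]) auto
qed

lemma C_on_bounded_linear:
  assumes "open S" "bounded_linear L" "C_on k S f"
  shows "C_on k S (\<lambda>p. L (f p))"
  using assms(3)
proof (induction k arbitrary: f)
  case 0
  then show ?case using assms(2) by (simp add: bounded_linear.continuous_on)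
next
  case (Suc k)
  show ?case
    using Suc bounded_linear.has_derivative[OF assms(2) C_on_Suc_has_derivative[OF Suc.prems]]
    by (intro C_on_SucI[OF assms(1)]) auto
qed

lemma C_on_add:
  assumes "open S" "C_on k S f" "C_on k S g"
  shows "C_on k S (\<lambda>p. f p + g p)"
  using assms(2,3)
proof (induction k arbitrary: f g)
  case 0
  then show ?case by (simp add: continuous_on_add)
next
  case (Suc k)
  show ?case
    using Suc has_derivative_add[OF C_on_Suc_has_derivative[OF Suc.prems(1)]
        C_on_Suc_has_derivative[OF Suc.prems(2)]]
    by (intro C_on_SucI[OF assms(1)]) auto
qed

text \<open>Each summand of the product rule pairs a factor of class C^(k+1) with a derivative of
  class C^k, so the former is lowered by \<open>C_on_SucD\<close> before the induction hypothesis
  applies. Products, scalar multiples and inner products are instances.\<close>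

lemma C_on_bilinear:
  assumes "open S" "bounded_bilinear B" "C_on k S f" "C_on k S g"
  shows "C_on k S (\<lambda>p. B (f p) (g p))"
  using assms(3,4)
proof (induction k arbitrary: f g)
  case 0
  then show ?case using assms(2) by (simp add: bounded_bilinear.continuous_on)
next
  case (Suc k)
  have "C_on k S f" "C_on k S g" using Suc.prems C_on_SucD by blast+
  then show ?case
    using Suc bounded_bilinear.FDERIV[OF assms(2) C_on_Suc_has_derivative[OF Suc.prems(1)]
        C_on_Suc_has_derivative[OF Suc.prems(2)]]
    by (intro C_on_SucI[OF assms(1)]) (auto intro!: C_on_add assms(1))
qed

lemmas C_on_mult = C_on_bilinear[OF _ bounded_bilinear_mult]
lemmas C_on_scaleR = C_on_bilinear[OF _ bounded_bilinear_scaleR]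
lemmas C_on_inner = C_on_bilinear[OF _ bounded_bilinear_inner]
lemmas C_on_fst = C_on_bounded_linear[OF _ bounded_linear_fst]
lemmas C_on_snd = C_on_bounded_linear[OF _ bounded_linear_snd]
lemmas C_on_minus = C_on_bounded_linear[OF _ bounded_linear_minus[OF bounded_linear_ident]]

lemma C_on_diff:
  assumes "open S" "C_on k S f" "C_on k S g"
  shows "C_on k S (\<lambda>p. f p - g p)"
  using C_on_add[OF assms(1,2) C_on_minus[OF assms(1,3)]] by simp

lemma C_on_Pair:
  fixes f :: "'a::real_normed_vector \<Rightarrow> 'b::real_normed_vector"
    and g :: "'a \<Rightarrow> 'c::real_normed_vector"
  assumes "open S" "C_on k S f" "C_on k S g"
  shows "C_on k S (\<lambda>p. (f p, g p))"
proof -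
  have "bounded_linear (\<lambda>x. (x, 0))" "bounded_linear (\<lambda>x. (0, x))"
    by (simp_all add: bounded_linear_Pair bounded_linear_ident bounded_linear_zero)
  then have "C_on k S (\<lambda>p. (f p, 0 :: 'c))" "C_on k S (\<lambda>p. (0 :: 'b, g p))"
    using C_on_bounded_linear[OF assms(1) _ assms(2), of "\<lambda>x. (x, 0)"]
      C_on_bounded_linear[OF assms(1) _ assms(3), of "\<lambda>x. (0, x)"] by blast+
  from C_on_add[OF assms(1) this] have "C_on k S (\<lambda>p. (f p, 0) + (0, g p))" .
  then show ?thesis by simp
qed

text \<open>With a real-valued inner function the direction in which g is differentiated is a
  multiple of 1, and linearity moves that factor out as a scalar. This covers \<open>sqrt\<close>,
  \<open>inverse\<close>, the trigonometric functions and the scale factor.\<close>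

lemma C_on_real_comp:
  fixes g :: "real \<Rightarrow> 'b::real_normed_vector"
  assumes "open S" "C_on k T g" "C_on k S f" "f ` S \<subseteq> T"
  shows "C_on k S (\<lambda>p. g (f p))"
  using assms(2,3)
proof (induction k arbitrary: g)
  case 0
  then show ?case using assms(4) by (auto intro!: continuous_on_compose2[of T g])
next
  case (Suc k)
  have "((\<lambda>p. g (f p)) has_derivative (\<lambda>v. dirderiv v f p *\<^sub>R dirderiv 1 g (f p))) (at p)"
    if p: "p \<in> S" for p
  proof -
    have g: "(g has_derivative (\<lambda>v. dirderiv v g (f p))) (at (f p))"
      using Suc.prems(1) p assms(4) C_on_Suc_has_derivative by blast
    have "(\<lambda>v. dirderiv v g (f p)) = (\<lambda>v. v *\<^sub>R dirderiv 1 g (f p))"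
    proof
      fix v show "dirderiv v g (f p) = v *\<^sub>R dirderiv 1 g (f p)"
        using linear_scale[OF has_derivative_linear[OF g], of v 1] by simp
    qed
    from has_derivative_eq_rhs[OF g this]
    have "(g has_derivative (\<lambda>v. v *\<^sub>R dirderiv 1 g (f p))) (at (f p))" .
    from has_derivative_compose[OF C_on_Suc_has_derivative[OF Suc.prems(2) p] this]
    show ?thesis .
  qed
  moreover have "C_on k S (\<lambda>p. dirderiv v f p *\<^sub>R dirderiv 1 g (f p))" for v
    by (rule C_on_scaleR[OF assms(1) _ Suc.IH])
      (use Suc.prems in \<open>auto intro: C_on_SucD[OF Suc.prems(2)]\<close>)
  ultimately show ?case by (rule C_on_SucI[OF assms(1)])
qed

lemma smooth_on_C: "smooth_on S f \<Longrightarrow> C_on k S f"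
  by (simp add: smooth_on_def)

lemma smooth_on_dirderiv: "smooth_on S f \<Longrightarrow> smooth_on S (dirderiv v f)"
  unfolding smooth_on_def by (metis C_on.simps(2))

lemma smooth_on_continuous: "smooth_on S f \<Longrightarrow> continuous_on S f"
  using smooth_on_C[of S f 0] by simp

lemma smooth_on_has_derivative:
  "smooth_on S f \<Longrightarrow> p \<in> S \<Longrightarrow> (f has_derivative (\<lambda>v. dirderiv v f p)) (at p)"
  using smooth_on_C C_on_Suc_has_derivative by blast

lemma smooth_on_deriv:
  fixes g :: "real \<Rightarrow> real"
  assumes "smooth_on UNIV g"
  shows "smooth_on UNIV (deriv g)" "(g has_real_derivative deriv g t) (at t)"
proof -
  have d: "(g has_real_derivative dirderiv 1 g t) (at t)" for t
  proof -
    have g: "(g has_derivative (\<lambda>v. dirderiv v g t)) (at t)"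
      using smooth_on_has_derivative[OF assms] by blast
    have "(\<lambda>v. dirderiv v g t) = (*) (dirderiv 1 g t)"
    proof
      fix v show "dirderiv v g t = dirderiv 1 g t * v"
        using linear_scale[OF has_derivative_linear[OF g], of v 1] by (simp add: mult.commute)
    qed
    from has_derivative_eq_rhs[OF g this] show ?thesis unfolding has_field_derivative_def .
  qed
  then have e: "deriv g = dirderiv 1 g" by (intro ext DERIV_imp_deriv)
  show "smooth_on UNIV (deriv g)" unfolding e by (rule smooth_on_dirderiv[OF assms])
  show "(g has_real_derivative deriv g t) (at t)" unfolding e by (rule d)
qed

text \<open>Joint induction, since each function occurs in the derivative of the other.\<close>

lemma C_on_cos_sin: "C_on k UNIV (cos :: real \<Rightarrow> real)" "C_on k UNIV (sin :: real \<Rightarrow> real)"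
proof (induction k)
  case (Suc k)
  { case 1
    have "C_on k UNIV (\<lambda>p. - sin p * v)" for v :: real
      by (intro C_on_mult C_on_minus C_on_const Suc open_UNIV)
    then show ?case
      by (intro C_on_SucI[where f' = "\<lambda>p v. - sin p * v"] open_UNIV)
        (auto intro!: derivative_eq_intros) }
  { case 2
    have "C_on k UNIV (\<lambda>p. cos p * v)" for v :: real
      by (intro C_on_mult C_on_const Suc open_UNIV)
    then show ?case
      by (intro C_on_SucI[where f' = "\<lambda>p v. cos p * v"] open_UNIV)
        (auto intro!: derivative_eq_intros) }
qed (auto intro!: continuous_intros)

lemma C_on_cis: "C_on k UNIV cis"
proof -
  have e: "cis = (\<lambda>t. cos t *\<^sub>R 1 + sin t *\<^sub>R \<i>)"
    by (auto simp: complex_eq_iff)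
  show ?thesis
    unfolding e by (intro C_on_add C_on_scaleR C_on_const C_on_cos_sin open_UNIV)
qed

text \<open>Schwarz's theorem, by differentiating
  \<open>f (p + r u + s v) - f (p + r u) = \<integral>\<^sub>0\<^sup>s (dirderiv v f) (p + r u + x v) dx\<close> under the integral
  sign with respect to \<open>r\<close>, and then with respect to \<open>s\<close>.\<close>

lemma dirderiv_commute:
  fixes f :: "'a::real_normed_vector \<Rightarrow> 'b::banach"
  assumes S: "open S" and f: "C_on 2 S f" and p: "p \<in> S"
  shows "dirderiv u (dirderiv v f) p = dirderiv v (dirderiv u f) p"
proof -
  let ?L = "\<lambda>z::real \<times> real. p + fst z *\<^sub>R u + snd z *\<^sub>R v"
  have cL: "continuous_on UNIV ?L" by (intro continuous_intros)
  have "open (?L -` S)" by (rule open_vimage[OF S cL])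
  moreover have "(0, 0) \<in> ?L -` S" using p by simp
  ultimately obtain A B where AB: "open A" "open B" "(0, 0) \<in> A \<times> B" "A \<times> B \<subseteq> ?L -` S"
    by (rule open_prod_elim)
  then have AB0: "0 \<in> A" "0 \<in> B" by auto
  obtain d1 where d1: "0 < d1" "ball 0 d1 \<subseteq> A" by (rule openE[OF AB(1) AB0(1)])
  obtain d2 where d2: "0 < d2" "ball 0 d2 \<subseteq> B" by (rule openE[OF AB(2) AB0(2)])
  \<comment> \<open>Halving places the closed square of half-side d inside the open rectangle, as
    integration over closed intervals requires.\<close>
  define d where "d = min d1 d2 / 2"
  have d: "d > 0" using d1 d2 by (simp add: d_def)
  have in_S: "p + r *\<^sub>R u + s *\<^sub>R v \<in> S" if "\<bar>r\<bar> \<le> d" "\<bar>s\<bar> \<le> d" for r s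
  proof -
    have "d < d1" "d < d2" using d1(1) d2(1) unfolding d_def by linarith+
    then have "r \<in> ball 0 d1" "s \<in> ball 0 d2" using that by simp_all
    then have "r \<in> A" "s \<in> B" using d1(2) d2(2) by blast+
    then have "(r, s) \<in> ?L -` S" using AB(4) by blast
    then show ?thesis by simp
  qed
  have f2: "C_on (Suc (Suc 0)) S f" using f by (simp only: numeral_2_eq_2)
  have f1: "C_on (Suc 0) S f" by (rule C_on_SucD[OF f2])
  have C1: "C_on (Suc 0) S (dirderiv w f)" for w
    by (rule f2[unfolded C_on.simps(2)[of "Suc 0"], THEN conjunct2, THEN spec])
  have cont: "continuous_on S (dirderiv w (dirderiv w' f))" for w w'
    using C1[where w = w'] by simp
  have along: "((\<lambda>s. g (q + s *\<^sub>R w)) has_vector_derivative dirderiv w g (q + s *\<^sub>R w)) (at s within X)"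
    if "C_on (Suc 0) S g" "q + s *\<^sub>R w \<in> S" for g :: "'a \<Rightarrow> 'b" and q s w X
  proof -
    note g = C_on_Suc_has_derivative[OF that]
    have g': "dirderiv (c *\<^sub>R w) g (q + s *\<^sub>R w) = c *\<^sub>R dirderiv w g (q + s *\<^sub>R w)" for c
      by (rule linear_scale[OF has_derivative_linear[OF g]])
    have "((\<lambda>s. q + s *\<^sub>R w) has_derivative (\<lambda>c. 0 + c *\<^sub>R w)) (at s within X)"
      by (rule has_derivative_add[OF has_derivative_const
            has_derivative_scaleR_left[OF has_derivative_ident]])
    from has_derivative_compose[OF this[unfolded add_0] g] show ?thesis
      unfolding g' has_vector_derivative_def .
  qed
  define h where "h s = dirderiv u (dirderiv v f) (p + s *\<^sub>R v)" for s
  have ch: "continuous_on {0..d} h"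
    unfolding h_def
  proof (rule continuous_on_compose2[OF cont[where w = u and w' = v]])
    show "(\<lambda>s. p + s *\<^sub>R v) ` {0..d} \<subseteq> S" by (rule image_subsetI) (use in_S[of 0] d in simp)
  qed (intro continuous_intros)
  \<comment> \<open>Two evaluations of one derivative at r = 0: under the integral sign it gives the
    right-hand side, directly it gives the left-hand side.\<close>
  have key: "dirderiv u f (p + s *\<^sub>R v) - dirderiv u f p = integral {0..s} h" if s: "s \<in> {0..d}" for s
  proof -
    have ftc: "((\<lambda>x. dirderiv v f (p + r *\<^sub>R u + x *\<^sub>R v)) has_integral
        (f (p + r *\<^sub>R u + s *\<^sub>R v) - f (p + r *\<^sub>R u))) {0..s}" if r: "r \<in> {-d..d}" for r
    proof -
      have "((\<lambda>x. f (p + r *\<^sub>R u + x *\<^sub>R v)) has_vector_derivative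
          dirderiv v f (p + r *\<^sub>R u + x *\<^sub>R v)) (at x within {0..s})" if "x \<in> {0..s}" for x
        by (rule along[OF f1 in_S]) (use that r s in auto)
      then have "((\<lambda>x. dirderiv v f (p + r *\<^sub>R u + x *\<^sub>R v)) has_integral
          (f (p + r *\<^sub>R u + s *\<^sub>R v) - f (p + r *\<^sub>R u + 0 *\<^sub>R v))) {0..s}"
        by (rule fundamental_theorem_of_calculus[rotated]) (use s in simp_all)
      then show ?thesis by simp
    qed
    have "((\<lambda>r. integral (cbox 0 s) (\<lambda>x. dirderiv v f (p + r *\<^sub>R u + x *\<^sub>R v))) has_vector_derivative
        integral (cbox 0 s) (\<lambda>x. dirderiv u (dirderiv v f) (p + 0 *\<^sub>R u + x *\<^sub>R v))) (at 0 within {-d..d})"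
    proof (rule leibniz_rule_vector_derivative)
      fix r x assume r: "r \<in> {-d..d}" and x: "x \<in> cbox 0 s"
      have eq: "p + r *\<^sub>R u + x *\<^sub>R v = (p + x *\<^sub>R v) + r *\<^sub>R u" for r by simp
      have "(p + x *\<^sub>R v) + r *\<^sub>R u \<in> S"
        unfolding eq[symmetric] using r x s by (intro in_S) auto
      from along[OF C1 this] show "((\<lambda>r. dirderiv v f (p + r *\<^sub>R u + x *\<^sub>R v)) has_vector_derivative
          dirderiv u (dirderiv v f) (p + r *\<^sub>R u + x *\<^sub>R v)) (at r within {-d..d})"
        unfolding eq .
    next
      fix r assume "r \<in> {-d..d}"
      then show "(\<lambda>x. dirderiv v f (p + r *\<^sub>R u + x *\<^sub>R v)) integrable_on cbox 0 s"
        by (auto intro: has_integral_integrable[OF ftc])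
    next
      show "continuous_on ({-d..d} \<times> cbox 0 s)
          (\<lambda>(r, x). dirderiv u (dirderiv v f) (p + r *\<^sub>R u + x *\<^sub>R v))"
        unfolding split_beta
      proof (rule continuous_on_compose2[OF cont[where w = u and w' = v]])
        show "(\<lambda>z. p + fst z *\<^sub>R u + snd z *\<^sub>R v) ` ({-d..d} \<times> cbox 0 s) \<subseteq> S"
        proof (rule image_subsetI)
          fix z assume "z \<in> {-d..d} \<times> cbox 0 s"
          then show "p + fst z *\<^sub>R u + snd z *\<^sub>R v \<in> S"
            using s by (intro in_S) (auto simp: mem_Times_iff)
        qed
      qed (intro continuous_intros)
    qed (use d in simp_all)
    then have "((\<lambda>r. integral {0..s} (\<lambda>x. dirderiv v f (p + r *\<^sub>R u + x *\<^sub>R v))) has_vector_derivative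
        integral {0..s} h) (at 0 within {-d..d})"
      by (simp add: h_def[abs_def])
    then have 1: "((\<lambda>r. f (p + r *\<^sub>R u + s *\<^sub>R v) - f (p + r *\<^sub>R u)) has_vector_derivative
        integral {0..s} h) (at 0 within {-d..d})"
      by (rule has_vector_derivative_transform[rotated 2])
        (use d in \<open>simp_all add: integral_unique[OF ftc]\<close>)
    have "((\<lambda>r. f ((p + s *\<^sub>R v) + r *\<^sub>R u) - f (p + r *\<^sub>R u)) has_vector_derivative
        (dirderiv u f ((p + s *\<^sub>R v) + 0 *\<^sub>R u) - dirderiv u f (p + 0 *\<^sub>R u))) (at 0 within {-d..d})"
      by (rule has_vector_derivative_diff[OF along[OF f1] along[OF f1]])
        (use in_S[of 0 s] p s d in simp_all)
    then have 2: "((\<lambda>r. f (p + r *\<^sub>R u + s *\<^sub>R v) - f (p + r *\<^sub>R u)) has_vector_derivative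
        (dirderiv u f (p + s *\<^sub>R v) - dirderiv u f p)) (at 0 within {-d..d})"
      by (simp add: add.assoc add.commute[of "s *\<^sub>R v"])
    show ?thesis
      by (rule vector_derivative_unique_within[OF _ 2 1]) (use d in \<open>simp add: at_within_Icc_at\<close>)
  qed
  \<comment> \<open>Now \<open>key\<close> is differentiated at s = 0 from the right: the integral
    yields h 0 by continuity of h, the other side yields the derivatives in the opposite
    order.\<close>
  have "((\<lambda>s. integral {0..s} h) has_vector_derivative h 0) (at 0 within {0..d})"
    by (rule integral_has_vector_derivative[OF ch]) (use d in simp)
  then have 1: "((\<lambda>s. dirderiv u f (p + s *\<^sub>R v) - dirderiv u f p) has_vector_derivative h 0) (at 0 within {0..d})"
    by (rule has_vector_derivative_transform[rotated 2]) (use key d in simp_all)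
  have "((\<lambda>s. dirderiv u f (p + s *\<^sub>R v) - dirderiv u f p) has_vector_derivative
      (dirderiv v (dirderiv u f) (p + 0 *\<^sub>R v) - 0)) (at 0 within {0..d})"
    by (rule has_vector_derivative_diff[OF along[OF C1] has_vector_derivative_const])
      (use p in simp)
  then have 2: "((\<lambda>s. dirderiv u f (p + s *\<^sub>R v) - dirderiv u f p) has_vector_derivative
      dirderiv v (dirderiv u f) p) (at 0 within {0..d})" by simp
  have "h 0 = dirderiv v (dirderiv u f) p"
    by (rule vector_derivative_unique_within[OF _ 1 2]) (use d in \<open>simp add: at_within_Icc_at_right\<close>)
  then show ?thesis by (simp add: h_def)
qed

text \<open>The derivative is built from copies of \<open>inverse\<close> itself, so the statement
  for k gives the one for k + 1. For \<open>sqrt\<close> below, the derivative is half of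
  \<open>inverse\<close> of \<open>sqrt\<close>.\<close>

lemma C_on_inverse: "C_on k {0<..} (inverse :: real \<Rightarrow> real)"
proof (induction k)
  case 0
  show ?case by (auto intro!: continuous_intros)
next
  case (Suc k)
  have "C_on k {0<..} (\<lambda>p. - (inverse p * v * inverse p))" for v :: real
    by (intro C_on_minus C_on_mult C_on_const Suc open_greaterThan)
  moreover have "(inverse has_derivative (\<lambda>v. - (inverse p * v * inverse p))) (at p)"
    if "p \<in> {0<..}" for p :: real
    using that by (intro has_derivative_inverse') simp
  ultimately show ?case by (intro C_on_SucI[OF open_greaterThan])
qed

lemma C_on_sqrt: "C_on k {0<..} (sqrt :: real \<Rightarrow> real)"
proof (induction k)
  case 0
  show ?case by (auto intro!: continuous_intros)
next
  case (Suc k)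
  have "C_on k {0<..} (\<lambda>p. inverse (sqrt p) / 2 * v)" for v :: real
    unfolding divide_inverse
    by (intro C_on_mult C_on_const Suc open_greaterThan C_on_real_comp[OF _ C_on_inverse]) auto
  moreover have "(sqrt has_derivative (\<lambda>v. inverse (sqrt p) / 2 * v)) (at p)"
    if "p \<in> {0<..}" for p :: real
    using DERIV_real_sqrt[of p] that by (simp only: has_field_derivative_def greaterThan_iff)
  ultimately show ?case by (intro C_on_SucI[OF open_greaterThan])
qed

lemma C_on_divide:
  fixes f g :: "'a::real_normed_vector \<Rightarrow> real"
  assumes "open S" "C_on k S f" "C_on k S g" "\<And>p. p \<in> S \<Longrightarrow> g p > 0"
  shows "C_on k S (\<lambda>p. f p / g p)"
  unfolding divide_inverse
  by (intro C_on_mult C_on_real_comp[OF _ C_on_inverse] assms) (use assms(4) in auto)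

section \<open>Extrinsic curvature as a function of the 2-jet\<close>

text \<open>The covariant second derivative of a parametrisation at one point, with base point q,
  first derivatives X, Y and raw second derivative N as independent arguments. In this form it can
  be differentiated in the variation parameter.\<close>

definition hess_cov ::
    "(real \<Rightarrow> real) \<Rightarrow> spacetime \<Rightarrow> spacetime \<Rightarrow> spacetime \<Rightarrow> spacetime \<Rightarrow> spacetime" where
  "hess_cov a q X Y N =
     (fst N + a (fst q) * deriv a (fst q) * (snd X \<bullet> snd Y),
      snd N + (snd X \<bullet> snd Y) *\<^sub>R snd q
        + (deriv a (fst q) / a (fst q)) *\<^sub>R (fst X *\<^sub>R snd Y + fst Y *\<^sub>R snd X))"

lemma cov_deriv_hess_cov:
  "cov_deriv a F v (dirderiv w F) p
     = hess_cov a (F p) (dirderiv v F p) (dirderiv w F p) (dirderiv v (dirderiv w F) p)"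
  by (simp add: cov_deriv_def hess_cov_def Let_def)

text \<open>In the following, \<open>X v\<close> stands for the first and \<open>N v w\<close> for the second derivatives of the
  parametrisation. The mean curvature vector is minus the normal part of \<open>jet_Z\<close>, and
  \<open>jet_tangential\<close> divided by the Gram determinant is the squared length of its tangential part.\<close>

definition jet_gram ::
    "(real \<Rightarrow> real) \<Rightarrow> spacetime \<Rightarrow> (param \<Rightarrow> spacetime) \<Rightarrow> real" where
  "jet_gram a q X = flrw_metric a q (X e1) (X e1) * flrw_metric a q (X e2) (X e2)
     - flrw_metric a q (X e1) (X e2) * flrw_metric a q (X e2) (X e1)"

definition jet_Z ::
    "(real \<Rightarrow> real) \<Rightarrow> spacetime \<Rightarrow> (param \<Rightarrow> spacetime) \<Rightarrow> (param \<Rightarrow> param \<Rightarrow> spacetime) \<Rightarrow> spacetime" where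
  "jet_Z a q X N = (1 / jet_gram a q X) *\<^sub>R
     (flrw_metric a q (X e2) (X e2) *\<^sub>R hess_cov a q (X e1) (X e1) (N e1 e1)
      - flrw_metric a q (X e1) (X e2) *\<^sub>R hess_cov a q (X e1) (X e2) (N e1 e2)
      - flrw_metric a q (X e2) (X e1) *\<^sub>R hess_cov a q (X e2) (X e1) (N e2 e1)
      + flrw_metric a q (X e1) (X e1) *\<^sub>R hess_cov a q (X e2) (X e2) (N e2 e2))"

definition jet_tangential ::
    "(real \<Rightarrow> real) \<Rightarrow> spacetime \<Rightarrow> (param \<Rightarrow> spacetime) \<Rightarrow> spacetime \<Rightarrow> real" where
  "jet_tangential a q X Z =
     flrw_metric a q (X e2) (X e2) * (flrw_metric a q Z (X e1) * flrw_metric a q Z (X e1))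
     - 2 * flrw_metric a q (X e1) (X e2) * (flrw_metric a q Z (X e1) * flrw_metric a q Z (X e2))
     + flrw_metric a q (X e1) (X e1) * (flrw_metric a q Z (X e2) * flrw_metric a q Z (X e2))"

definition jet_vecH_sq ::
    "(real \<Rightarrow> real) \<Rightarrow> spacetime \<Rightarrow> (param \<Rightarrow> spacetime) \<Rightarrow> (param \<Rightarrow> param \<Rightarrow> spacetime) \<Rightarrow> real" where
  "jet_vecH_sq a q X N = flrw_metric a q (jet_Z a q X N) (jet_Z a q X N)
     - jet_tangential a q X (jet_Z a q X N) / jet_gram a q X"

lemma gram_det_jet: "gram_det a F p = jet_gram a (F p) (\<lambda>v. dirderiv v F p)"
  by (simp add: gram_det_def jet_gram_def induced_metric_def)

lemma flrw_metric_linear: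
  "flrw_metric a q (X + Y) Z = flrw_metric a q X Z + flrw_metric a q Y Z"
  "flrw_metric a q Z (X + Y) = flrw_metric a q Z X + flrw_metric a q Z Y"
  "flrw_metric a q (X - Y) Z = flrw_metric a q X Z - flrw_metric a q Y Z"
  "flrw_metric a q Z (X - Y) = flrw_metric a q Z X - flrw_metric a q Z Y"
  "flrw_metric a q (c *\<^sub>R X) Z = c * flrw_metric a q X Z"
  "flrw_metric a q Z (c *\<^sub>R X) = c * flrw_metric a q Z X"
  by (simp_all add: flrw_metric_def algebra_simps inner_add_left inner_add_right
      inner_diff_left inner_diff_right)

lemma flrw_metric_commute: "flrw_metric a q X Y = flrw_metric a q Y X"
  by (simp add: flrw_metric_def inner_commute mult.commute)

text \<open>The tangential projection satisfies <Z, pr Z> = <pr Z, pr Z>, so the square of Z - pr Z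
  is <Z, Z> - <Z, pr Z>, and the last product is \<open>jet_tangential\<close> divided by the Gram
  determinant. A nonzero determinant suffices; the metric may be indefinite on the surface.\<close>

lemma vecH_sq_jet:
  assumes g: "gram_det a F p \<noteq> 0"
  shows "vecH_sq a F p
    = jet_vecH_sq a (F p) (\<lambda>v. dirderiv v F p) (\<lambda>v w. dirderiv v (dirderiv w F) p)"
proof -
  define M where "M = flrw_metric a (F p)"
  define X1 where "X1 = dirderiv e1 F p"
  define X2 where "X2 = dirderiv e2 F p"
  define Z where "Z = jet_Z a (F p) (\<lambda>v. dirderiv v F p) (\<lambda>v w. dirderiv v (dirderiv w F) p)"
  define G where "G = gram_det a F p"
  define A where "A = M X1 X1"
  define B where "B = M X1 X2"
  define C where "C = M X2 X2"
  note lin = flrw_metric_linear[where a = a and q = "F p", folded M_def]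
  have sym: "M X2 X1 = B" "M X1 Z = M Z X1" "M X2 Z = M Z X2"
    by (simp_all add: B_def M_def flrw_metric_commute)
  have neg: "M (- Y) (- Y) = M Y Y" for Y by (simp add: M_def flrw_metric_def)
  have G: "G = A * C - B * B"
    by (simp add: G_def gram_det_def induced_metric_def A_def B_def C_def
        flip: M_def X1_def X2_def add: sym(1)[unfolded B_def])
  define pr where "pr Y = (1 / G) *\<^sub>R (C *\<^sub>R M Y X1 *\<^sub>R X1 - B *\<^sub>R M Y X1 *\<^sub>R X2
      - B *\<^sub>R M Y X2 *\<^sub>R X1 + A *\<^sub>R M Y X2 *\<^sub>R X2)" for Y
  have np: "normal_part a F p Y = Y - pr Y" for Y
    unfolding normal_part_def tr_h_def induced_metric_def pr_def G_def A_def B_def C_def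
      M_def[symmetric] X1_def[symmetric] X2_def[symmetric]
    by (simp add: sym(1)[unfolded B_def])
  have pr_lin: "pr (x + y) = pr x + pr y" "pr (x - y) = pr x - pr y" "pr (c *\<^sub>R x) = c *\<^sub>R pr x" for x y c
    by (simp_all add: pr_def lin algebra_simps)
  have "vecH a F p = - (Z - pr Z)"
    unfolding vecH_def tr_h_def second_ff_def np Z_def jet_Z_def cov_deriv_hess_cov
      induced_metric_def gram_det_jet pr_lin by (simp add: algebra_simps)
  then have "vecH_sq a F p = M (- (Z - pr Z)) (- (Z - pr Z))"
    by (simp add: vecH_sq_def M_def)
  also have "\<dots> = M (Z - pr Z) (Z - pr Z)"
    by (rule neg)
  also have "\<dots> = M Z Z - (M Z (pr Z) + M (pr Z) Z - M (pr Z) (pr Z))"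
    by (simp add: lin)
  also have "M (pr Z) Z = M Z (pr Z)"
    by (simp add: M_def flrw_metric_commute)
  also have 1: "M Z (pr Z) = (C * (M Z X1 * M Z X1) - 2 * B * (M Z X1 * M Z X2) + A * (M Z X2 * M Z X2)) / G"
    by (simp add: pr_def lin algebra_simps add_divide_distrib diff_divide_distrib)
  \<comment> \<open>\<open>pr Z\<close> and Z have the same products with \<open>X1\<close> and
    \<open>X2\<close>, because the inverse Gram matrix cancels the Gram matrix; hence the same value
    as for \<open>M Z (pr Z)\<close>.\<close>
  also have "M (pr Z) (pr Z) = (C * (M Z X1 * M Z X1) - 2 * B * (M Z X1 * M Z X2) + A * (M Z X2 * M Z X2)) / G"
  proof -
    define m where "m = M Z X1"
    define n where "n = M Z X2"
    have x: "M (pr Z) X1 = m" "M (pr Z) X2 = n"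
      using g unfolding pr_def lin sym(1) A_def[symmetric] B_def[symmetric] C_def[symmetric]
        m_def[symmetric] n_def[symmetric] G_def[symmetric]
      by (simp_all add: G divide_simps) (simp_all add: algebra_simps)
    have "M (pr Z) (pr Z) = (1 / G) * (C * (m * m) - B * (m * n) - B * (n * m) + A * (n * n))"
      by (subst (2) pr_def) (simp add: lin x flip: m_def n_def)
    then show ?thesis
      by (simp add: m_def n_def algebra_simps add_divide_distrib diff_divide_distrib)
  qed
  finally show ?thesis
    by (simp add: jet_vecH_sq_def jet_tangential_def gram_det_jet[symmetric] Z_def[symmetric]
        flip: M_def X1_def X2_def A_def B_def C_def G_def)
qed

lemma C_on_flrw_metric:
  assumes "smooth_on UNIV a" "open S" "C_on k S q" "C_on k S X" "C_on k S Y"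
  shows "C_on k S (\<lambda>z. flrw_metric a (q z) (X z) (Y z))"
  unfolding flrw_metric_def power2_eq_square
  by (intro C_on_add C_on_minus C_on_mult C_on_inner C_on_fst C_on_snd assms subset_UNIV
      C_on_real_comp[OF _ smooth_on_C[OF assms(1)] C_on_fst])

lemma C_on_hess_cov:
  assumes a: "smooth_on UNIV a" "\<And>t. a t > 0"
    and "open S" "C_on k S q" "C_on k S X" "C_on k S Y" "C_on k S N"
  shows "C_on k S (\<lambda>z. hess_cov a (q z) (X z) (Y z) (N z))"
  unfolding hess_cov_def
  by (intro C_on_Pair C_on_add C_on_mult C_on_scaleR C_on_inner C_on_fst C_on_snd C_on_divide
      assms subset_UNIV C_on_real_comp[OF _ smooth_on_C[OF a(1)] C_on_fst]
      C_on_real_comp[OF _ smooth_on_C[OF smooth_on_deriv(1)[OF a(1)]] C_on_fst])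

text \<open>The jet functions are rational expressions in the jet and in a and a' at the time
  coordinate. The denominators are a, positive everywhere, and the Gram determinant, whose
  positivity is required for the second conclusion.\<close>

lemma C_on_jet:
  assumes a: "smooth_on UNIV a" "\<And>t. a t > 0"
    and S: "open S" and q: "C_on k S q" and X: "\<And>v. C_on k S (\<lambda>z. X z v)"
    and N: "\<And>v w. C_on k S (\<lambda>z. N z v w)"
  shows C_on_jet_gram: "C_on k S (\<lambda>z. jet_gram a (q z) (X z))"
    and C_on_jet_vecH_sq: "(\<And>z. z \<in> S \<Longrightarrow> jet_gram a (q z) (X z) > 0) \<Longrightarrow>
      C_on k S (\<lambda>z. jet_vecH_sq a (q z) (X z) (N z))"
proof -
  note m = C_on_flrw_metric[OF a(1) S q]
  show G: "C_on k S (\<lambda>z. jet_gram a (q z) (X z))"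
    unfolding jet_gram_def by (intro C_on_diff C_on_mult m X S)
  assume pos: "\<And>z. z \<in> S \<Longrightarrow> jet_gram a (q z) (X z) > 0"
  have Z: "C_on k S (\<lambda>z. jet_Z a (q z) (X z) (N z))"
    unfolding jet_Z_def
    by (intro C_on_scaleR C_on_divide C_on_add C_on_diff C_on_const C_on_hess_cov a q m X N S G pos)
  show "C_on k S (\<lambda>z. jet_vecH_sq a (q z) (X z) (N z))"
    unfolding jet_vecH_sq_def jet_tangential_def
    by (intro C_on_divide C_on_add C_on_diff C_on_mult C_on_const m X Z S G pos)
qed

section \<open>Linearisation at the Clifford torus\<close>

lemmas has_vderiv_fst = bounded_linear.has_vector_derivative[OF bounded_linear_fst]
lemmas has_vderiv_snd = bounded_linear.has_vector_derivative[OF bounded_linear_snd]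

lemma has_real_derivative_fst:
  "(f has_vector_derivative f') F \<Longrightarrow> ((\<lambda>s. fst (f s :: real \<times> 'b::real_normed_vector)) has_real_derivative fst f') F"
  using has_vderiv_fst by (simp add: has_real_derivative_iff_has_vector_derivative)

lemma has_real_derivative_inner_snd:
  fixes f g :: "real \<Rightarrow> 'a::real_normed_vector \<times> 'b::real_inner"
  assumes "(f has_vector_derivative f') (at s)" "(g has_vector_derivative g') (at s)"
  shows "((\<lambda>s. snd (f s) \<bullet> snd (g s)) has_real_derivative
    (snd f' \<bullet> snd (g s) + snd (f s) \<bullet> snd g')) (at s)"
  using bounded_bilinear.has_vector_derivative[OF bounded_bilinear_inner
      has_vderiv_snd[OF assms(1)] has_vderiv_snd[OF assms(2)]]
  by (simp add: has_real_derivative_iff_has_vector_derivative add.commute)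

lemma flrw_metric_has_derivative:
  assumes a: "smooth_on UNIV a"
    and q: "(q has_vector_derivative q') (at s)"
    and X: "(X has_vector_derivative X') (at s)" and Y: "(Y has_vector_derivative Y') (at s)"
  shows "((\<lambda>s. flrw_metric a (q s) (X s) (Y s)) has_real_derivative
     - (fst X' * fst (Y s) + fst (X s) * fst Y')
     + 2 * a (fst (q s)) * deriv a (fst (q s)) * fst q' * (snd (X s) \<bullet> snd (Y s))
     + (a (fst (q s)))\<^sup>2 * (snd X' \<bullet> snd (Y s) + snd (X s) \<bullet> snd Y')) (at s)"
proof -
  have "((\<lambda>s. a (fst (q s))) has_real_derivative deriv a (fst (q s)) * fst q') (at s)"
    by (rule DERIV_chain2[OF smooth_on_deriv(2)[OF a] has_real_derivative_fst[OF q]])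
  then show ?thesis
    unfolding flrw_metric_def
    by (auto intro!: derivative_eq_intros has_real_derivative_inner_snd[OF X Y]
        has_real_derivative_fst[OF X] has_real_derivative_fst[OF Y] simp: algebra_simps power2_eq_square)
qed

text \<open>Only the case of purely spatial tangent vectors at the base point is needed, in which the
  derivative of \<open>a'/a\<close> does not contribute.\<close>

lemma hess_cov_has_derivative:
  assumes a: "smooth_on UNIV a" "\<And>t. a t > 0"
    and q: "(q has_vector_derivative q') (at s)"
    and X: "(X has_vector_derivative X') (at s)" and Y: "(Y has_vector_derivative Y') (at s)"
    and N: "(N has_vector_derivative N') (at s)"
    and base: "fst (X s) = 0" "fst (Y s) = 0" "fst (q s) = t0"
  shows "((\<lambda>s. hess_cov a (q s) (X s) (Y s) (N s)) has_vector_derivative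
     (fst N' + ((deriv a t0)\<^sup>2 + a t0 * deriv (deriv a) t0) * fst q' * (snd (X s) \<bullet> snd (Y s))
        + a t0 * deriv a t0 * (snd X' \<bullet> snd (Y s) + snd (X s) \<bullet> snd Y'),
      snd N' + (snd X' \<bullet> snd (Y s) + snd (X s) \<bullet> snd Y') *\<^sub>R snd (q s)
        + (snd (X s) \<bullet> snd (Y s)) *\<^sub>R snd q'
        + (deriv a t0 / a t0) *\<^sub>R (fst X' *\<^sub>R snd (Y s) + fst Y' *\<^sub>R snd (X s)))) (at s)"
proof -
  note tq = has_real_derivative_fst[OF q]
  have A: "((\<lambda>s. a (fst (q s))) has_real_derivative deriv a t0 * fst q') (at s)"
    using DERIV_chain2[OF smooth_on_deriv(2)[OF a(1)] tq] base(3) by simp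
  have B: "((\<lambda>s. deriv a (fst (q s))) has_real_derivative deriv (deriv a) t0 * fst q') (at s)"
    using DERIV_chain2[OF smooth_on_deriv(2)[OF smooth_on_deriv(1)[OF a(1)]] tq] base(3) by simp
  have AB: "((\<lambda>s. deriv a (fst (q s)) / a (fst (q s))) has_vector_derivative
      (deriv (deriv a) t0 * fst q' * a t0 - deriv a t0 * (deriv a t0 * fst q')) / (a t0 * a t0)) (at s)"
    using DERIV_divide[OF B A] a(2)[of t0] base(3)
    by (simp add: has_real_derivative_iff_has_vector_derivative)
  have XY: "((\<lambda>s. snd (X s) \<bullet> snd (Y s)) has_real_derivative
      (snd X' \<bullet> snd (Y s) + snd (X s) \<bullet> snd Y')) (at s)"
    by (rule has_real_derivative_inner_snd[OF X Y])
  have 1: "((\<lambda>s. fst (N s) + a (fst (q s)) * deriv a (fst (q s)) * (snd (X s) \<bullet> snd (Y s)))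
     has_real_derivative
     fst N' + ((deriv a t0)\<^sup>2 + a t0 * deriv (deriv a) t0) * fst q' * (snd (X s) \<bullet> snd (Y s))
        + a t0 * deriv a t0 * (snd X' \<bullet> snd (Y s) + snd (X s) \<bullet> snd Y')) (at s)"
    using base(3)
    by (auto intro!: derivative_eq_intros A B XY has_real_derivative_fst[OF N]
        simp: algebra_simps power2_eq_square)
  note sc = bounded_bilinear.has_vector_derivative[OF bounded_bilinear_scaleR]
  have cross: "((\<lambda>s. fst (X s) *\<^sub>R snd (Y s) + fst (Y s) *\<^sub>R snd (X s)) has_vector_derivative
      (fst X' *\<^sub>R snd (Y s) + fst Y' *\<^sub>R snd (X s))) (at s)"
    using has_vector_derivative_add[OF sc[OF has_vderiv_fst[OF X] has_vderiv_snd[OF Y]]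
        sc[OF has_vderiv_fst[OF Y] has_vderiv_snd[OF X]]] base(1,2) by simp
  have 2: "((\<lambda>s. snd (N s) + (snd (X s) \<bullet> snd (Y s)) *\<^sub>R snd (q s)
        + (deriv a (fst (q s)) / a (fst (q s))) *\<^sub>R (fst (X s) *\<^sub>R snd (Y s) + fst (Y s) *\<^sub>R snd (X s)))
     has_vector_derivative
      snd N' + (snd X' \<bullet> snd (Y s) + snd (X s) \<bullet> snd Y') *\<^sub>R snd (q s)
        + (snd (X s) \<bullet> snd (Y s)) *\<^sub>R snd q'
        + (deriv a t0 / a t0) *\<^sub>R (fst X' *\<^sub>R snd (Y s) + fst Y' *\<^sub>R snd (X s))) (at s)"
    using has_vector_derivative_add[OF has_vector_derivative_add[OF has_vderiv_snd[OF N]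
        sc[OF XY[unfolded has_real_derivative_iff_has_vector_derivative] has_vderiv_snd[OF q]]]
        sc[OF AB cross]] base
    by (simp add: algebra_simps)
  show ?thesis
    unfolding hess_cov_def
    by (rule has_vector_derivative_Pair[OF 1[unfolded has_real_derivative_iff_has_vector_derivative] 2])
qed

text \<open>Here \<open>zt, zu, zw\<close> are the components of the
  derivative of the trace of the Hessian along \<open>\<partial>\<^sub>t\<close>, \<open>cis x\<close> and \<open>cis y\<close>.\<close>

lemma clifford_linearised_identity:
  fixes a b d c s c1 c2 f f11 f22 :: real
  assumes nz: "a \<noteq> 0" "c \<noteq> 0" "s \<noteq> 0" and sc: "c\<^sup>2 + s\<^sup>2 = 1"
  defines "A \<equiv> c1 * s / a" and "B \<equiv> - c1 * c / a" and "H \<equiv> (s / c - c / s) / a" and "P \<equiv> 2 * b / a"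
  defines "\<eta>1 \<equiv> 2 * (b / a) * c2 + 2 * (s / (c * a)) * c1"
    and "\<eta>2 \<equiv> 2 * (b / a) * c2 - 2 * (c / (s * a)) * c1"
  defines "zt \<equiv> (c2 * f11 + (b\<^sup>2 + a * d) * c2 * f * c\<^sup>2 + a * b * (2 * c * A * f) - \<eta>1 * f * (a * b * c\<^sup>2)) / (a\<^sup>2 * c\<^sup>2)
      + (c2 * f22 + (b\<^sup>2 + a * d) * c2 * f * s\<^sup>2 + a * b * (2 * s * B * f) - \<eta>2 * f * (a * b * s\<^sup>2)) / (a\<^sup>2 * s\<^sup>2)"
    and "zu \<equiv> (A * f11 + f * A * (3 * c\<^sup>2 - 1) + \<eta>1 * f * (c * s\<^sup>2)) / (a\<^sup>2 * c\<^sup>2)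
      + (A * f22 + 2 * s * c * B * f + s\<^sup>2 * A * f - \<eta>2 * f * (s\<^sup>2 * c)) / (a\<^sup>2 * s\<^sup>2)"
    and "zw \<equiv> (B * f11 + 2 * c * s * A * f + c\<^sup>2 * B * f - \<eta>1 * f * (c\<^sup>2 * s)) / (a\<^sup>2 * c\<^sup>2)
      + (B * f22 + f * B * (3 * s\<^sup>2 - 1) + \<eta>2 * f * (s * c\<^sup>2)) / (a\<^sup>2 * s\<^sup>2)"
    and "z1 \<equiv> (c\<^sup>2 - s\<^sup>2) / (a\<^sup>2 * c)" and "z2 \<equiv> - (c\<^sup>2 - s\<^sup>2) / (a\<^sup>2 * s)"
  shows "- 2 * P * zt + 2 * a * b * (c2 * f) * (z1\<^sup>2 + z2\<^sup>2) + 2 * a\<^sup>2 * (z1 * zu + z2 * zw)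
    = (- 2 * H * c1 / (a * s * c)\<^sup>2 - 2 * H\<^sup>2 * c2 * (b / a) - 4 * P * (d / a - (b / a)\<^sup>2) * c2) * f
      - 2 * (P * c2 + H * c1) / (a * c)\<^sup>2 * f11 - 2 * (P * c2 + H * c1) / (a * s)\<^sup>2 * f22"
proof -
  define k where "k = c\<^sup>2 - s\<^sup>2"
  have s2: "s\<^sup>2 = 1 - c\<^sup>2" using sc by simp
  have H: "H = - k / (a * c * s)"
    using nz by (simp add: H_def k_def field_simps power2_eq_square)
  have zt: "zt = c2 * f11 / (a\<^sup>2 * c\<^sup>2) + c2 * f22 / (a\<^sup>2 * s\<^sup>2) + 2 * f * c2 * (a * d - b\<^sup>2) / a\<^sup>2"
  proof -
    \<comment> \<open>The \<open>c1\<close> terms cancel here and in \<open>n2\<close>: the time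
      component of the trace is P = 2 a' / a, which a motion inside the slice leaves
      unchanged.\<close>
    have n1: "c2 * f11 + (b\<^sup>2 + a * d) * c2 * f * c\<^sup>2 + a * b * (2 * c * A * f) - \<eta>1 * f * (a * b * c\<^sup>2)
        = c2 * f11 + f * c2 * (a * d - b\<^sup>2) * c\<^sup>2"
      unfolding A_def \<eta>1_def using nz by (simp add: field_simps power2_eq_square)
    have n2: "c2 * f22 + (b\<^sup>2 + a * d) * c2 * f * s\<^sup>2 + a * b * (2 * s * B * f) - \<eta>2 * f * (a * b * s\<^sup>2)
        = c2 * f22 + f * c2 * (a * d - b\<^sup>2) * s\<^sup>2"
      unfolding B_def \<eta>2_def using nz by (simp add: field_simps power2_eq_square)
    show ?thesis
      unfolding zt_def n1 n2 using nz by (simp add: add_divide_distrib)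
  qed
  have u1: "A * f11 + f * A * (3 * c\<^sup>2 - 1) + \<eta>1 * f * (c * s\<^sup>2)
      = (c1 * s * f11 + c1 * f * s * (1 + c\<^sup>2) + 2 * b * c2 * f * c * s\<^sup>2) / a"
  proof -
    have "A * f11 + f * A * (3 * c\<^sup>2 - 1) + \<eta>1 * f * (c * s\<^sup>2)
      = (c1 * s * f11 + c1 * f * s * (3 * c\<^sup>2 - 1 + 2 * s\<^sup>2) + 2 * b * c2 * f * c * s\<^sup>2) / a"
      unfolding A_def \<eta>1_def using nz by (simp add: field_simps power2_eq_square)
    also have "3 * c\<^sup>2 - 1 + 2 * s\<^sup>2 = 1 + c\<^sup>2" using sc by simp
    finally show ?thesis .
  qed
  have w2: "B * f22 + f * B * (3 * s\<^sup>2 - 1) + \<eta>2 * f * (s * c\<^sup>2)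
      = (- c1 * c * f22 - c1 * f * c * (1 + s\<^sup>2) + 2 * b * c2 * f * s * c\<^sup>2) / a"
  proof -
    have "B * f22 + f * B * (3 * s\<^sup>2 - 1) + \<eta>2 * f * (s * c\<^sup>2)
      = (- c1 * c * f22 - c1 * f * c * (3 * s\<^sup>2 - 1 + 2 * c\<^sup>2) + 2 * b * c2 * f * s * c\<^sup>2) / a"
      unfolding B_def \<eta>2_def using nz by (simp add: field_simps power2_eq_square)
    also have "3 * s\<^sup>2 - 1 + 2 * c\<^sup>2 = 1 + s\<^sup>2" using sc by simp
    finally show ?thesis .
  qed
  have u2: "A * f22 + 2 * s * c * B * f + s\<^sup>2 * A * f - \<eta>2 * f * (s\<^sup>2 * c)
      = (c1 * s * f22 + c1 * f * s ^ 3 - 2 * b * c2 * f * s\<^sup>2 * c) / a"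
    unfolding A_def B_def \<eta>2_def using nz by (simp add: field_simps power2_eq_square power3_eq_cube)
  have w1: "B * f11 + 2 * c * s * A * f + c\<^sup>2 * B * f - \<eta>1 * f * (c\<^sup>2 * s)
      = (- c1 * c * f11 - c1 * f * c ^ 3 - 2 * b * c2 * f * c\<^sup>2 * s) / a"
    unfolding A_def B_def \<eta>1_def using nz by (simp add: field_simps power2_eq_square power3_eq_cube)
  \<comment> \<open>Since (z1, z2) is proportional to (1 / c, - 1 / s), the derivative of the
    spatial part enters only through this combination.\<close>
  have diff: "zu / c - zw / s = c1 / a ^ 3 * ((s / c + c / s) * (f11 / c\<^sup>2 + f22 / s\<^sup>2)
      + f * (s * (1 + c\<^sup>2) / c ^ 3 + s / c + c / s + c * (1 + s\<^sup>2) / s ^ 3))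
      + 2 * b * c2 * f / a ^ 3 * (s\<^sup>2 / c\<^sup>2 - c\<^sup>2 / s\<^sup>2)"
    unfolding zu_def zw_def u1 u2 w1 w2
    using nz by (simp add: divide_simps) (simp add: algebra_simps power_numeral_reduce)
  \<comment> \<open>The remaining uses of c^2 + s^2 = 1 are isolated in \<open>t1\<close> to
    \<open>t4\<close>, leaving a rational identity in independent variables for the end.\<close>
  have t1: "s / c + c / s = 1 / (c * s)"
    using nz sc by (simp add: field_simps power2_eq_square)
  have t2: "s * (1 + c\<^sup>2) / c ^ 3 + s / c + c / s + c * (1 + s\<^sup>2) / s ^ 3 = 1 / (c ^ 3 * s ^ 3)"
  proof -
    have "s * (1 + c\<^sup>2) / c ^ 3 + s / c + c / s + c * (1 + s\<^sup>2) / s ^ 3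
      = ((s\<^sup>2)\<^sup>2 * (1 + c\<^sup>2) + (s\<^sup>2)\<^sup>2 * c\<^sup>2 + (c\<^sup>2)\<^sup>2 * s\<^sup>2 + (c\<^sup>2)\<^sup>2 * (1 + s\<^sup>2)) / (c ^ 3 * s ^ 3)"
      using nz by (simp add: field_simps power2_eq_square power3_eq_cube)
    also have "(s\<^sup>2)\<^sup>2 * (1 + c\<^sup>2) + (s\<^sup>2)\<^sup>2 * c\<^sup>2 + (c\<^sup>2)\<^sup>2 * s\<^sup>2 + (c\<^sup>2)\<^sup>2 * (1 + s\<^sup>2) = 1"
      unfolding s2 by (simp add: algebra_simps power2_eq_square)
    finally show ?thesis .
  qed
  have t3: "s\<^sup>2 / c\<^sup>2 - c\<^sup>2 / s\<^sup>2 = - k / (c\<^sup>2 * s\<^sup>2)"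
  proof -
    have "s\<^sup>2 / c\<^sup>2 - c\<^sup>2 / s\<^sup>2 = - k * (c\<^sup>2 + s\<^sup>2) / (c\<^sup>2 * s\<^sup>2)"
      using nz by (simp add: k_def field_simps power2_eq_square)
    then show ?thesis using sc by simp
  qed
  have t4: "z1\<^sup>2 + z2\<^sup>2 = k\<^sup>2 / (a ^ 4 * c\<^sup>2 * s\<^sup>2)"
  proof -
    have "z1\<^sup>2 + z2\<^sup>2 = k\<^sup>2 * (c\<^sup>2 + s\<^sup>2) / (a ^ 4 * c\<^sup>2 * s\<^sup>2)"
      unfolding z1_def z2_def k_def[symmetric]
      using nz by (simp add: field_simps power2_eq_square power4_eq_xxxx)
    then show ?thesis using sc by simp
  qed
  have "2 * a\<^sup>2 * (z1 * zu + z2 * zw) = 2 * k * (zu / c - zw / s)"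
    unfolding z1_def z2_def k_def[symmetric] using nz by (simp add: field_simps)
  also have "\<dots> = 2 * k * (c1 / a ^ 3 * (1 / (c * s) * (f11 / c\<^sup>2 + f22 / s\<^sup>2) + f * (1 / (c ^ 3 * s ^ 3)))
      - 2 * b * c2 * f / a ^ 3 * (k / (c\<^sup>2 * s\<^sup>2)))"
    unfolding diff t1 t2 t3 by simp
  finally have E: "2 * a\<^sup>2 * (z1 * zu + z2 * zw)
    = 2 * k * (c1 / a ^ 3 * (1 / (c * s) * (f11 / c\<^sup>2 + f22 / s\<^sup>2) + f * (1 / (c ^ 3 * s ^ 3)))
      - 2 * b * c2 * f / a ^ 3 * (k / (c\<^sup>2 * s\<^sup>2)))" .
  show ?thesis
    unfolding zt t4 H P_def E
    using nz by (simp add: divide_simps) (simp add: algebra_simps power_numeral_reduce)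
qed

text \<open>The coefficients reflect three mechanisms. Along \<nu>, H changes by minus the Jacobi
  operator, whose potential is 1 / (r s c)^2. Along n, H scales like 1 / a and P = 2 a' / a is
  differentiated in time. The terms in \<open>f11\<close> and \<open>f22\<close> are the Laplacian
  produced by both motions. \<open>N12'\<close> and \<open>N21'\<close> are left free: the mixed
  entries of metric and Hessian both vanish at the torus, so their products vanish to second
  order.\<close>

lemma clifford_jet_variation:
  fixes q :: "real \<Rightarrow> spacetime" and X :: "real \<Rightarrow> param \<Rightarrow> spacetime"
    and N :: "real \<Rightarrow> param \<Rightarrow> param \<Rightarrow> spacetime" and a :: "real \<Rightarrow> real"
    and t0 \<alpha> c1 c2 f f1 f2 f11 f22 x y :: real
  assumes a: "smooth_on UNIV a" "\<And>t. a t > 0" and \<alpha>: "0 < \<alpha>" "\<alpha> < pi / 2"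
  defines "r \<equiv> a t0" and "b \<equiv> deriv a t0" and "d \<equiv> deriv (deriv a) t0"
    and "c \<equiv> cos \<alpha>" and "s \<equiv> sin \<alpha>"
  defines "A \<equiv> c1 * s / r" and "B \<equiv> - c1 * c / r" and "H \<equiv> (s / c - c / s) / r" and "P \<equiv> 2 * b / r"
  assumes q: "(q has_vector_derivative (c2 * f, (A * f) *\<^sub>R U, (B * f) *\<^sub>R W)) (at 0)"
    and X1: "((\<lambda>h. X h e1) has_vector_derivative
      (c2 * f1, A *\<^sub>R (f1 *\<^sub>R U + f *\<^sub>R (\<i> * U)), (B * f1) *\<^sub>R W)) (at 0)"
    and X2: "((\<lambda>h. X h e2) has_vector_derivative
      (c2 * f2, (A * f2) *\<^sub>R U, B *\<^sub>R (f2 *\<^sub>R W + f *\<^sub>R (\<i> * W)))) (at 0)"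
    and N11: "((\<lambda>h. N h e1 e1) has_vector_derivative
      (c2 * f11, A *\<^sub>R (f11 *\<^sub>R U + (2 * f1) *\<^sub>R (\<i> * U) - f *\<^sub>R U), (B * f11) *\<^sub>R W)) (at 0)"
    and N22: "((\<lambda>h. N h e2 e2) has_vector_derivative
      (c2 * f22, (A * f22) *\<^sub>R U, B *\<^sub>R (f22 *\<^sub>R W + (2 * f2) *\<^sub>R (\<i> * W) - f *\<^sub>R W))) (at 0)"
    and N12: "((\<lambda>h. N h e1 e2) has_vector_derivative N12') (at 0)"
    and N21: "((\<lambda>h. N h e2 e1) has_vector_derivative N21') (at 0)"
    and UW: "U = cis x" "W = cis y"
    and base: "q 0 = (t0, c *\<^sub>R U, s *\<^sub>R W)" "X 0 e1 = (0, c *\<^sub>R (\<i> * U), 0)"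
      "X 0 e2 = (0, 0, s *\<^sub>R (\<i> * W))" "N 0 e1 e1 = (0, - c *\<^sub>R U, 0)"
      "N 0 e2 e2 = (0, 0, - s *\<^sub>R W)" "N 0 e1 e2 = 0" "N 0 e2 e1 = 0"
  shows "((\<lambda>h. jet_gram a (q h) (X h)) has_real_derivative
      2 * (H * c1 + P * c2) * f * (r ^ 4 * c\<^sup>2 * s\<^sup>2)) (at 0)" (is ?gram)
    and "((\<lambda>h. jet_vecH_sq a (q h) (X h) (N h)) has_real_derivative
      (- 2 * H * c1 / (r * s * c)\<^sup>2 - 2 * H\<^sup>2 * c2 * (b / r) - 4 * P * (d / r - (b / r)\<^sup>2) * c2) * f
      - 2 * (P * c2 + H * c1) / (r * c)\<^sup>2 * f11 - 2 * (P * c2 + H * c1) / (r * s)\<^sup>2 * f22) (at 0)" (is ?H)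
proof -
  have nz: "r \<noteq> 0" "c \<noteq> 0" "s \<noteq> 0"
    using a(2)[of t0] cos_gt_zero[of \<alpha>] sin_gt_zero[of \<alpha>] \<alpha> by (auto simp: r_def c_def s_def)
  have sc: "c\<^sup>2 + s\<^sup>2 = 1" by (simp add: c_def s_def)
  have Uin: "U \<bullet> U = 1" "(\<i> * U) \<bullet> U = 0" "U \<bullet> (\<i> * U) = 0" "(\<i> * U) \<bullet> (\<i> * U) = 1"
    "W \<bullet> W = 1" "(\<i> * W) \<bullet> W = 0" "W \<bullet> (\<i> * W) = 0" "(\<i> * W) \<bullet> (\<i> * W) = 1"
    by (simp_all only: UW inner_cis)
  note ips = inner_add_left inner_add_right inner_diff_left inner_diff_right Uin
  \<comment> \<open>\<eta>1 and \<eta>2 are the relative rates of change of the two diagonal metric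
    coefficients: twice the principal curvature in the slice times \<open>c1\<close>, plus twice a'
    / a times \<open>c2\<close>.\<close>
  define \<eta>1 where "\<eta>1 = 2 * (b / r) * c2 + 2 * (s / (c * r)) * c1"
  define \<eta>2 where "\<eta>2 = 2 * (b / r) * c2 - 2 * (c / (s * r)) * c1"
  define h where "h v w = (\<lambda>z. flrw_metric a (q z) (X z v) (X z w))" for v w
  have h_ap: "flrw_metric a (q z) (X z v) (X z w) = h v w z" for v w z by (simp add: h_def)
  define C where "C v w = (\<lambda>z. hess_cov a (q z) (X z v) (X z w) (N z v w))" for v w
  have cA: "r * (c * A) = c * s * c1" "r * (s * B) = - (c * s * c1)"
    using nz by (simp_all add: A_def B_def)
  have h0: "h e1 e1 0 = r\<^sup>2 * c\<^sup>2" "h e2 e2 0 = r\<^sup>2 * s\<^sup>2" "h e1 e2 0 = 0" "h e2 e1 0 = 0"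
    by (simp_all add: h_def flrw_metric_def base ips r_def power2_eq_square)
  have h11: "(h e1 e1 has_real_derivative \<eta>1 * f * (r\<^sup>2 * c\<^sup>2)) (at 0)"
    unfolding h_def
    by (rule DERIV_cong[OF flrw_metric_has_derivative[OF a(1) q X1 X1]])
      (use nz in \<open>simp add: base ips flip: r_def b_def\<close>,
        simp add: \<eta>1_def A_def field_simps power2_eq_square)
  have h22: "(h e2 e2 has_real_derivative \<eta>2 * f * (r\<^sup>2 * s\<^sup>2)) (at 0)"
    unfolding h_def
    by (rule DERIV_cong[OF flrw_metric_has_derivative[OF a(1) q X2 X2]])
      (use nz in \<open>simp add: base ips flip: r_def b_def\<close>,
        simp add: \<eta>2_def B_def field_simps power2_eq_square)
  \<comment> \<open>Any value will do: \<open>h e1 e2\<close> and \<open>h e2 e1\<close> both vanish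
    at 0, hence so does the derivative of their product.\<close>
  obtain h12' where h12: "(h e1 e2 has_real_derivative h12') (at 0)"
    unfolding h_def using flrw_metric_has_derivative[OF a(1) q X1 X2] by blast
  obtain h21' where h21: "(h e2 e1 has_real_derivative h21') (at 0)"
    unfolding h_def using flrw_metric_has_derivative[OF a(1) q X2 X1] by blast
  have gram: "((\<lambda>z. jet_gram a (q z) (X z)) has_real_derivative
      (\<eta>1 + \<eta>2) * f * (r ^ 4 * c\<^sup>2 * s\<^sup>2)) (at 0)"
    unfolding jet_gram_def h_ap
    by (rule DERIV_cong[OF DERIV_diff[OF DERIV_mult[OF h11 h22] DERIV_mult[OF h12 h21]]])
      (simp add: h0 algebra_simps power_numeral_reduce)
  have gram0: "jet_gram a (q 0) (X 0) = r ^ 4 * c\<^sup>2 * s\<^sup>2"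
    unfolding jet_gram_def unfolding h_ap h0 by (simp add: power_numeral_reduce)
  have "\<eta>1 + \<eta>2 = 2 * (H * c1 + P * c2)"
    using nz by (simp add: \<eta>1_def \<eta>2_def H_def P_def field_simps)
  then show ?gram using gram by simp

  have fst0: "fst (X 0 e1) = 0" "fst (X 0 e2) = 0" "fst (q 0) = t0" by (simp_all add: base)
  have C0: "C e1 e1 0 = (r * b * c\<^sup>2, - (c * s\<^sup>2) *\<^sub>R U, (c\<^sup>2 * s) *\<^sub>R W)"
    "C e2 e2 0 = (r * b * s\<^sup>2, (s\<^sup>2 * c) *\<^sub>R U, - (s * c\<^sup>2) *\<^sub>R W)"
    "C e1 e2 0 = 0" "C e2 e1 0 = 0"
  proof -
    have "- c + c\<^sup>2 * c = - (c * s\<^sup>2)" "- s + s\<^sup>2 * s = - (s * c\<^sup>2)"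
      using sc by algebra+
    then have e: "- (c *\<^sub>R U) + (c\<^sup>2 * c) *\<^sub>R U = - (c * s\<^sup>2) *\<^sub>R U"
      "- (s *\<^sub>R W) + (s\<^sup>2 * s) *\<^sub>R W = - (s * c\<^sup>2) *\<^sub>R W"
      by (metis scaleR_left_distrib scaleR_minus_left)+
    show "C e1 e1 0 = (r * b * c\<^sup>2, - (c * s\<^sup>2) *\<^sub>R U, (c\<^sup>2 * s) *\<^sub>R W)"
      "C e2 e2 0 = (r * b * s\<^sup>2, (s\<^sup>2 * c) *\<^sub>R U, - (s * c\<^sup>2) *\<^sub>R W)"
      using e by (simp_all add: C_def hess_cov_def base ips r_def b_def power2_eq_square)
  qed (simp_all add: C_def hess_cov_def base zero_prod_def)
  define T11 where "T11 = c2 * f11 + (b\<^sup>2 + r * d) * c2 * f * c\<^sup>2 + r * b * (2 * c * A * f)"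
  define T22 where "T22 = c2 * f22 + (b\<^sup>2 + r * d) * c2 * f * s\<^sup>2 + r * b * (2 * s * B * f)"
  define u11 where "u11 = A * f11 + f * A * (3 * c\<^sup>2 - 1)"
  define w11 where "w11 = B * f11 + 2 * c * s * A * f + c\<^sup>2 * B * f"
  define u22 where "u22 = A * f22 + 2 * s * c * B * f + s\<^sup>2 * A * f"
  define w22 where "w22 = B * f22 + f * B * (3 * s\<^sup>2 - 1)"
  define v11 where "v11 = 2 * A * f1 + 2 * (b / r) * c2 * f1 * c"
  define v22 where "v22 = 2 * B * f2 + 2 * (b / r) * c2 * f2 * s"
  have C11: "(C e1 e1 has_vector_derivative
      (T11, u11 *\<^sub>R U + v11 *\<^sub>R (\<i> * U), w11 *\<^sub>R W)) (at 0)"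
    unfolding C_def
    by (rule has_vector_derivative_eq_rhs[OF hess_cov_has_derivative[OF a q X1 X1 N11 fst0(1,1,3)]])
      (simp add: base ips flip: r_def b_def d_def,
        simp add: T11_def u11_def v11_def w11_def scaleR_conv_of_real algebra_simps power2_eq_square)
  have C22: "(C e2 e2 has_vector_derivative
      (T22, u22 *\<^sub>R U, w22 *\<^sub>R W + v22 *\<^sub>R (\<i> * W))) (at 0)"
    unfolding C_def
    by (rule has_vector_derivative_eq_rhs[OF hess_cov_has_derivative[OF a q X2 X2 N22 fst0(2,2,3)]])
      (simp add: base ips flip: r_def b_def d_def,
        simp add: T22_def u22_def v22_def w22_def scaleR_conv_of_real algebra_simps power2_eq_square)
  obtain C12' where C12: "(C e1 e2 has_vector_derivative C12') (at 0)"
    unfolding C_def using hess_cov_has_derivative[OF a q X1 X2 N12 fst0] by blast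
  obtain C21' where C21: "(C e2 e1 has_vector_derivative C21') (at 0)"
    unfolding C_def using hess_cov_has_derivative[OF a q X2 X1 N21 fst0(2,1,3)] by blast

  define zt where "zt = (T11 - \<eta>1 * f * (r * b * c\<^sup>2)) / (r\<^sup>2 * c\<^sup>2) + (T22 - \<eta>2 * f * (r * b * s\<^sup>2)) / (r\<^sup>2 * s\<^sup>2)"
  define zu where "zu = (u11 + \<eta>1 * f * (c * s\<^sup>2)) / (r\<^sup>2 * c\<^sup>2) + (u22 - \<eta>2 * f * (s\<^sup>2 * c)) / (r\<^sup>2 * s\<^sup>2)"
  define zw where "zw = (w11 - \<eta>1 * f * (c\<^sup>2 * s)) / (r\<^sup>2 * c\<^sup>2) + (w22 + \<eta>2 * f * (s * c\<^sup>2)) / (r\<^sup>2 * s\<^sup>2)"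
  define z1 where "z1 = (c\<^sup>2 - s\<^sup>2) / (r\<^sup>2 * c)"
  define z2 where "z2 = - (c\<^sup>2 - s\<^sup>2) / (r\<^sup>2 * s)"
  define Z where "Z = (\<lambda>z. jet_Z a (q z) (X z) (N z))"
  note sc_rule = bounded_bilinear.has_vector_derivative[OF bounded_bilinear_scaleR]
  note vd = has_real_derivative_iff_has_vector_derivative
  define gi where "gi = 1 / (r ^ 4 * c\<^sup>2 * s\<^sup>2)"
  have ginv: "((\<lambda>z. 1 / jet_gram a (q z) (X z)) has_vector_derivative - (\<eta>1 + \<eta>2) * f * gi) (at 0)"
    unfolding vd[symmetric]
    by (rule DERIV_cong[OF DERIV_divide[OF DERIV_const gram]])
      (use nz in \<open>simp_all add: gram0 gi_def field_simps\<close>)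
  have Z_eq: "Z = (\<lambda>z. (1 / jet_gram a (q z) (X z)) *\<^sub>R
      (h e2 e2 z *\<^sub>R C e1 e1 z - h e1 e2 z *\<^sub>R C e1 e2 z - h e2 e1 z *\<^sub>R C e2 e1 z + h e1 e1 z *\<^sub>R C e2 e2 z))"
    by (simp add: Z_def jet_Z_def h_def C_def)
  have gi: "gi * (r\<^sup>2 * s\<^sup>2) = 1 / (r\<^sup>2 * c\<^sup>2)" "gi * (r\<^sup>2 * c\<^sup>2) = 1 / (r\<^sup>2 * s\<^sup>2)"
    using nz by (simp_all add: gi_def field_simps power_numeral_reduce)
  have Z0: "Z 0 = (1 / (r\<^sup>2 * c\<^sup>2)) *\<^sub>R C e1 e1 0 + (1 / (r\<^sup>2 * s\<^sup>2)) *\<^sub>R C e2 e2 0"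
    unfolding Z_eq gram0 gi_def[symmetric] h0 C0(3,4) by (simp add: scaleR_add_right gi)
  have Z0': "Z 0 = (P, z1 *\<^sub>R U, z2 *\<^sub>R W)"
  proof -
    have e: "1 / (r\<^sup>2 * c\<^sup>2) * (r * b * c\<^sup>2) + 1 / (r\<^sup>2 * s\<^sup>2) * (r * b * s\<^sup>2) = P"
      "1 / (r\<^sup>2 * c\<^sup>2) * (- (c * s\<^sup>2)) + 1 / (r\<^sup>2 * s\<^sup>2) * (s\<^sup>2 * c) = z1"
      "1 / (r\<^sup>2 * c\<^sup>2) * (c\<^sup>2 * s) + 1 / (r\<^sup>2 * s\<^sup>2) * (- (s * c\<^sup>2)) = z2"
      using nz by (simp_all add: P_def z1_def z2_def field_simps power2_eq_square)
    show ?thesis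
      unfolding Z0 C0 e[symmetric]
      by (simp only: scaleR_Pair add_Pair scaleR_scaleR scaleR_left_distrib real_scaleR_def)
  qed
  define D1 where "D1 = (T11, u11 *\<^sub>R U + v11 *\<^sub>R (\<i> * U), w11 *\<^sub>R W)"
  define D2 where "D2 = (T22, u22 *\<^sub>R U, w22 *\<^sub>R W + v22 *\<^sub>R (\<i> * W))"
  note D_def = D1_def D2_def
  have Z': "(Z has_vector_derivative
      (1 / (r\<^sup>2 * c\<^sup>2)) *\<^sub>R (D1 - (\<eta>1 * f) *\<^sub>R C e1 e1 0)
      + (1 / (r\<^sup>2 * s\<^sup>2)) *\<^sub>R (D2 - (\<eta>2 * f) *\<^sub>R C e2 e2 0)) (at 0)"
    unfolding Z_eq
    by (rule has_vector_derivative_eq_rhs[OF sc_rule[OF ginv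
          has_vector_derivative_add[OF has_vector_derivative_diff[OF has_vector_derivative_diff[OF
            sc_rule[OF h22[unfolded vd] C11] sc_rule[OF h12[unfolded vd] C12]]
            sc_rule[OF h21[unfolded vd] C21]] sc_rule[OF h11[unfolded vd] C22]]]])
      (unfold gram0 gi_def[symmetric] h0 C0(3,4) D_def[symmetric] gi[symmetric], simp add: algebra_simps)
  have "(Z has_vector_derivative (zt, zu *\<^sub>R U + (v11 / (r\<^sup>2 * c\<^sup>2)) *\<^sub>R (\<i> * U),
      zw *\<^sub>R W + (v22 / (r\<^sup>2 * s\<^sup>2)) *\<^sub>R (\<i> * W))) (at 0)"
    by (rule has_vector_derivative_eq_rhs[OF Z'])
      (simp add: D_def C0 zt_def zu_def zw_def scaleR_add_right scaleR_add_left scaleR_diff_right scaleR_diff_left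
        add_divide_distrib diff_divide_distrib)
  note Zd = this
  \<comment> \<open>The components of the derivative of Z along \<i> * U and \<i> * W disappear,
    because \<open>Z 0\<close> is orthogonal to these directions.\<close>
  have "((\<lambda>z. flrw_metric a (q z) (Z z) (Z z)) has_real_derivative
      - 2 * P * zt + 2 * r * b * (c2 * f) * (z1\<^sup>2 + z2\<^sup>2) + 2 * r\<^sup>2 * (z1 * zu + z2 * zw)) (at 0)"
    by (rule DERIV_cong[OF flrw_metric_has_derivative[OF a(1) q Zd Zd]])
      (simp add: Z0' base ips algebra_simps power2_eq_square flip: r_def b_def)
  also have "- 2 * P * zt + 2 * r * b * (c2 * f) * (z1\<^sup>2 + z2\<^sup>2) + 2 * r\<^sup>2 * (z1 * zu + z2 * zw)
    = (- 2 * H * c1 / (r * s * c)\<^sup>2 - 2 * H\<^sup>2 * c2 * (b / r) - 4 * P * (d / r - (b / r)\<^sup>2) * c2) * f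
      - 2 * (P * c2 + H * c1) / (r * c)\<^sup>2 * f11 - 2 * (P * c2 + H * c1) / (r * s)\<^sup>2 * f22"
    unfolding zt_def zu_def zw_def z1_def z2_def T11_def T22_def u11_def u22_def w11_def w22_def
      \<eta>1_def \<eta>2_def A_def B_def H_def P_def
    by (rule clifford_linearised_identity[OF nz sc])
  finally have main: "((\<lambda>z. flrw_metric a (q z) (Z z) (Z z)) has_real_derivative
    (- 2 * H * c1 / (r * s * c)\<^sup>2 - 2 * H\<^sup>2 * c2 * (b / r) - 4 * P * (d / r - (b / r)\<^sup>2) * c2) * f
      - 2 * (P * c2 + H * c1) / (r * c)\<^sup>2 * f11 - 2 * (P * c2 + H * c1) / (r * s)\<^sup>2 * f22) (at 0)" .
  \<comment> \<open>The tangential part is quadratic in these products, which vanish at 0 because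
    \<open>Z 0\<close> is normal to the torus; it therefore contributes nothing to first
    order.\<close>
  define m where "m v = (\<lambda>z. flrw_metric a (q z) (Z z) (X z v))" for v
  have m_ap: "flrw_metric a (q z) (Z z) (X z v) = m v z" for v z by (simp add: m_def)
  have m0: "m e1 0 = 0" "m e2 0 = 0"
    by (simp_all add: m_def flrw_metric_def Z0' base ips)
  obtain m1' where m1: "(m e1 has_real_derivative m1') (at 0)"
    unfolding m_def using flrw_metric_has_derivative[OF a(1) q Zd X1] by blast
  obtain m2' where m2: "(m e2 has_real_derivative m2') (at 0)"
    unfolding m_def using flrw_metric_has_derivative[OF a(1) q Zd X2] by blast
  have zero: "((\<lambda>z. k z * (i z * j z)) has_real_derivative 0) (at 0)"
    if "(k has_real_derivative k') (at 0)" "(i has_real_derivative i') (at 0)"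
      "(j has_real_derivative j') (at 0)" "i 0 = 0" "j 0 = 0" for k i j :: "real \<Rightarrow> real" and k' i' j'
    by (rule DERIV_cong[OF DERIV_mult[OF that(1) DERIV_mult[OF that(2,3)]]]) (simp add: that)
  have tang: "((\<lambda>z. jet_tangential a (q z) (X z) (Z z)) has_real_derivative 0) (at 0)"
    unfolding jet_tangential_def h_ap m_ap
    by (rule DERIV_cong[OF DERIV_add[OF DERIV_diff[OF zero[OF h22 m1 m1]
            zero[OF DERIV_cmult[OF h12] m1 m2]] zero[OF h11 m2 m2]]])
      (simp_all add: m0)
  have tang0: "jet_tangential a (q 0) (X 0) (Z 0) = 0"
    using m0 by (simp add: jet_tangential_def m_def)
  have "((\<lambda>z. jet_tangential a (q z) (X z) (Z z) / jet_gram a (q z) (X z)) has_real_derivative 0) (at 0)"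
    by (rule DERIV_cong[OF DERIV_divide[OF tang gram]]) (use nz in \<open>simp_all add: gram0 tang0\<close>)
  from DERIV_diff[OF main this] show ?H
    unfolding jet_vecH_sq_def Z_def by simp
qed

section \<open>Integrals over the torus\<close>

text \<open>Two functions are kept apart: g is written with derivatives of single surfaces, while
  smoothness is available only for G as a function of time and parameters jointly, on the region
  where the two agree. The tube lemma supplies a time interval on which they agree over the whole
  box.\<close>

lemma param_integral_has_derivative:
  fixes g :: "real \<Rightarrow> 'b::euclidean_space \<Rightarrow> real"
  assumes S: "open S" "{0} \<times> cbox lo hi \<subseteq> S" and G: "C_on 1 S G"
    and g: "\<And>s p. (s, p) \<in> S \<Longrightarrow> g s p = G (s, p)"
    and D: "\<And>p. p \<in> cbox lo hi \<Longrightarrow> ((\<lambda>s. G (s, p)) has_real_derivative D p) (at 0)"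
  shows "((\<lambda>s. integral (cbox lo hi) (g s)) has_real_derivative integral (cbox lo hi) D) (at 0)"
proof -
  obtain X0 where X0: "0 \<in> X0" "open X0" "X0 \<times> cbox lo hi \<subseteq> S"
    using Elementary_Topology.tube_lemma[OF compact_cbox S] by blast
  obtain \<delta> where \<delta>: "0 < \<delta>" "ball 0 \<delta> \<subseteq> X0" by (rule openE[OF X0(2,1)])
  have in_S: "(s, p) \<in> S" if "s \<in> ball 0 \<delta>" "p \<in> cbox lo hi" for s p
    using that \<delta>(2) X0(3) by blast
  have Gs: "((\<lambda>s. G (s, p)) has_real_derivative dirderiv (1, 0) G (s, p)) (at s)"
    if "(s, p) \<in> S" for s p
  proof -
    have 1: "((\<lambda>s. (s, p)) has_derivative (\<lambda>h. h *\<^sub>R (1, 0))) (at s)"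
      by (auto intro!: derivative_eq_intros)
    have G': "(G has_derivative (\<lambda>v. dirderiv v G (s, p))) (at (s, p))"
      using G that by (intro C_on_Suc_has_derivative[of 0 S]) simp_all
    have "(\<lambda>h. dirderiv (h *\<^sub>R (1, 0)) G (s, p)) = (*) (dirderiv (1, 0) G (s, p))"
    proof
      fix h show "dirderiv (h *\<^sub>R (1, 0)) G (s, p) = dirderiv (1, 0) G (s, p) * h"
        using linear_scale[OF has_derivative_linear[OF G'], of h "(1, 0)"] by (simp only: real_scaleR_def mult.commute)
    qed
    from has_derivative_eq_rhs[OF has_derivative_compose[OF 1 G'] this]
    show ?thesis unfolding has_field_derivative_def .
  qed
  have cG: "continuous_on S G" "continuous_on S (dirderiv (1, 0) G)"
    using C_on_SucD[of 0 S G] G by simp_all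
  have "((\<lambda>s. integral (cbox lo hi) (\<lambda>p. G (s, p))) has_real_derivative
      integral (cbox lo hi) (\<lambda>p. dirderiv (1, 0) G (0, p))) (at 0 within ball 0 \<delta>)"
  proof (rule leibniz_rule_field_derivative)
    show "((\<lambda>s. G (s, p)) has_real_derivative dirderiv (1, 0) G (s, p)) (at s within ball 0 \<delta>)"
      if "s \<in> ball 0 \<delta>" "p \<in> cbox lo hi" for s p
      by (rule has_field_derivative_at_within[OF Gs[OF in_S[OF that]]])
    show "(\<lambda>p. G (s, p)) integrable_on cbox lo hi" if "s \<in> ball 0 \<delta>" for s
    proof (intro integrable_continuous continuous_on_compose2[OF cG(1)])
      show "Pair s ` cbox lo hi \<subseteq> S" using in_S[OF that] by blast
    qed (intro continuous_intros)
    show "continuous_on (ball 0 \<delta> \<times> cbox lo hi) (\<lambda>(s, p). dirderiv (1, 0) G (s, p))"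
    proof -
      have "ball 0 \<delta> \<times> cbox lo hi \<subseteq> S" using in_S by blast
      from continuous_on_subset[OF cG(2) this] show ?thesis
        by (simp add: split_beta)
    qed
  qed (use \<delta>(1) in simp_all)
  then have "((\<lambda>s. integral (cbox lo hi) (\<lambda>p. G (s, p))) has_real_derivative
      integral (cbox lo hi) (\<lambda>p. dirderiv (1, 0) G (0, p))) (at 0)"
    using \<delta>(1) by (simp add: at_within_open[of 0 "ball 0 \<delta>"])
  \<comment> \<open>D is known only at time 0, which is enough to identify the integrand produced by
    the Leibniz rule.\<close>
  moreover have "integral (cbox lo hi) (\<lambda>p. dirderiv (1, 0) G (0, p)) = integral (cbox lo hi) D"
    by (intro Henstock_Kurzweil_Integration.integral_cong DERIV_unique[OF Gs D] in_S)
      (use \<delta>(1) in simp_all)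
  ultimately have "((\<lambda>s. integral (cbox lo hi) (\<lambda>p. G (s, p))) has_real_derivative
      integral (cbox lo hi) D) (at 0)" by simp
  then show ?thesis
    by (rule has_field_derivative_transform_within_open[of _ _ _ "ball 0 \<delta>"])
      (use \<delta>(1) in_S in \<open>auto intro!: Henstock_Kurzweil_Integration.integral_cong simp: g\<close>)
qed

abbreviation torus_box :: "param set" where
  "torus_box \<equiv> cbox (0, 0) (2 * pi, 2 * pi)"

text \<open>The fundamental theorem makes the integral along each coordinate circle vanish, and
  Fubini finishes; for \<open>e1\<close> the order of integration is swapped first.\<close>

lemma integral_periodic_dirderiv:
  fixes f :: "param \<Rightarrow> real"
  assumes f: "torus_smooth f"
  shows "integral torus_box (dirderiv e1 f) = 0" "integral torus_box (dirderiv e2 f) = 0"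
proof -
  have sm: "smooth_on UNIV f" and per: "f (x + 2 * pi, y) = f (x, y)" "f (x, y + 2 * pi) = f (x, y)" for x y
    using f by (auto simp: torus_smooth_def doubly_periodic_def)
  have per0: "f (2 * pi, y) = f (0, y)" "f (x, 2 * pi) = f (x, 0)" for x y
    using per(1)[of 0 y] per(2)[of x 0] by simp_all
  have c: "continuous_on X (dirderiv v f)" for v X
    using smooth_on_continuous[OF smooth_on_dirderiv[OF sm]] by (rule continuous_on_subset) simp
  have d: "(f has_derivative (\<lambda>v. dirderiv v f p)) (at p)" for p
    using smooth_on_has_derivative[OF sm] by blast
  have lin: "dirderiv (h *\<^sub>R v) f p = h *\<^sub>R dirderiv v f p" for h v p
    by (rule linear_scale[OF has_derivative_linear[OF d]])
  have 1: "((\<lambda>x. f (x, y)) has_vector_derivative dirderiv e1 f (x, y)) (at x within X)" for x y X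
  proof -
    have "((\<lambda>x. (x, y)) has_derivative (\<lambda>h. h *\<^sub>R e1)) (at x within X)"
      by (auto intro!: derivative_eq_intros)
    from has_derivative_compose[OF this d] show ?thesis unfolding lin has_vector_derivative_def .
  qed
  have 2: "((\<lambda>y. f (x, y)) has_vector_derivative dirderiv e2 f (x, y)) (at y within X)" for x y X
  proof -
    have "((\<lambda>y. (x, y)) has_derivative (\<lambda>h. h *\<^sub>R e2)) (at y within X)"
      by (auto intro!: derivative_eq_intros)
    from has_derivative_compose[OF this d] show ?thesis unfolding lin has_vector_derivative_def .
  qed
  have i1: "integral (cbox 0 (2 * pi)) (\<lambda>x. dirderiv e1 f (x, y)) = 0" for y
    using fundamental_theorem_of_calculus[of 0 "2 * pi" "\<lambda>x. f (x, y)" "\<lambda>x. dirderiv e1 f (x, y)"] 1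
    by (simp add: per0 integral_unique)
  have i2: "integral (cbox 0 (2 * pi)) (\<lambda>y. dirderiv e2 f (x, y)) = 0" for x
    using fundamental_theorem_of_calculus[of 0 "2 * pi" "\<lambda>y. f (x, y)" "\<lambda>y. dirderiv e2 f (x, y)"] 2
    by (simp add: per0 integral_unique)
  show "integral torus_box (dirderiv e2 f) = 0"
    unfolding integral_prod_continuous[OF c] i2 by simp
  show "integral torus_box (dirderiv e1 f) = 0"
    unfolding integral_prod_continuous[OF c]
    by (subst integral_swap_continuous) (simp_all only: i1 case_prod_unfold prod.collapse c integral_0)
qed

lemma doubly_periodic_dirderiv:
  assumes "smooth_on UNIV f" "doubly_periodic f"
  shows "doubly_periodic (dirderiv v f)"
proof -
  have shift: "dirderiv v f (p + w) = dirderiv v f p" if "\<And>q. f (q + w) = f q" for p w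
  proof -
    have "((\<lambda>q. q + w) has_derivative (\<lambda>v. v)) (at p)"
      by (auto intro!: derivative_eq_intros)
    from has_derivative_compose[OF this smooth_on_has_derivative[OF assms(1) UNIV_I]]
    have "(f has_derivative (\<lambda>v. dirderiv v f (p + w))) (at p)" unfolding that .
    then show ?thesis using dirderiv_eqI by metis
  qed
  have "f (q + (2 * pi, 0)) = f q" "f (q + (0, 2 * pi)) = f q" for q
    using assms(2) by (cases q; simp add: doubly_periodic_def)+
  from shift[OF this(1)] shift[OF this(2)] show ?thesis
    unfolding doubly_periodic_def by (metis add_Pair add_0_right)
qed

lemma torus_smooth_dirderiv: "torus_smooth f \<Longrightarrow> torus_smooth (dirderiv v f)"
  by (simp add: torus_smooth_def smooth_on_dirderiv doubly_periodic_dirderiv)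

lemma dirderiv_slice:
  assumes "smooth_on (I \<times> UNIV) f" "s \<in> I"
  shows "dirderiv v (\<lambda>p. f (s, p)) p = dirderiv (0, v) f (s, p)"
proof -
  have "((\<lambda>p. (s, p)) has_derivative (\<lambda>v. (0, v))) (at p)"
    by (auto intro!: derivative_eq_intros)
  from dirderiv_eqI[OF has_derivative_compose[OF this smooth_on_has_derivative[OF assms(1)]]] assms(2)
  show ?thesis by simp
qed

lemma has_vector_derivative_slice:
  assumes "smooth_on (I \<times> UNIV) f" "s \<in> I"
  shows "((\<lambda>s. f (s, p)) has_vector_derivative dirderiv (1, 0) f (s, p)) (at s)"
proof -
  have 1: "((\<lambda>s. (s, p)) has_derivative (\<lambda>h. h *\<^sub>R (1, 0))) (at s)"
    by (auto intro!: derivative_eq_intros)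
  have f': "(f has_derivative (\<lambda>v. dirderiv v f (s, p))) (at (s, p))"
    using smooth_on_has_derivative[OF assms(1)] assms(2) by blast
  have "dirderiv (h *\<^sub>R (1, 0)) f (s, p) = h *\<^sub>R dirderiv (1, 0) f (s, p)" for h
    by (rule linear_scale[OF has_derivative_linear[OF f']])
  with has_derivative_compose[OF 1 f'] show ?thesis
    unfolding has_vector_derivative_def by (simp only:)
qed

text \<open>At s = 0 the velocity of a derivative is the derivative of the velocity. This makes the
  first-order motion of the 2-jet depend on V alone, whatever the variation.\<close>

lemma dirderiv_slice_commute:
  fixes f :: "real \<times> 'a::real_normed_vector \<Rightarrow> 'b::banach"
  assumes "open I" "smooth_on (I \<times> UNIV) f" "s \<in> I"
  shows "dirderiv (1, 0) (dirderiv (0, v) f) (s, p) = dirderiv v (\<lambda>p. dirderiv (1, 0) f (s, p)) p"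
  using dirderiv_commute[of "I \<times> UNIV" f "(s, p)" "(1, 0)" "(0, v)"] assms
    dirderiv_slice[OF smooth_on_dirderiv[OF assms(2)] assms(3)]
  by (simp add: open_Times smooth_on_C)

section \<open>First variation at the Clifford torus\<close>

text \<open>The shape is stable under differentiation: m = n = 0 covers the velocity field, and m =
  1 or n = 1 with \<psi> the original function covers its first derivatives, where a rotated term
  has appeared.\<close>

lemma dirderiv_polar_field:
  fixes \<phi> \<psi> :: "param \<Rightarrow> real"
  assumes \<phi>: "(\<phi> has_derivative \<phi>') (at p)" and \<psi>: "(\<psi> has_derivative \<psi>') (at p)"
  shows "dirderiv v (\<lambda>p. (k * \<phi> p, A *\<^sub>R (\<phi> p *\<^sub>R cis (fst p) + (m * \<psi> p) *\<^sub>R (\<i> * cis (fst p))),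
      B *\<^sub>R (\<phi> p *\<^sub>R cis (snd p) + (n * \<psi> p) *\<^sub>R (\<i> * cis (snd p))))) p
    = (k * \<phi>' v,
       A *\<^sub>R (\<phi>' v *\<^sub>R cis (fst p) + (\<phi> p * fst v + m * \<psi>' v) *\<^sub>R (\<i> * cis (fst p)) - (m * \<psi> p * fst v) *\<^sub>R cis (fst p)),
       B *\<^sub>R (\<phi>' v *\<^sub>R cis (snd p) + (\<phi> p * snd v + n * \<psi>' v) *\<^sub>R (\<i> * cis (snd p)) - (n * \<psi> p * snd v) *\<^sub>R cis (snd p)))"
  by (rule dirderiv_eqI)
    (auto intro!: derivative_eq_intros \<phi> \<psi> simp: fun_eq_iff scaleR_conv_of_real algebra_simps)

definition clifford_H :: "(real \<Rightarrow> real) \<Rightarrow> real \<Rightarrow> real \<Rightarrow> real" where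
  "clifford_H a t0 \<alpha> = (sin \<alpha> / cos \<alpha> - cos \<alpha> / sin \<alpha>) / a t0"

definition clifford_P :: "(real \<Rightarrow> real) \<Rightarrow> real \<Rightarrow> real" where
  "clifford_P a t0 = 2 * deriv a t0 / a t0"

text \<open>The Euler-Lagrange expression of the Willmore functional in the direction \<open>c1 \<nu> + c2 n\<close>.\<close>

definition clifford_EL :: "(real \<Rightarrow> real) \<Rightarrow> real \<Rightarrow> real \<Rightarrow> real \<Rightarrow> real \<Rightarrow> real" where
  "clifford_EL a t0 \<alpha> c1 c2 =
     - 2 * clifford_H a t0 \<alpha> * c1 / (a t0 * sin \<alpha> * cos \<alpha>)\<^sup>2
     - 2 * (clifford_H a t0 \<alpha>)\<^sup>2 * c2 * (deriv a t0 / a t0)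
     - 4 * clifford_P a t0 * (deriv (deriv a) t0 / a t0 - (deriv a t0 / a t0)\<^sup>2) * c2
     + ((clifford_H a t0 \<alpha>)\<^sup>2 - (clifford_P a t0)\<^sup>2) * (clifford_H a t0 \<alpha> * c1 + clifford_P a t0 * c2)"

lemma clifford_mean_curv':
  assumes "a t0 > 0" "0 < \<alpha>" "\<alpha> < pi / 2"
  shows "mean_curv a (clifford t0 \<alpha>) (clifford_normal a t0 \<alpha>) p = clifford_H a t0 \<alpha>"
    and "mean_curv a (clifford t0 \<alpha>) d_t p = clifford_P a t0"
  using clifford_mean_curv[where a = a, OF assms]
  by (simp_all add: clifford_H_def clifford_P_def tan_def cot_def)

lemma flrw_metric_clifford_frame:
  assumes "a t0 > 0"
  shows "flrw_metric a (clifford t0 \<alpha> p) (h *\<^sub>R clifford_normal a t0 \<alpha> p - k *\<^sub>R d_t p)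
      (h *\<^sub>R clifford_normal a t0 \<alpha> p - k *\<^sub>R d_t p) = h\<^sup>2 - k\<^sup>2"
proof -
  have "flrw_metric a (clifford t0 \<alpha> p) (d_t p) (d_t p) = -1"
    by (simp add: flrw_metric_def d_t_def)
  then show ?thesis
    using clifford_normal_unit(2,3)[where a = a, OF assms]
      flrw_metric_commute[of a "clifford t0 \<alpha> p" "d_t p" "clifford_normal a t0 \<alpha> p"]
    by (simp add: flrw_metric_linear power2_eq_square)
qed

lemma clifford_vecH_sq:
  assumes "a t0 > 0" "0 < \<alpha>" "\<alpha> < pi / 2"
  shows "vecH_sq a (clifford t0 \<alpha>) p = (clifford_H a t0 \<alpha>)\<^sup>2 - (clifford_P a t0)\<^sup>2"
  unfolding vecH_sq_def clifford_vecH[where a = a, OF assms] clifford_mean_curv'[where a = a, OF assms]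
  by (rule flrw_metric_clifford_frame[where a = a, OF assms(1)])

lemma clifford_gram_det:
  "gram_det a (clifford t0 \<alpha>) p = (a t0) ^ 4 * (cos \<alpha>)\<^sup>2 * (sin \<alpha>)\<^sup>2"
  by (simp add: gram_det_def clifford_induced_metric power_numeral_reduce)

text \<open>The factor H * c1 + P * c2 is the metric product of \<open>c1 \<nu> + c2 n\<close> with
  \<open>vecH\<close>, the sign of the second term coming from <n, n> = -1; this is the usual first
  variation of area.\<close>

lemma clifford_first_variation:
  assumes a: "smooth_on UNIV a" "\<And>t. a t > 0" and \<alpha>: "0 < \<alpha>" "\<alpha> < pi / 2"
    and \<phi>: "torus_smooth \<phi>"
    and var: "variation (clifford t0 \<alpha>) (\<lambda>p. \<phi> p *\<^sub>R (c1 *\<^sub>R clifford_normal a t0 \<alpha> p + c2 *\<^sub>R d_t p)) \<Phi>"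
  defines "H \<equiv> clifford_H a t0 \<alpha>" and "P \<equiv> clifford_P a t0"
  shows "((\<lambda>s. area a (\<Phi> s)) has_real_derivative
      (H * c1 + P * c2) * surface_integral a (clifford t0 \<alpha>) \<phi>) (at 0)"
    and "((\<lambda>s. willmore a (\<Phi> s)) has_real_derivative
      clifford_EL a t0 \<alpha> c1 c2 * surface_integral a (clifford t0 \<alpha>) \<phi>) (at 0)"
proof -
  define r where "r = a t0"
  define c where "c = cos \<alpha>"
  define s where "s = sin \<alpha>"
  define A where "A = c1 * s / r"
  define B where "B = - c1 * c / r"
  have pos: "r > 0" "c > 0" "s > 0"
    using a(2)[of t0] cos_gt_zero[of \<alpha>] sin_gt_zero[of \<alpha>] \<alpha> by (auto simp: r_def c_def s_def)
  define V where "V = (\<lambda>p. \<phi> p *\<^sub>R (c1 *\<^sub>R clifford_normal a t0 \<alpha> p + c2 *\<^sub>R d_t p))"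
  have V: "V = (\<lambda>p. (c2 * \<phi> p, A *\<^sub>R (\<phi> p *\<^sub>R cis (fst p)), B *\<^sub>R (\<phi> p *\<^sub>R cis (snd p))))"
    by (auto simp: V_def clifford_normal_def d_t_def A_def B_def r_def c_def s_def split_beta mult.commute)
  define f where "f = (\<lambda>(s, p). \<Phi> s p)"
  obtain \<epsilon> where \<epsilon>: "\<epsilon> > 0" and sm: "smooth_on ({-\<epsilon><..<\<epsilon>} \<times> UNIV) f"
    and \<Phi>0: "\<Phi> 0 = clifford t0 \<alpha>" and dV: "\<And>p. ((\<lambda>s. \<Phi> s p) has_vector_derivative V p) (at 0)"
    using var unfolding variation_def V_def[symmetric] f_def[symmetric] by blast
  define I where "I = {-\<epsilon><..<\<epsilon>}"
  have I: "open I" "0 \<in> I" and sm: "smooth_on (I \<times> UNIV) f" using \<epsilon> sm by (auto simp: I_def)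
  have f_slice: "(\<lambda>p. f (s, p)) = \<Phi> s" for s by (simp add: f_def)
  define X where "X = (\<lambda>z v. dirderiv (0, v) f z)"
  define N where "N = (\<lambda>z v w. dirderiv (0, v) (dirderiv (0, w) f) z)"
  have smX: "smooth_on (I \<times> UNIV) (dirderiv (0, v) f)" for v
    by (rule smooth_on_dirderiv[OF sm])
  have smN: "smooth_on (I \<times> UNIV) (dirderiv (0, v) (dirderiv (0, w) f))" for v w
    by (rule smooth_on_dirderiv[OF smX])
  have X_eq: "dirderiv v (\<Phi> s) = (\<lambda>p. dirderiv (0, v) f (s, p))" if "s \<in> I" for s v
    using dirderiv_slice[OF sm that] unfolding f_slice by blast
  have N_eq: "dirderiv v (dirderiv w (\<Phi> s)) = (\<lambda>p. dirderiv (0, v) (dirderiv (0, w) f) (s, p))"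
    if "s \<in> I" for s v w
    unfolding X_eq[OF that] using dirderiv_slice[OF smX that] by blast
  have Xf: "(\<lambda>v. dirderiv v (\<Phi> s) p) = X (s, p)" if "s \<in> I" for s p
    by (rule ext) (simp add: X_def fun_cong[OF X_eq[OF that]])
  have Nf: "(\<lambda>v w. dirderiv v (dirderiv w (\<Phi> s)) p) = N (s, p)" if "s \<in> I" for s p
    by (rule ext)+ (use fun_cong[OF N_eq[OF that]] in \<open>simp add: N_def\<close>)
  define G where "G = (\<lambda>z. jet_gram a (f z) (X z))"
  define E where "E = (\<lambda>z. jet_vecH_sq a (f z) (X z) (N z))"
  have G_eq: "gram_det a (\<Phi> s) p = G (s, p)" if "s \<in> I" for s p
    using gram_det_jet[of a "\<Phi> s" p] unfolding Xf[OF that] by (simp add: G_def f_def)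
  have E_eq: "vecH_sq a (\<Phi> s) p = E (s, p)" if "s \<in> I" "G (s, p) > 0" for s p
  proof -
    have "gram_det a (\<Phi> s) p \<noteq> 0" using that G_eq by simp
    from vecH_sq_jet[OF this] show ?thesis
      unfolding Nf[OF that(1)] unfolding Xf[OF that(1)] by (simp add: E_def f_def)
  qed
  have g0: "G (0, p) = r ^ 4 * c\<^sup>2 * s\<^sup>2" for p
    using G_eq[OF I(2)] \<Phi>0 clifford_gram_det[of a t0 \<alpha> p] by (simp add: r_def c_def s_def)
  have G0: "G (0, p) > 0" for p unfolding g0 using pos by simp
  have sqrt0: "sqrt (G (0, p)) = r\<^sup>2 * c * s" for p
    unfolding g0 using pos by (intro real_sqrt_unique) (simp_all add: power_mult_distrib flip: power_mult)
  \<comment> \<open>On this open set the Gram determinant is positive, so \<open>E\<close> is smooth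
    and equals \<open>vecH_sq\<close> of the varied surface. It contains the whole parameter plane
    at time 0.\<close>
  define S where "S = (I \<times> UNIV) \<inter> G -` {0<..}"
  have S0: "open (I \<times> (UNIV :: param set))" by (intro open_Times I open_UNIV)
  have cG: "C_on k (I \<times> UNIV) G" for k
    unfolding G_def X_def by (intro C_on_jet_gram[where N = N] a S0 smooth_on_C sm smX)
      (unfold N_def, intro smooth_on_C smN)
  have S: "open S"
    unfolding S_def using cG[of 0] by (intro continuous_open_preimage S0) simp_all
  have S_sub: "S \<subseteq> I \<times> UNIV" "\<And>z. z \<in> S \<Longrightarrow> G z > 0" and S_0: "{0} \<times> torus_box \<subseteq> S"
    using G0 I(2) by (auto simp: S_def)
  have on_S: "C_on k S h" if "smooth_on (I \<times> UNIV) h" for h :: "real \<times> param \<Rightarrow> spacetime" and k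
    by (rule C_on_subset[OF S_sub(1) smooth_on_C[OF that]])
  have cE: "C_on k S E" for k
    unfolding E_def X_def N_def
    by (intro C_on_jet_vecH_sq a S on_S sm smX smN) (use S_sub(2) in \<open>simp add: G_def X_def\<close>)
  have cR: "C_on k S (\<lambda>z. sqrt (G z))" for k
    by (rule C_on_real_comp[OF S C_on_sqrt C_on_subset[OF S_sub(1) cG]]) (use S_sub(2) in auto)

  have smooth\<phi>: "smooth_on UNIV \<phi>" using \<phi> by (simp add: torus_smooth_def)
  define f1 where "f1 = dirderiv e1 \<phi>"
  define f2 where "f2 = dirderiv e2 \<phi>"
  define f11 where "f11 = dirderiv e1 f1"
  define f22 where "f22 = dirderiv e2 f2"
  have d\<phi>: "(\<phi> has_derivative (\<lambda>v. dirderiv v \<phi> p)) (at p)" for p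
    using smooth_on_has_derivative[OF smooth\<phi>] by blast
  have df1: "(f1 has_derivative (\<lambda>v. dirderiv v f1 p)) (at p)"
    and df2: "(f2 has_derivative (\<lambda>v. dirderiv v f2 p)) (at p)" for p
    unfolding f1_def f2_def
    using smooth_on_has_derivative[OF smooth_on_dirderiv[OF smooth\<phi>]] by blast+
  have ap: "dirderiv e1 \<phi> p = f1 p" "dirderiv e2 \<phi> p = f2 p" "dirderiv e1 f1 p = f11 p"
    "dirderiv e2 f2 p = f22 p" for p
    by (simp_all add: f1_def f2_def f11_def f22_def)
  have V1: "dirderiv e1 V = (\<lambda>p. (c2 * f1 p, A *\<^sub>R (f1 p *\<^sub>R cis (fst p) + \<phi> p *\<^sub>R (\<i> * cis (fst p))),
      B *\<^sub>R (f1 p *\<^sub>R cis (snd p))))"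
    using dirderiv_polar_field[OF d\<phi> d\<phi>, where m = 0 and n = 0] by (auto simp: V f1_def)
  have V2: "dirderiv e2 V = (\<lambda>p. (c2 * f2 p, A *\<^sub>R (f2 p *\<^sub>R cis (fst p)),
      B *\<^sub>R (f2 p *\<^sub>R cis (snd p) + \<phi> p *\<^sub>R (\<i> * cis (snd p)))))"
    using dirderiv_polar_field[OF d\<phi> d\<phi>, where m = 0 and n = 0] by (auto simp: V f2_def)
  have V11: "dirderiv e1 (dirderiv e1 V) p = (c2 * f11 p,
      A *\<^sub>R (f11 p *\<^sub>R cis (fst p) + (2 * f1 p) *\<^sub>R (\<i> * cis (fst p)) - \<phi> p *\<^sub>R cis (fst p)),
      B *\<^sub>R (f11 p *\<^sub>R cis (snd p)))" for p
    using dirderiv_polar_field[OF df1 d\<phi>, where m = 1 and n = 0 and v = e1 and k = c2 and A = A and B = B and p = p]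
    unfolding V1 by (simp add: ap mult_2[symmetric])
  have V22: "dirderiv e2 (dirderiv e2 V) p = (c2 * f22 p, A *\<^sub>R (f22 p *\<^sub>R cis (fst p)),
      B *\<^sub>R (f22 p *\<^sub>R cis (snd p) + (2 * f2 p) *\<^sub>R (\<i> * cis (snd p)) - \<phi> p *\<^sub>R cis (snd p)))" for p
    using dirderiv_polar_field[OF df2 d\<phi>, where m = 0 and n = 1 and v = e2 and k = c2 and A = A and B = B and p = p]
    unfolding V2 by (simp add: ap mult_2[symmetric])

  \<comment> \<open>The velocity is given pointwise by \<open>dV\<close>; rewriting it as a
    derivative of the joint map f allows it to be differentiated along the torus.\<close>
  have s0: "(\<lambda>p. dirderiv (1, 0) f (0, p)) = V"
  proof
    fix p
    have "((\<lambda>s. f (s, p)) has_vector_derivative V p) (at 0)" using dV[of p] by (simp add: f_def)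
    from vector_derivative_unique_at[OF has_vector_derivative_slice[OF sm I(2)] this]
    show "dirderiv (1, 0) f (0, p) = V p" .
  qed
  have s1: "(\<lambda>p. dirderiv (1, 0) (dirderiv (0, v) f) (0, p)) = dirderiv v V" for v
    using dirderiv_slice_commute[OF I(1) sm I(2)] unfolding s0 by blast
  have s2: "dirderiv (1, 0) (dirderiv (0, v) (dirderiv (0, w) f)) (0, p) = dirderiv v (dirderiv w V) p" for v w p
    using dirderiv_slice_commute[OF I(1) smX I(2)] unfolding s1 by blast
  have q': "((\<lambda>h. f (h, p)) has_vector_derivative V p) (at 0)" for p
    using has_vector_derivative_slice[OF sm I(2)] fun_cong[OF s0] by metis
  have X': "((\<lambda>h. X (h, p) v) has_vector_derivative dirderiv v V p) (at 0)" for p v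
    unfolding X_def using has_vector_derivative_slice[OF smX I(2)] fun_cong[OF s1] by metis
  have N': "((\<lambda>h. N (h, p) v w) has_vector_derivative dirderiv v (dirderiv w V) p) (at 0)" for p v w
    unfolding N_def s2[symmetric] by (rule has_vector_derivative_slice[OF smN I(2)])
  have base: "f (0, p) = (t0, c *\<^sub>R cis (fst p), s *\<^sub>R cis (snd p))"
    "X (0, p) e1 = (0, c *\<^sub>R (\<i> * cis (fst p)), 0)" "X (0, p) e2 = (0, 0, s *\<^sub>R (\<i> * cis (snd p)))"
    "N (0, p) e1 e1 = (0, - c *\<^sub>R cis (fst p), 0)" "N (0, p) e2 e2 = (0, 0, - s *\<^sub>R cis (snd p))"
    "N (0, p) e1 e2 = 0" "N (0, p) e2 e1 = 0" for p
  proof -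
    show "f (0, p) = (t0, c *\<^sub>R cis (fst p), s *\<^sub>R cis (snd p))"
      by (simp add: f_def \<Phi>0 clifford_def c_def s_def split_beta)
    have x: "X (0, p) v = dirderiv v (clifford t0 \<alpha>) p" for v
      unfolding X_def using fun_cong[OF X_eq[OF I(2), where v = v], where x = p] unfolding \<Phi>0 by (rule sym)
    have n: "N (0, p) v w = dirderiv v (dirderiv w (clifford t0 \<alpha>)) p" for v w
      unfolding N_def using fun_cong[OF N_eq[OF I(2), where v = v and w = w], where x = p]
      unfolding \<Phi>0 by (rule sym)
    show "X (0, p) e1 = (0, c *\<^sub>R (\<i> * cis (fst p)), 0)" "X (0, p) e2 = (0, 0, s *\<^sub>R (\<i> * cis (snd p)))"
      by (simp_all add: x clifford_dirderiv c_def s_def)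
    show "N (0, p) e1 e1 = (0, - c *\<^sub>R cis (fst p), 0)" "N (0, p) e2 e2 = (0, 0, - s *\<^sub>R cis (snd p))"
      "N (0, p) e1 e2 = 0" "N (0, p) e2 e1 = 0"
      unfolding n clifford_dirderiv2 by (simp_all add: c_def s_def zero_prod_def)
  qed
  define Q where "Q = H\<^sup>2 - P\<^sup>2"
  define k0 where "k0 = - 2 * H * c1 / (r * s * c)\<^sup>2 - 2 * H\<^sup>2 * c2 * (deriv a t0 / r)
      - 4 * P * (deriv (deriv a) t0 / r - (deriv a t0 / r)\<^sup>2) * c2"
  define k1 where "k1 = 2 * (P * c2 + H * c1) / (r * c)\<^sup>2"
  define k2 where "k2 = 2 * (P * c2 + H * c1) / (r * s)\<^sup>2"
  have jets: "((\<lambda>h. G (h, p)) has_real_derivative 2 * (H * c1 + P * c2) * \<phi> p * (r ^ 4 * c\<^sup>2 * s\<^sup>2)) (at 0)"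
    "((\<lambda>h. E (h, p)) has_real_derivative k0 * \<phi> p - k1 * f11 p - k2 * f22 p) (at 0)" for p
  proof -
    note defs = A_def B_def r_def c_def s_def
    have q: "((\<lambda>h. f (h, p)) has_vector_derivative
        (c2 * \<phi> p, (A * \<phi> p) *\<^sub>R cis (fst p), (B * \<phi> p) *\<^sub>R cis (snd p))) (at 0)"
      using q'[of p] by (simp add: V)
    have X1: "((\<lambda>h. X (h, p) e1) has_vector_derivative (c2 * f1 p,
        A *\<^sub>R (f1 p *\<^sub>R cis (fst p) + \<phi> p *\<^sub>R (\<i> * cis (fst p))), (B * f1 p) *\<^sub>R cis (snd p))) (at 0)"
      using X'[of p e1] unfolding fun_cong[OF V1] by simp
    have X2: "((\<lambda>h. X (h, p) e2) has_vector_derivative (c2 * f2 p, (A * f2 p) *\<^sub>R cis (fst p),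
        B *\<^sub>R (f2 p *\<^sub>R cis (snd p) + \<phi> p *\<^sub>R (\<i> * cis (snd p))))) (at 0)"
      using X'[of p e2] unfolding fun_cong[OF V2] by simp
    have N11: "((\<lambda>h. N (h, p) e1 e1) has_vector_derivative (c2 * f11 p,
        A *\<^sub>R (f11 p *\<^sub>R cis (fst p) + (2 * f1 p) *\<^sub>R (\<i> * cis (fst p)) - \<phi> p *\<^sub>R cis (fst p)),
        (B * f11 p) *\<^sub>R cis (snd p))) (at 0)"
      using N'[of p e1 e1] unfolding V11 by simp
    have N22: "((\<lambda>h. N (h, p) e2 e2) has_vector_derivative (c2 * f22 p, (A * f22 p) *\<^sub>R cis (fst p),
        B *\<^sub>R (f22 p *\<^sub>R cis (snd p) + (2 * f2 p) *\<^sub>R (\<i> * cis (snd p)) - \<phi> p *\<^sub>R cis (snd p)))) (at 0)"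
      using N'[of p e2 e2] unfolding V22 by simp
    note J = clifford_jet_variation[where X = "\<lambda>h. X (h, p)" and N = "\<lambda>h. N (h, p)",
        OF a \<alpha> q[unfolded defs] X1[unfolded defs] X2[unfolded defs] N11[unfolded defs] N22[unfolded defs]
          N' N' refl refl base[unfolded defs]]
    show "((\<lambda>h. G (h, p)) has_real_derivative 2 * (H * c1 + P * c2) * \<phi> p * (r ^ 4 * c\<^sup>2 * s\<^sup>2)) (at 0)"
      unfolding G_def H_def P_def clifford_H_def clifford_P_def r_def c_def s_def by (rule J(1))
    show "((\<lambda>h. E (h, p)) has_real_derivative k0 * \<phi> p - k1 * f11 p - k2 * f22 p) (at 0)"
      unfolding E_def k0_def k1_def k2_def H_def P_def clifford_H_def clifford_P_def r_def c_def s_def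
      by (rule DERIV_cong[OF J(2)]) simp
  qed
  have root: "((\<lambda>h. sqrt (G (h, p))) has_real_derivative (H * c1 + P * c2) * \<phi> p * (r\<^sup>2 * c * s)) (at 0)" for p
    by (rule DERIV_cong[OF DERIV_chain2[OF DERIV_real_sqrt[OF G0] jets(1)]])
      (unfold sqrt0, use pos in \<open>simp add: field_simps power_numeral_reduce\<close>)
  have E0: "E (0, p) = Q" for p
    using E_eq[OF I(2) G0] clifford_vecH_sq[where a = a, OF a(2) \<alpha>] by (simp add: \<Phi>0 Q_def H_def P_def)
  have si: "surface_integral a (clifford t0 \<alpha>) h = integral torus_box (\<lambda>p. h p * (r\<^sup>2 * c * s))" for h
  proof -
    have "sqrt (gram_det a (clifford t0 \<alpha>) p) = r\<^sup>2 * c * s" for p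
      using sqrt0[of p] G_eq[OF I(2), of p] \<Phi>0 by simp
    then show ?thesis by (simp only: surface_integral_def)
  qed

  have "((\<lambda>h. integral torus_box (\<lambda>p. 1 * sqrt (gram_det a (\<Phi> h) p))) has_real_derivative
      integral torus_box (\<lambda>p. (H * c1 + P * c2) * \<phi> p * (r\<^sup>2 * c * s))) (at 0)"
  proof (rule param_integral_has_derivative[OF S S_0 cR _ root])
    show "1 * sqrt (gram_det a (\<Phi> h) p) = sqrt (G (h, p))" if "(h, p) \<in> S" for h p
    proof -
      have "h \<in> I" using S_sub(1) that by blast
      then show ?thesis by (simp add: G_eq)
    qed
  qed
  then show "((\<lambda>s. area a (\<Phi> s)) has_real_derivative
      (H * c1 + P * c2) * surface_integral a (clifford t0 \<alpha>) \<phi>) (at 0)"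
    unfolding area_def surface_integral_def[of a "\<Phi> s" for s] si
    by (simp add: mult.assoc)

  \<comment> \<open>\<open>clifford_EL\<close> gathers \<open>k0\<close> and the term Q * (H * c1 +
    P * c2), in which the constant value Q of the squared mean curvature multiplies the relative
    change of the area density.\<close>
  have EG: "((\<lambda>h. E (h, p) * sqrt (G (h, p))) has_real_derivative
      (clifford_EL a t0 \<alpha> c1 c2 * \<phi> p - k1 * f11 p - k2 * f22 p) * (r\<^sup>2 * c * s)) (at 0)" for p
    by (rule DERIV_cong[OF DERIV_mult[OF jets(2) root]])
      (simp add: sqrt0 E0 clifford_EL_def k0_def Q_def H_def P_def r_def c_def s_def algebra_simps)
  have "((\<lambda>h. integral torus_box (\<lambda>p. vecH_sq a (\<Phi> h) p * sqrt (gram_det a (\<Phi> h) p))) has_real_derivative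
      integral torus_box (\<lambda>p. (clifford_EL a t0 \<alpha> c1 c2 * \<phi> p - k1 * f11 p - k2 * f22 p) * (r\<^sup>2 * c * s))) (at 0)"
  proof (rule param_integral_has_derivative[OF S S_0 C_on_mult[OF S cE cR] _ EG])
    show "vecH_sq a (\<Phi> h) p * sqrt (gram_det a (\<Phi> h) p) = E (h, p) * sqrt (G (h, p))" if "(h, p) \<in> S" for h p
    proof -
      have "h \<in> I" "G (h, p) > 0" using S_sub that by blast+
      then show ?thesis by (simp add: G_eq E_eq)
    qed
  qed
  also have "integral torus_box (\<lambda>p. (clifford_EL a t0 \<alpha> c1 c2 * \<phi> p - k1 * f11 p - k2 * f22 p) * (r\<^sup>2 * c * s))
    = clifford_EL a t0 \<alpha> c1 c2 * surface_integral a (clifford t0 \<alpha>) \<phi>"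
  proof -
    have int: "(\<lambda>p. k * h p) integrable_on torus_box" if "torus_smooth h" for h :: "param \<Rightarrow> real" and k
      using that unfolding torus_smooth_def
      by (intro integrable_continuous continuous_on_mult_left continuous_on_subset[OF smooth_on_continuous]) auto
    have t: "torus_smooth f1" "torus_smooth f2" "torus_smooth f11" "torus_smooth f22"
      unfolding f11_def f22_def f1_def f2_def using \<phi> by (simp_all add: torus_smooth_dirderiv)
    have z: "integral torus_box f11 = 0" "integral torus_box f22 = 0"
      unfolding f11_def f22_def using integral_periodic_dirderiv t(1,2) by blast+
    show ?thesis
      unfolding si integral_mult_left
      using int[OF \<phi>] int[OF t(3)] int[OF t(4)]
      by (simp add: Henstock_Kurzweil_Integration.integral_diff integrable_diff z)
  qed
  finally show "((\<lambda>s. willmore a (\<Phi> s)) has_real_derivative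
      clifford_EL a t0 \<alpha> c1 c2 * surface_integral a (clifford t0 \<alpha>) \<phi>) (at 0)"
    unfolding willmore_def surface_integral_def[of a "\<Phi> s" for s] .
qed

section \<open>Smoothness of the explicit fields and existence of variations\<close>

lemma C_on_ident: "open S \<Longrightarrow> C_on k S (\<lambda>p. p)"
proof (induction k)
  case (Suc k)
  then show ?case by (intro C_on_SucI[where f' = "\<lambda>p v. v"]) (auto intro: C_on_const)
qed simp

lemma C_on_cis_comp:
  fixes f :: "'a::real_normed_vector \<Rightarrow> real"
  assumes "open S" "C_on k S f"
  shows "C_on k S (\<lambda>p. cis (f p))"
  by (rule C_on_real_comp[OF assms(1) C_on_cis assms(2) subset_UNIV])

lemma C_on_polar:
  fixes f g x y u v :: "'a::real_normed_vector \<Rightarrow> real"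
  assumes "open S" "C_on k S x" "C_on k S u" "C_on k S v" "C_on k S f" "C_on k S g"
  shows "C_on k S (\<lambda>p. (x p, f p *\<^sub>R cis (u p), g p *\<^sub>R cis (v p)))"
  by (intro C_on_Pair C_on_scaleR C_on_cis_comp assms)

lemma cis_add_2pi [simp]: "cis (x + 2 * pi) = cis x"
  by (simp add: complex_eq_iff)

lemma torus_smooth_polar:
  "torus_smooth (\<lambda>p. (k :: real, m *\<^sub>R cis (fst p), n *\<^sub>R cis (snd p)))"
proof -
  have "C_on j UNIV (\<lambda>p :: param. (k, m *\<^sub>R cis (fst p), n *\<^sub>R cis (snd p)))" for j
    by (intro C_on_polar C_on_const C_on_fst C_on_snd C_on_ident open_UNIV)
  then show ?thesis
    by (simp add: torus_smooth_def smooth_on_def doubly_periodic_def)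
qed

lemma torus_smooth_const: "torus_smooth (\<lambda>p. c)"
  by (simp add: torus_smooth_def smooth_on_def doubly_periodic_def C_on_const)

text \<open>The two sines serve, up to a factor, as periodic primitives of cos x and cos 2x.\<close>

lemma torus_smooth_cos_sin:
  "torus_smooth (\<lambda>p. cos (fst p))" "torus_smooth (\<lambda>p. sin (fst p))" "torus_smooth (\<lambda>p. sin (2 * fst p))"
proof -
  have f: "C_on k UNIV (\<lambda>p::param. fst p)" for k by (intro C_on_fst C_on_ident open_UNIV)
  have p: "sin (2 * x + 4 * pi) = sin (2 * x)" for x
    using sin_periodic[of "2 * x + 2 * pi"] by (simp add: add.assoc)
  show "torus_smooth (\<lambda>p. cos (fst p))" "torus_smooth (\<lambda>p. sin (fst p))" "torus_smooth (\<lambda>p. sin (2 * fst p))"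
    unfolding torus_smooth_def smooth_on_def doubly_periodic_def
    by (auto intro!: C_on_real_comp[OF open_UNIV C_on_cos_sin(1) f] C_on_real_comp[OF open_UNIV C_on_cos_sin(2) f]
        C_on_real_comp[OF open_UNIV C_on_cos_sin(2) C_on_mult[OF open_UNIV C_on_const[OF open_UNIV] f]]
        simp: distrib_left p)
qed

lemma clifford_frame_polar:
  "c1 *\<^sub>R clifford_normal a t0 \<alpha> p + c2 *\<^sub>R d_t p
    = (c2, (c1 * sin \<alpha> / a t0) *\<^sub>R cis (fst p), (- (c1 * cos \<alpha> / a t0)) *\<^sub>R cis (snd p))"
  by (simp add: clifford_normal_def d_t_def split_beta)

lemma clifford_polar: "clifford t0 \<alpha> = (\<lambda>p. (t0, cos \<alpha> *\<^sub>R cis (fst p), sin \<alpha> *\<^sub>R cis (snd p)))"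
  by (auto simp: clifford_def)

lemma polar_in_FLRW: "(t, cos \<theta> *\<^sub>R cis x, sin \<theta> *\<^sub>R cis y) \<in> FLRW"
  by (simp add: FLRW_def norm_Pair)

lemma clifford_spacelike_torus:
  assumes "a t0 > 0" "0 < \<alpha>" "\<alpha> < pi / 2"
  shows "spacelike_torus a (clifford t0 \<alpha>)"
proof -
  have c: "cos \<alpha> > 0" "sin \<alpha> > 0"
    using assms by (auto intro: cos_gt_zero sin_gt_zero)
  have "induced_metric a (clifford t0 \<alpha>) p v v > 0" if "v \<noteq> 0" for p v
  proof -
    have "fst v \<noteq> 0 \<or> snd v \<noteq> 0" using that by (simp add: prod_eq_iff)
    then have "0 < (cos \<alpha> * fst v)\<^sup>2 + (sin \<alpha> * snd v)\<^sup>2"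
      using c by (simp add: sum_power2_gt_zero_iff)
    then have "0 < (cos \<alpha>)\<^sup>2 * (fst v * fst v) + (sin \<alpha>)\<^sup>2 * (snd v * snd v)"
      by (simp add: power2_eq_square mult_ac)
    then show ?thesis using assms(1) by (simp add: clifford_induced_metric)
  qed
  moreover have "range (clifford t0 \<alpha>) \<subseteq> FLRW"
    by (auto simp: clifford_polar polar_in_FLRW)
  moreover have "torus_smooth (clifford t0 \<alpha>)"
    unfolding clifford_polar by (rule torus_smooth_polar)
  ultimately show ?thesis by (simp add: spacelike_torus_def)
qed

lemma clifford_normal_field:
  assumes "a t0 > 0"
  shows "normal_field a (clifford t0 \<alpha>) (\<lambda>p. c1 *\<^sub>R clifford_normal a t0 \<alpha> p + c2 *\<^sub>R d_t p)"
proof -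
  have "flrw_metric a (clifford t0 \<alpha> p) (d_t p) (dirderiv v (clifford t0 \<alpha>) p) = 0" for p v
    by (simp add: flrw_metric_def d_t_def clifford_dirderiv)
  moreover have "torus_smooth (\<lambda>p. c1 *\<^sub>R clifford_normal a t0 \<alpha> p + c2 *\<^sub>R d_t p)"
    unfolding clifford_frame_polar by (rule torus_smooth_polar)
  ultimately show ?thesis
    using clifford_normal_unit(1,4)[where a = a, OF assms]
    by (simp add: normal_field_def flrw_metric_linear) (simp add: tangent_def inner_add_right d_t_def flip: zero_prod_def)
qed

text \<open>The variation moves the time coordinate linearly and rotates the angle \<open>\<alpha>\<close>, so that it stays
  on the sphere.\<close>

lemma clifford_variation_exists:
  assumes \<phi>: "torus_smooth \<phi>"
  shows "\<exists>\<Phi>. variation (clifford t0 \<alpha>)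
    (\<lambda>p. \<phi> p *\<^sub>R (c1 *\<^sub>R clifford_normal a t0 \<alpha> p + c2 *\<^sub>R d_t p)) \<Phi>"
proof -
  \<comment> \<open>The derivative of the torus point in \<alpha> is - a(t0) times the unit normal,
    hence the rate - k * \<phi> for the angle.\<close>
  define k where "k = c1 / a t0"
  define \<Phi> where "\<Phi> = (\<lambda>s p. (t0 + s * (c2 * \<phi> p), cos (\<alpha> - s * (k * \<phi> p)) *\<^sub>R cis (fst p),
    sin (\<alpha> - s * (k * \<phi> p)) *\<^sub>R cis (snd p)))"
  have per: "\<phi> (x + 2 * pi, y) = \<phi> (x, y)" "\<phi> (x, y + 2 * pi) = \<phi> (x, y)" for x y
    using \<phi> by (auto simp: torus_smooth_def doubly_periodic_def)
  have "smooth_on ({-1<..<1} \<times> UNIV) (\<lambda>(s, p). \<Phi> s p)"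
  proof -
    let ?S = "{-1<..<1::real} \<times> (UNIV :: param set)"
    have S: "open ?S" by (intro open_Times open_greaterThanLessThan open_UNIV)
    have \<phi>': "C_on n ?S (\<lambda>z. \<phi> (snd z))" for n
      by (rule C_on_linear_comp[OF S bounded_linear_snd _ subset_UNIV])
        (use \<phi> in \<open>simp add: torus_smooth_def smooth_on_def\<close>)
    have ang: "C_on n ?S (\<lambda>z. \<alpha> - fst z * (k * \<phi> (snd z)))" for n
      by (intro C_on_diff C_on_mult C_on_const C_on_fst C_on_ident S \<phi>')
    show ?thesis
      unfolding smooth_on_def \<Phi>_def split_beta
      by (intro allI C_on_polar C_on_add C_on_mult C_on_const C_on_fst C_on_snd C_on_ident S \<phi>'
          C_on_real_comp[OF S C_on_cos_sin(1) ang] C_on_real_comp[OF S C_on_cos_sin(2) ang] subset_UNIV)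
  qed
  moreover have "doubly_periodic (\<Phi> s)" "range (\<Phi> s) \<subseteq> FLRW" for s
    by (auto simp: \<Phi>_def doubly_periodic_def per polar_in_FLRW)
  moreover have "\<Phi> 0 = clifford t0 \<alpha>"
    by (simp add: \<Phi>_def clifford_polar)
  moreover have "((\<lambda>s. \<Phi> s p) has_vector_derivative
      \<phi> p *\<^sub>R (c1 *\<^sub>R clifford_normal a t0 \<alpha> p + c2 *\<^sub>R d_t p)) (at 0)" for p
  proof -
    note sc = bounded_linear.has_vector_derivative[OF bounded_linear_scaleR_left]
    have 1: "((\<lambda>s. t0 + s * (c2 * \<phi> p)) has_vector_derivative c2 * \<phi> p) (at 0)"
      and 2: "((\<lambda>s. cos (\<alpha> - s * (k * \<phi> p))) has_vector_derivative sin \<alpha> * (k * \<phi> p)) (at 0)"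
      and 3: "((\<lambda>s. sin (\<alpha> - s * (k * \<phi> p))) has_vector_derivative - cos \<alpha> * (k * \<phi> p)) (at 0)"
      unfolding has_real_derivative_iff_has_vector_derivative[symmetric]
      by (auto intro!: derivative_eq_intros)
    have "\<phi> p *\<^sub>R (c1 *\<^sub>R clifford_normal a t0 \<alpha> p + c2 *\<^sub>R d_t p)
      = (c2 * \<phi> p, (sin \<alpha> * (k * \<phi> p)) *\<^sub>R cis (fst p), (- cos \<alpha> * (k * \<phi> p)) *\<^sub>R cis (snd p))"
      unfolding clifford_frame_polar k_def by (simp add: mult_ac)
    then show ?thesis
      unfolding \<Phi>_def using has_vector_derivative_Pair[OF 1 has_vector_derivative_Pair[OF sc[OF 2] sc[OF 3]]]
      by simp
  qed
  ultimately show ?thesis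
    unfolding variation_def by (intro exI[of _ \<Phi>] conjI exI[of _ 1]) auto
qed

lemma clifford_has_first_variation:
  fixes t0 c1 c2 :: real
  assumes a: "smooth_on UNIV a" "\<And>t. a t > 0" and \<alpha>: "0 < \<alpha>" "\<alpha> < pi / 2"
    and \<phi>: "torus_smooth \<phi>"
  defines "V \<equiv> \<lambda>p. c1 *\<^sub>R clifford_normal a t0 \<alpha> p + c2 *\<^sub>R d_t p"
  shows "has_first_variation (area a) (clifford t0 \<alpha>) (\<lambda>p. \<phi> p *\<^sub>R V p)
      ((clifford_H a t0 \<alpha> * c1 + clifford_P a t0 * c2) * surface_integral a (clifford t0 \<alpha>) \<phi>)"
    and "has_first_variation (willmore a) (clifford t0 \<alpha>) (\<lambda>p. \<phi> p *\<^sub>R V p)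
      (clifford_EL a t0 \<alpha> c1 c2 * surface_integral a (clifford t0 \<alpha>) \<phi>)"
  unfolding has_first_variation_def V_def
  using clifford_variation_exists[OF \<phi>] clifford_first_variation[OF a \<alpha> \<phi>] by blast+

section \<open>Integrals over the Clifford torus\<close>

lemma clifford_surface_integral:
  assumes "a t0 > 0" "0 < \<alpha>" "\<alpha> < pi / 2"
  shows "surface_integral a (clifford t0 \<alpha>) f
    = (a t0)\<^sup>2 * cos \<alpha> * sin \<alpha> * integral torus_box f"
proof -
  have c: "cos \<alpha> > 0" "sin \<alpha> > 0"
    using assms by (auto intro: cos_gt_zero sin_gt_zero)
  have "sqrt (gram_det a (clifford t0 \<alpha>) p) = (a t0)\<^sup>2 * cos \<alpha> * sin \<alpha>" for p
    unfolding clifford_gram_det using c assms(1)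
    by (intro real_sqrt_unique) (simp_all add: power_mult_distrib flip: power_mult)
  then show ?thesis
    by (simp add: surface_integral_def mult.commute)
qed

lemma integral_torus_box_const: "integral torus_box (\<lambda>p. c :: real) = 4 * pi\<^sup>2 * c"
  by (simp add: content_Pair power2_eq_square)

lemma integral_torus_box_cos:
  "integral torus_box (\<lambda>p. cos (fst p)) = 0" "integral torus_box (\<lambda>p. cos (2 * fst p)) = 0"
proof -
  have "((\<lambda>p::param. sin (fst p)) has_derivative (\<lambda>v. fst v * cos (fst p))) (at p)" for p
    by (auto intro!: derivative_eq_intros)
  from dirderiv_eqI[OF this] have "dirderiv e1 (\<lambda>p::param. sin (fst p)) = (\<lambda>p. cos (fst p))"
    by simp
  then show "integral torus_box (\<lambda>p. cos (fst p)) = 0"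
    using integral_periodic_dirderiv(1)[OF torus_smooth_cos_sin(2)] by simp
  have "((\<lambda>p::param. sin (2 * fst p)) has_derivative (\<lambda>v. 2 * fst v * cos (2 * fst p))) (at p)" for p
    by (auto intro!: derivative_eq_intros)
  from dirderiv_eqI[OF this] have "dirderiv e1 (\<lambda>p::param. sin (2 * fst p)) = (\<lambda>p. 2 * cos (2 * fst p))"
    by simp
  then show "integral torus_box (\<lambda>p. cos (2 * fst p)) = 0"
    using integral_periodic_dirderiv(1)[OF torus_smooth_cos_sin(3)] by simp
qed

section \<open>Small Clifford tori\<close>

text \<open>Sum of the coefficients of |H|^3 that remain in the estimate of the Euler-Lagrange
  expression for |\<beta>| \<le> 1. It depends neither on \<alpha> nor on \<beta>, so |H| exceeds it
  for small \<alpha>. Here \<rho> is the excess of 1 / (a(t0) sin \<alpha> cos \<alpha>)^2 over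
  H^2.\<close>

definition clifford_multiplier_bound :: "(real \<Rightarrow> real) \<Rightarrow> real \<Rightarrow> real" where
  "clifford_multiplier_bound a t0 =
    (let P = clifford_P a t0; \<rho> = 4 / (a t0)\<^sup>2; b = deriv a t0 / a t0; e = deriv (deriv a) t0 / a t0 - b\<^sup>2
     in 2 * \<bar>P\<bar> + 2 * \<rho> * \<bar>P\<bar> + 2 * \<bar>b\<bar> * (1 + \<bar>P\<bar>) + 4 * (\<bar>P\<bar> * \<bar>e\<bar>) * (1 + \<bar>P\<bar>) + P ^ 4)"

text \<open>Apart from the quartic terms everything is at most cubic in H, and |H| \<ge> 1 bounds
  the lower powers by |H|^3. The cubic coefficients are linear in \<beta>, which is where |\<beta>|
  \<le> 1 enters. In the application b is a' / a and e is its time derivative.\<close>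

lemma EL_polynomial_bound:
  fixes H P \<rho> b e \<beta> :: real
  assumes "\<bar>\<beta>\<bar> \<le> 1" "\<rho> \<ge> 0" and H: "\<bar>H\<bar> \<ge> 1"
  defines "c1 \<equiv> H - \<beta> * P" and "c2 \<equiv> \<beta> * H - P"
  shows "- 2 * H * c1 * (H\<^sup>2 + \<rho>) - 2 * H\<^sup>2 * c2 * b - 4 * P * e * c2 + (H\<^sup>2 - P\<^sup>2)\<^sup>2
    \<le> \<bar>H\<bar> ^ 3 * (2 * \<bar>P\<bar> + 2 * \<rho> * \<bar>P\<bar> + 2 * \<bar>b\<bar> * (1 + \<bar>P\<bar>) + 4 * (\<bar>P\<bar> * \<bar>e\<bar>) * (1 + \<bar>P\<bar>) + P ^ 4 - \<bar>H\<bar>)"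
proof -
  define x where "x = \<bar>H\<bar>"
  have x: "x \<ge> 1" "x \<ge> 0" using H by (auto simp: x_def)
  have x3: "1 \<le> x ^ 3" "x \<le> x ^ 3" using x(1) self_le_power[of x 3] by auto
  have bP: "\<bar>\<beta> * P\<bar> \<le> \<bar>P\<bar>"
    using mult_right_mono[OF assms(1), of "\<bar>P\<bar>"] by (simp add: abs_mult)
  have c2: "\<bar>c2\<bar> \<le> (1 + \<bar>P\<bar>) * x"
  proof -
    have "\<bar>\<beta> * H\<bar> \<le> x"
      using mult_right_mono[OF assms(1), of "\<bar>H\<bar>"] by (simp add: abs_mult x_def)
    moreover have "\<bar>P\<bar> \<le> \<bar>P\<bar> * x" using mult_left_mono[OF x(1), of "\<bar>P\<bar>"] by simp
    ultimately show ?thesis unfolding c2_def by (simp add: algebra_simps)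
  qed
  have t1: "2 * (\<beta> * P) * H ^ 3 \<le> 2 * \<bar>P\<bar> * x ^ 3"
  proof -
    have "\<beta> * P * H ^ 3 \<le> \<bar>\<beta> * P\<bar> * \<bar>H ^ 3\<bar>" by (metis abs_ge_self abs_mult)
    also have "\<dots> \<le> \<bar>P\<bar> * x ^ 3" unfolding x_def power_abs by (intro mult_right_mono bP) simp
    finally show ?thesis by simp
  qed
  have t2: "2 * \<rho> * (\<beta> * P) * H \<le> 2 * \<rho> * \<bar>P\<bar> * x ^ 3"
  proof -
    have "\<beta> * P * H \<le> \<bar>\<beta> * P\<bar> * \<bar>H\<bar>" by (metis abs_ge_self abs_mult)
    also have "\<dots> \<le> \<bar>P\<bar> * x ^ 3" using x3(2) by (intro mult_mono bP) (simp_all add: x_def)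
    finally have "\<rho> * (\<beta> * P * H) \<le> \<rho> * (\<bar>P\<bar> * x ^ 3)" by (rule mult_left_mono) (rule assms(2))
    then show ?thesis by (simp add: mult.assoc)
  qed
  have t3: "- (2 * H\<^sup>2 * c2 * b) \<le> 2 * \<bar>b\<bar> * (1 + \<bar>P\<bar>) * x ^ 3"
  proof -
    have "- (H\<^sup>2 * c2 * b) \<le> \<bar>H\<^sup>2 * c2 * b\<bar>" by simp
    also have "\<dots> = \<bar>b\<bar> * (x\<^sup>2 * \<bar>c2\<bar>)" by (simp add: abs_mult x_def)
    also have "\<dots> \<le> \<bar>b\<bar> * (x\<^sup>2 * ((1 + \<bar>P\<bar>) * x))" by (intro mult_left_mono c2) simp_all
    finally show ?thesis by (simp add: power_numeral_reduce algebra_simps)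
  qed
  have t4: "- (4 * P * e * c2) \<le> 4 * (\<bar>P\<bar> * \<bar>e\<bar>) * (1 + \<bar>P\<bar>) * x ^ 3"
  proof -
    have "- (P * e * c2) \<le> \<bar>P * e * c2\<bar>" by simp
    also have "\<dots> = \<bar>P\<bar> * \<bar>e\<bar> * \<bar>c2\<bar>" by (simp add: abs_mult)
    also have "\<dots> \<le> \<bar>P\<bar> * \<bar>e\<bar> * ((1 + \<bar>P\<bar>) * x)" by (intro mult_left_mono c2) simp_all
    also have "\<dots> \<le> \<bar>P\<bar> * \<bar>e\<bar> * ((1 + \<bar>P\<bar>) * x ^ 3)" by (intro mult_left_mono x3(2)) simp_all
    finally show ?thesis by (simp add: algebra_simps)
  qed
  have t5: "P ^ 4 \<le> P ^ 4 * x ^ 3"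
    using mult_left_mono[OF x3(1), of "P ^ 4"] by simp
  have H4: "H ^ 4 = x ^ 3 * x"
    by (simp add: x_def power_numeral_reduce abs_mult_self_eq flip: abs_mult)
  have "- 2 * H * c1 * (H\<^sup>2 + \<rho>) - 2 * H\<^sup>2 * c2 * b - 4 * P * e * c2 + (H\<^sup>2 - P\<^sup>2)\<^sup>2
    = - (H ^ 4) + 2 * (\<beta> * P) * H ^ 3 - 2 * \<rho> * H\<^sup>2 + 2 * \<rho> * (\<beta> * P) * H - 2 * H\<^sup>2 * c2 * b
      - 4 * P * e * c2 - 2 * H\<^sup>2 * P\<^sup>2 + P ^ 4"
    by (simp add: c1_def algebra_simps power_numeral_reduce)
  also have "\<dots> \<le> - (x ^ 3 * x) + 2 * \<bar>P\<bar> * x ^ 3 + 2 * \<rho> * \<bar>P\<bar> * x ^ 3 + 2 * \<bar>b\<bar> * (1 + \<bar>P\<bar>) * x ^ 3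
      + 4 * (\<bar>P\<bar> * \<bar>e\<bar>) * (1 + \<bar>P\<bar>) * x ^ 3 + P ^ 4 * x ^ 3"
  proof -
    \<comment> \<open>The terms - 2 \<rho> H^2 and - 2 H^2 P^2 are discarded by their sign.\<close>
    have "0 \<le> \<rho> * H\<^sup>2" "0 \<le> H\<^sup>2 * P\<^sup>2" using assms(2) by simp_all
    then show ?thesis using t1 t2 t3 t4 t5 H4 by linarith
  qed
  also have "\<dots> = x ^ 3 * (2 * \<bar>P\<bar> + 2 * \<rho> * \<bar>P\<bar> + 2 * \<bar>b\<bar> * (1 + \<bar>P\<bar>) + 4 * (\<bar>P\<bar> * \<bar>e\<bar>) * (1 + \<bar>P\<bar>) + P ^ 4 - x)"
    by (simp add: algebra_simps)
  finally show ?thesis by (simp add: x_def)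
qed

lemma clifford_EL_le:
  assumes r: "a t0 > 0" and \<alpha>: "0 < \<alpha>" "\<alpha> < pi / 2" and "\<bar>\<beta>\<bar> \<le> 1"
  defines "H \<equiv> clifford_H a t0 \<alpha>" and "P \<equiv> clifford_P a t0"
  assumes H: "\<bar>H\<bar> \<ge> 1"
  shows "clifford_EL a t0 \<alpha> (H - \<beta> * P) (\<beta> * H - P)
    \<le> \<bar>H\<bar> ^ 3 * (clifford_multiplier_bound a t0 - \<bar>H\<bar>)"
proof -
  have c: "cos \<alpha> > 0" "sin \<alpha> > 0"
    using \<alpha> by (auto intro: cos_gt_zero sin_gt_zero)
  define s where "s = sin \<alpha>"
  define c where "c = cos \<alpha>"
  have nz: "c \<noteq> 0" "s \<noteq> 0" "a t0 \<noteq> 0" and sc: "s\<^sup>2 + c\<^sup>2 = 1"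
    using c r by (auto simp: s_def c_def)
  \<comment> \<open>Inserting (s^2 + c^2)^2 = (s^2 - c^2)^2 + 4 s^2 c^2 splits the quotient into H^2
    and 4 / a(t0)^2.\<close>
  have "1 / (a t0 * s * c)\<^sup>2 = (s\<^sup>2 + c\<^sup>2)\<^sup>2 / (a t0 * s * c)\<^sup>2" by (simp add: sc)
  also have "\<dots> = ((s / c - c / s) / a t0)\<^sup>2 + 4 / (a t0)\<^sup>2"
    using nz by (simp add: field_simps power2_eq_square)
  finally have id: "1 / (a t0 * sin \<alpha> * cos \<alpha>)\<^sup>2 = H\<^sup>2 + 4 / (a t0)\<^sup>2"
    unfolding H_def clifford_H_def s_def c_def .
  have E: "- 2 * H * (H - \<beta> * P) / (a t0 * sin \<alpha> * cos \<alpha>)\<^sup>2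
      = - 2 * H * (H - \<beta> * P) * (H\<^sup>2 + 4 / (a t0)\<^sup>2)"
    unfolding id[symmetric] by simp
  have Q: "H * (H - \<beta> * P) + P * (\<beta> * H - P) = H\<^sup>2 - P\<^sup>2"
    by (simp add: algebra_simps power2_eq_square)
  have "clifford_EL a t0 \<alpha> (H - \<beta> * P) (\<beta> * H - P)
    = - 2 * H * (H - \<beta> * P) * (H\<^sup>2 + 4 / (a t0)\<^sup>2) - 2 * H\<^sup>2 * (\<beta> * H - P) * (deriv a t0 / a t0)
      - 4 * P * (deriv (deriv a) t0 / a t0 - (deriv a t0 / a t0)\<^sup>2) * (\<beta> * H - P) + (H\<^sup>2 - P\<^sup>2)\<^sup>2"
    unfolding clifford_EL_def H_def[symmetric] P_def[symmetric] Q E power2_eq_square[of "H\<^sup>2 - P\<^sup>2"] by simp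
  also have "\<dots> \<le> \<bar>H\<bar> ^ 3 * (clifford_multiplier_bound a t0 - \<bar>H\<bar>)"
    unfolding clifford_multiplier_bound_def Let_def P_def[symmetric]
    by (rule EL_polynomial_bound[OF assms(4) _ H]) simp
  finally show ?thesis .
qed

text \<open>Here - a(t0) H = cot \<alpha> - tan \<alpha>, where tan \<alpha> \<le> 1 below \<pi>/4,
  and cot \<alpha> \<ge> 1 / (2 \<alpha>) by sin \<alpha> \<le> \<alpha> and cos \<alpha> \<ge> 1 /
  2. The bound on the cosine is stated as well for the gradient term of the test function.\<close>

lemma clifford_H_large:
  assumes r: "a t0 > 0" and M: "M \<ge> 0" and \<alpha>: "0 < \<alpha>" "\<alpha> < pi / 4" "\<alpha> < 1 / (2 * (a t0 * M + 1))"
  shows "\<bar>clifford_H a t0 \<alpha>\<bar> > M" "cos \<alpha> \<ge> 1 / 2"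
proof -
  have c: "cos \<alpha> \<ge> cos (pi / 4)" "sin \<alpha> \<le> sin (pi / 4)"
    using \<alpha> by (auto intro!: cos_monotone_0_pi_le sin_monotone_2pi_le)
  have "cos \<alpha> \<ge> cos (pi / 3)"
    using \<alpha> by (intro cos_monotone_0_pi_le) auto
  then show ch: "cos \<alpha> \<ge> 1 / 2" by (simp add: cos_60)
  have s: "sin \<alpha> > 0" "sin \<alpha> \<le> \<alpha>" using \<alpha> by (auto intro!: sin_gt_zero sin_x_le_x)
  have "sin \<alpha> / cos \<alpha> \<le> 1" using c ch by (simp add: sin_45 cos_45 divide_le_eq)
  moreover have "cos \<alpha> / sin \<alpha> \<ge> (1 / 2) / \<alpha>"
    using ch s \<alpha>(1) by (intro frac_le) auto
  moreover have "(1 / 2) / \<alpha> > a t0 * M + 1"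
  proof -
    have "a t0 * M + 1 > 0" using r M by (simp add: add_nonneg_pos)
    then show ?thesis using \<alpha>(1,3) by (simp add: field_simps)
  qed
  ultimately have "a t0 * M < cos \<alpha> / sin \<alpha> - sin \<alpha> / cos \<alpha>" by linarith
  then have "M < (cos \<alpha> / sin \<alpha> - sin \<alpha> / cos \<alpha>) / a t0"
    using r by (simp add: less_divide_eq mult.commute)
  also have "\<dots> = - clifford_H a t0 \<alpha>" by (simp add: clifford_H_def diff_divide_distrib)
  finally show "\<bar>clifford_H a t0 \<alpha>\<bar> > M" by simp
qed

lemma clifford_V_dir:
  assumes "a t0 > 0" "0 < \<alpha>" "\<alpha> < pi / 2"
  defines "H \<equiv> clifford_H a t0 \<alpha>" and "P \<equiv> clifford_P a t0"
  shows "V_dir a t0 \<alpha> \<beta> = (\<lambda>p. (H - \<beta> * P) *\<^sub>R clifford_normal a t0 \<alpha> p + (\<beta> * H - P) *\<^sub>R d_t p)"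
    and "vecH a (clifford t0 \<alpha>) = (\<lambda>p. H *\<^sub>R clifford_normal a t0 \<alpha> p + (- P) *\<^sub>R d_t p)"
  unfolding H_def P_def
  by (auto simp: fun_eq_iff V_dir_def vecH_star_def clifford_vecH[where a = a, OF assms(1-3)]
      clifford_mean_curv'[where a = a, OF assms(1-3)] algebra_simps simp del: scaleR_Pair)

lemma clifford_frame_nonzero:
  assumes "a t0 > 0" and "c1 *\<^sub>R clifford_normal a t0 \<alpha> p + c2 *\<^sub>R d_t p = 0"
  shows "c1 = 0" "c2 = 0"
proof -
  have 0: "c2 = 0" "(c1 * sin \<alpha> / a t0) *\<^sub>R cis (fst p) = 0" "(- (c1 * cos \<alpha> / a t0)) *\<^sub>R cis (snd p) = 0"
    using assms(2) unfolding clifford_frame_polar by (simp_all only: zero_prod_def prod.inject)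
  then have "c1 * sin \<alpha> = 0" "c1 * cos \<alpha> = 0" using assms(1) by auto
  then show "c1 = 0" using sin_zero_abs_cos_one[of \<alpha>] by auto
  show "c2 = 0" by (rule 0(1))
qed

theorem proposition6p8:
  fixes a :: "real \<Rightarrow> real" and t0 :: real
  assumes "smooth_on UNIV a" and "\<And>t. a t > 0"
  shows "\<exists>\<alpha>0>0. \<forall>\<alpha>. 0 < \<alpha> \<and> \<alpha> < \<alpha>0 \<and> \<alpha> < pi / 2 \<longrightarrow>
     stcmc a (clifford t0 \<alpha>) \<and>
     (\<forall>\<beta>. area_constrained_willmore a (clifford t0 \<alpha>) (V_dir a t0 \<alpha> \<beta>) \<and>
          (\<exists>l. lagrange_multiplier a (clifford t0 \<alpha>) (V_dir a t0 \<alpha> \<beta>) l)) \<and>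
     (\<forall>\<beta> l. \<bar>\<beta>\<bar> \<le> 1 \<and> lagrange_multiplier a (clifford t0 \<alpha>) (V_dir a t0 \<alpha> \<beta>) l \<longrightarrow> l < 0) \<and>
     constant_mode_unstable a (clifford t0 \<alpha>) \<and>
     variationally_unstable a (clifford t0 \<alpha>)"
proof -
  define P where "P = clifford_P a t0"
  \<comment> \<open>The summands secure |H| \<ge> 1, then Q > 0, then a negative Euler-Lagrange
    expression, and finally room for the gradient term \<open>K\<close> of the test
    function.\<close>
  define M where "M = 1 + \<bar>P\<bar> + clifford_multiplier_bound a t0 + 8 / (a t0)\<^sup>2"
  have r: "a t0 > 0" by (rule assms(2))
  have B: "clifford_multiplier_bound a t0 \<ge> 0"
    by (simp add: clifford_multiplier_bound_def Let_def)
  have M: "M \<ge> 0" using B by (simp add: M_def)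
  show ?thesis
  proof (rule exI[of _ "min (pi / 4) (1 / (2 * (a t0 * M + 1)))"], rule conjI[OF _ allI[OF impI]])
    show "0 < min (pi / 4) (1 / (2 * (a t0 * M + 1)))"
      using r M by (simp add: add_nonneg_pos)
  next
    fix \<alpha> assume "0 < \<alpha> \<and> \<alpha> < min (pi / 4) (1 / (2 * (a t0 * M + 1))) \<and> \<alpha> < pi / 2"
    then have \<alpha>: "0 < \<alpha>" "\<alpha> < pi / 2" "\<alpha> < pi / 4" "\<alpha> < 1 / (2 * (a t0 * M + 1))" by auto
    let ?F = "clifford t0 \<alpha>"
    define H where "H = clifford_H a t0 \<alpha>"
    define Q where "Q = H\<^sup>2 - P\<^sup>2"
    define EL where "EL \<beta> = clifford_EL a t0 \<alpha> (H - \<beta> * P) (\<beta> * H - P)" for \<beta>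
    have Hlarge: "\<bar>H\<bar> > M" and cos: "cos \<alpha> \<ge> 1 / 2"
      unfolding H_def using clifford_H_large[where a = a, OF r M \<alpha>(1,3,4)] .
    have cs: "cos \<alpha> > 0" "sin \<alpha> > 0"
      using \<alpha> by (auto intro: cos_gt_zero sin_gt_zero)
    have r0: "8 / (a t0)\<^sup>2 \<ge> 0" by simp
    have H1: "\<bar>H\<bar> \<ge> 1" and HP: "\<bar>H\<bar> > \<bar>P\<bar>" and HB: "\<bar>H\<bar> > clifford_multiplier_bound a t0 + 8 / (a t0)\<^sup>2"
      using Hlarge B r0 unfolding M_def by linarith+
    have Q: "Q > 0" using HP by (simp add: Q_def abs_le_square_iff[symmetric] not_le[symmetric])
    have EL: "EL \<beta> \<le> \<bar>H\<bar> ^ 3 * (clifford_multiplier_bound a t0 - \<bar>H\<bar>)" if "\<bar>\<beta>\<bar> \<le> 1" for \<beta>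
      unfolding EL_def H_def P_def
      by (rule clifford_EL_le[where a = a, OF r \<alpha>(1,2) that]) (use H1 in \<open>simp add: H_def\<close>)
    have H3: "\<bar>H\<bar> ^ 3 > 0" using H1 by simp
    have EL_neg: "EL \<beta> < 0" if "\<bar>\<beta>\<bar> \<le> 1" for \<beta>
    proof -
      have "\<bar>H\<bar> ^ 3 * (clifford_multiplier_bound a t0 - \<bar>H\<bar>) < 0"
        using H3 HB r0 by (intro mult_pos_neg) linarith+
      then show ?thesis using EL[OF that] by linarith
    qed
    have Qc: "H * (H - \<beta> * P) + P * (\<beta> * H - P) = Q" for \<beta>
      by (simp add: Q_def algebra_simps power2_eq_square)
    note V = clifford_V_dir[where a = a, OF r \<alpha>(1,2), folded H_def P_def]
    have fv: "has_first_variation (area a) ?F (\<lambda>p. \<phi> p *\<^sub>R V_dir a t0 \<alpha> \<beta> p) (Q * surface_integral a ?F \<phi>)"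
      "has_first_variation (willmore a) ?F (\<lambda>p. \<phi> p *\<^sub>R V_dir a t0 \<alpha> \<beta> p) (EL \<beta> * surface_integral a ?F \<phi>)"
      if "torus_smooth \<phi>" for \<phi> \<beta>
      using clifford_has_first_variation[OF assms \<alpha>(1,2) that, of t0 "H - \<beta> * P" "\<beta> * H - P"]
      unfolding V EL_def H_def[symmetric] P_def[symmetric] Qc by simp_all
    define \<kappa> where "\<kappa> = (a t0)\<^sup>2 * cos \<alpha> * sin \<alpha>"
    have \<kappa>: "\<kappa> > 0" using r cs by (simp add: \<kappa>_def)
    have si: "surface_integral a ?F h = \<kappa> * integral torus_box h" for h
      unfolding \<kappa>_def by (rule clifford_surface_integral[where a = a, OF r \<alpha>(1,2)])
    have H_sq: "vecH_sq a ?F p = Q" for p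
      unfolding Q_def H_def P_def by (rule clifford_vecH_sq[where a = a, OF r \<alpha>(1,2)])
    have space: "spacelike_torus a ?F" by (rule clifford_spacelike_torus[where a = a, OF r \<alpha>(1,2)])
    have st: "stcmc a ?F" using space H_sq by (auto simp: stcmc_def)
    have lm: "lagrange_multiplier a ?F (V_dir a t0 \<alpha> \<beta>) (EL \<beta> / Q)" for \<beta>
      unfolding lagrange_multiplier_def
    proof (intro allI impI)
      fix \<phi> :: "param \<Rightarrow> real" assume \<phi>: "torus_smooth \<phi>"
      have "EL \<beta> / Q * (Q * surface_integral a ?F \<phi>) = EL \<beta> * surface_integral a ?F \<phi>"
        using Q by simp
      with fv[OF \<phi>, of \<beta>] show "\<exists>d. has_first_variation (area a) ?F (\<lambda>p. \<phi> p *\<^sub>R V_dir a t0 \<alpha> \<beta> p) d \<and>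
          has_first_variation (willmore a) ?F (\<lambda>p. \<phi> p *\<^sub>R V_dir a t0 \<alpha> \<beta> p) (EL \<beta> / Q * d)"
        by (intro exI[of _ "Q * surface_integral a ?F \<phi>"]) simp
    qed
    \<comment> \<open>Uniqueness relies on the existence of a variation, which
      \<open>has_first_variation\<close> includes.\<close>
    have unique: "d = d'" if "has_first_variation J F W d" "has_first_variation J F W d'" for J F W d d'
      using that DERIV_unique unfolding has_first_variation_def by blast
    have neg: "l < 0" if \<beta>: "\<bar>\<beta>\<bar> \<le> 1" and l: "lagrange_multiplier a ?F (V_dir a t0 \<alpha> \<beta>) l" for \<beta> l
    proof -
      \<comment> \<open>Testing with \<phi> = 1, where the area variation Q * \<mu> is nonzero, pins
        the multiplier down to \<open>EL \<beta> / Q\<close>.\<close>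
      have one: "torus_smooth (\<lambda>p. 1 :: real)" by (rule torus_smooth_const)
      define \<mu> where "\<mu> = surface_integral a ?F (\<lambda>p. 1)"
      have \<mu>: "\<mu> > 0" using \<kappa> by (simp only: \<mu>_def si integral_torus_box_const) simp
      obtain d where "has_first_variation (area a) ?F (\<lambda>p. 1 *\<^sub>R V_dir a t0 \<alpha> \<beta> p) d"
        "has_first_variation (willmore a) ?F (\<lambda>p. 1 *\<^sub>R V_dir a t0 \<alpha> \<beta> p) (l * d)"
        using l one unfolding lagrange_multiplier_def by blast
      then have "d = Q * \<mu>" "l * d = EL \<beta> * \<mu>"
        using unique fv[OF one, of \<beta>] unfolding \<mu>_def by blast+
      then have "l * Q = EL \<beta>" using \<mu> by simp
      then show ?thesis using EL_neg[OF \<beta>] Q by (metis mult_less_0_iff not_less_iff_gr_or_eq)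
    qed
    have acw: "area_constrained_willmore a ?F (V_dir a t0 \<alpha> \<beta>)" for \<beta>
      unfolding area_constrained_willmore_def
    proof (intro conjI allI impI)
      show "spacelike_torus a ?F" by (rule space)
      show "normal_field a ?F (V_dir a t0 \<alpha> \<beta>)"
        unfolding V by (rule clifford_normal_field[where a = a, OF r])
      show "V_dir a t0 \<alpha> \<beta> p \<noteq> 0" for p
      proof
        assume "V_dir a t0 \<alpha> \<beta> p = 0"
        then have "H - \<beta> * P = 0" "\<beta> * H - P = 0"
          unfolding V using clifford_frame_nonzero[where a = a, OF r] by blast+
        \<comment> \<open>The metric product of the direction with \<open>vecH\<close> is Q, so a
          vanishing direction would force Q = 0.\<close>
        then have "H * (H - \<beta> * P) + P * (\<beta> * H - P) = 0"
          by (simp only: mult_zero_right add_0_left)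
        then show False using Qc[of \<beta>] Q by linarith
      qed
    next
      fix \<phi> :: "param \<Rightarrow> real" and \<Phi>
      assume h: "torus_smooth \<phi> \<and> variation ?F (\<lambda>p. \<phi> p *\<^sub>R V_dir a t0 \<alpha> \<beta> p) \<Phi> \<and>
        (\<forall>\<^sub>F s in nhds 0. area a (\<Phi> s) = area a ?F)"
      \<comment> \<open>Both derivatives are multiples of the integral of \<phi>, and area
        preservation makes that integral zero since Q > 0.\<close>
      then have "((\<lambda>s. area a (\<Phi> s)) has_real_derivative Q * surface_integral a ?F \<phi>) (at 0)"
        and W: "((\<lambda>s. willmore a (\<Phi> s)) has_real_derivative EL \<beta> * surface_integral a ?F \<phi>) (at 0)"
        using fv[of \<phi> \<beta>] unfolding has_first_variation_def by blast+
      moreover have "((\<lambda>s. area a (\<Phi> s)) has_real_derivative 0) (at 0)"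
        by (subst DERIV_cong_ev[OF refl _ refl, of _ "\<lambda>s. area a ?F"]) (use h in auto)
      ultimately have "Q * surface_integral a ?F \<phi> = 0" by (rule_tac DERIV_unique)
      then have "surface_integral a ?F \<phi> = 0" using Q by simp
      then show "((\<lambda>s. willmore a (\<Phi> s)) has_real_derivative 0) (at 0)" using W by simp
    qed

    \<comment> \<open>The direction \<open>vecH\<close> is the case \<beta> = 0, and the gradient is
      a constant function because all coefficients on the torus are constant.\<close>
    define w where "w = EL 0"
    have wg: "willmore_gradient a ?F (\<lambda>p. w)"
      unfolding willmore_gradient_def
    proof (intro conjI allI impI torus_smooth_const)
      fix \<phi> :: "param \<Rightarrow> real" assume \<phi>: "torus_smooth \<phi>"
      have "surface_integral a ?F (\<lambda>p. \<phi> p * w) = w * surface_integral a ?F \<phi>"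
        unfolding si integral_mult_left by simp
      moreover have "V_dir a t0 \<alpha> 0 = vecH a ?F" by (simp add: V_dir_def fun_eq_iff)
      ultimately show "has_first_variation (willmore a) ?F (\<lambda>p. \<phi> p *\<^sub>R vecH a ?F p)
          (surface_integral a ?F (\<lambda>p. \<phi> p * w))"
        using fv(2)[OF \<phi>, of 0] by (simp only: w_def)
    qed
    have w: "w < 0" unfolding w_def by (rule EL_neg) simp
    have cm: "constant_mode_unstable a ?F"
      unfolding constant_mode_unstable_def
    proof (intro conjI exI[of _ "\<lambda>p. w"] st wg)
      have "grad_sq a ?F (\<lambda>p. 1) p = 0" for p
        by (simp add: grad_sq_def clifford_tr_h[where a = a, OF r \<alpha>(1,2)])
      then have "second_variation a ?F (\<lambda>p. w) (\<lambda>p. 1) = \<kappa> * (4 * pi\<^sup>2 * w)"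
        unfolding second_variation_def si H_sq by (simp only: integral_torus_box_const[symmetric]) simp
      then show "second_variation a ?F (\<lambda>p. w) (\<lambda>p. 1) < 0"
        using w \<kappa> by (simp add: mult_pos_neg mult_neg_pos)
    qed
    \<comment> \<open>For u = cos x one has 2 Q |grad u|^2 = K sin^2 x, as the x-circle has radius
      a(t0) cos \<alpha>. Averaging over the torus reduces the instability to K + w < 0.\<close>
    define K where "K = 2 * Q / (a t0 * cos \<alpha>)\<^sup>2"
    have "K + w < 0"
    proof -
      have "K \<le> 2 * H\<^sup>2 / (a t0 * (1 / 2))\<^sup>2"
        unfolding K_def using Q r cos by (intro frac_le power_mono mult_left_mono) (simp_all add: Q_def)
      also have "\<dots> = \<bar>H\<bar>\<^sup>2 * (8 / (a t0)\<^sup>2)"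
        using r by (simp add: field_simps power2_eq_square)
      \<comment> \<open>One power of |H| \<ge> 1 is spent to match the cubic factor in the bound on
        w; this explains the summand 8 / a(t0)^2 of \<open>M\<close>.\<close>
      also have "\<dots> \<le> \<bar>H\<bar> ^ 3 * (8 / (a t0)\<^sup>2)"
        using H1 by (intro mult_right_mono power_increasing) auto
      finally have "K + w \<le> \<bar>H\<bar> ^ 3 * (8 / (a t0)\<^sup>2) + \<bar>H\<bar> ^ 3 * (clifford_multiplier_bound a t0 - \<bar>H\<bar>)"
        unfolding w_def using EL[of 0] by simp
      also have "\<dots> = \<bar>H\<bar> ^ 3 * (8 / (a t0)\<^sup>2 + clifford_multiplier_bound a t0 - \<bar>H\<bar>)"
        by (simp add: algebra_simps)
      also have "\<dots> < 0"
        using H3 HB by (intro mult_pos_neg) linarith+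
      finally show ?thesis .
    qed
    have vu: "variationally_unstable a ?F"
      unfolding variationally_unstable_def
    proof (rule conjI[OF st], rule exI[of _ "\<lambda>p. w"], rule exI[of _ "\<lambda>p. cos (fst p)"], intro conjI wg)
      let ?u = "\<lambda>p :: param. cos (fst p)"
      show "torus_smooth ?u" by (rule torus_smooth_cos_sin)
      show "surface_integral a ?F ?u = 0" unfolding si integral_torus_box_cos by simp
      have "(?u has_derivative (\<lambda>v. - (fst v * sin (fst p)))) (at p)" for p
        by (auto intro!: derivative_eq_intros)
      note du = dirderiv_eqI[OF this]
      have grad: "grad_sq a ?F ?u p = (sin (fst p))\<^sup>2 / (a t0 * cos \<alpha>)\<^sup>2" for p
        by (simp add: grad_sq_def clifford_tr_h[where a = a, OF r \<alpha>(1,2)] du power2_eq_square)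
      \<comment> \<open>The double-angle formulas isolate the mean (K + w) / 2; the remaining cos 2x
        integrates to zero.\<close>
      have "2 * vecH_sq a ?F p * grad_sq a ?F ?u p + w * (?u p)\<^sup>2
        = (K + w) / 2 + (w - K) / 2 * cos (2 * fst p)" for p
      proof -
        have KQ: "2 * Q * ((sin (fst p))\<^sup>2 / (a t0 * cos \<alpha>)\<^sup>2) = K * (sin (fst p))\<^sup>2"
          by (simp add: K_def)
        show ?thesis
          unfolding H_sq grad KQ unfolding cos_double sin_squared_eq by (simp add: field_simps)
      qed
      then have "second_variation a ?F (\<lambda>p. w) ?u
        = \<kappa> * integral torus_box (\<lambda>p. (K + w) / 2 + (w - K) / 2 * cos (2 * fst p))"
        unfolding second_variation_def si by simp
      also have "integral torus_box (\<lambda>p. (K + w) / 2 + (w - K) / 2 * cos (2 * fst p)) = 4 * pi\<^sup>2 * ((K + w) / 2)"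
        by (subst Henstock_Kurzweil_Integration.integral_add)
          (auto intro!: integrable_continuous continuous_intros
            simp only: integral_torus_box_const integral_mult_right integral_torus_box_cos)
      finally show "second_variation a ?F (\<lambda>p. w) ?u < 0"
        using \<kappa> \<open>K + w < 0\<close> by (simp add: mult_pos_neg mult_neg_pos)
    qed
    show "stcmc a ?F \<and>
      (\<forall>\<beta>. area_constrained_willmore a ?F (V_dir a t0 \<alpha> \<beta>) \<and>
        (\<exists>l. lagrange_multiplier a ?F (V_dir a t0 \<alpha> \<beta>) l)) \<and>
      (\<forall>\<beta> l. \<bar>\<beta>\<bar> \<le> 1 \<and> lagrange_multiplier a ?F (V_dir a t0 \<alpha> \<beta>) l \<longrightarrow> l < 0) \<and>
      constant_mode_unstable a ?F \<and> variationally_unstable a ?F"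
      using st acw lm neg cm vu by blast
  qed
qed

end
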